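(* Let $(X_i)_{i\in\mathbb N}$ be a stationary process of $\mathbb R^d$-valued random vectors whose multidimensional distribution function $F$ is continuous. Assume there is a vector space $\mathcal G$ of measurable functions $\mathbb R^d\to\mathbb R$, containing the constant functions and equipped with a seminorm $\|\cdot\|_{\mathcal G}$, such that: (i) for every $f\in\mathcal G$ with $\|f\|_\infty<\infty$ and ${\rm E}f(X_0)=0$ there is $\sigma_f^2<\infty$ with $\frac1{\sqrt n}\sum_{i=1}^n f(X_i)\to N(0,\sigma_f^2)$ in distribution; (ii) $\mathcal G$ approximates the indicator functions with a $(\mathcal G,F)$-control function $\Psi$; (iii) there are constants $r\ge1$, an integer $p>rd$, real numbers $\gamma_1,\dots,\gamma_p$ with $0\le\gamma_i<\frac ir+2(p-i)-d$ for all $i=1,\dots,p$, and nondecreasing functions $\Phi_1,\dots,\Phi_p:\mathbb R_0^+\to\mathbb R_0^+$ with $\Phi_i(2\Psi(z))=\mathcal O(z^{\gamma_i})$ as $z\to\infty$, such that the moment bound (M) holds with these $C,r,p,\Phi_1,\dots,\Phi_p$ for every $f\in\mathcal G$ with $\|f\|_\infty\le1$ and every $n\ge1$. Then the empirical CLT holds: there is a centered Gaussian process $(W(t))_{t\in[-\infty,\infty]^d}$ with almost surely continuous sample paths such that $U_n\to W$ in distribution in $\mathbb D([-\infty,\infty]^d)$.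
   Context: Inequalities between vectors of $[-\infty,\infty]^d$ are componentwise. $F(t)=P(X_0\le t)$, and $F_1,\dots,F_d$ denote the marginal distribution functions of $X_0$. The empirical process is $U_n(t)=\frac1{\sqrt n}\sum_{i=1}^n\big(\mathbf 1\{X_i\le t\}-F(t)\big)$, $t\in[-\infty,\infty]^d$, viewed as a random element of $\mathbb D([-\infty,\infty]^d)$, the space of multidimensional càdlàg functions on $[-\infty,\infty]^d$ with the multidimensional Skorokhod metric (a complete separable metric space). Modulus of continuity: for $g:\mathbb R^d\to\mathbb R$ (or $\mathbb R\to\mathbb R$), $w_g(\delta)=\sup\{|g(t)-g(s)|:\|t-s\|\le\delta\}$. $(\mathcal G,F)$-control function: a nondecreasing $\Psi:\mathbb R_0^+\to\mathbb R_0^+$ such that for every $a<b$ in $[-\infty,\infty]^d$ there is $\phi_{(a,b)}\in\mathcal G$ with $\mathbf 1\{x\le a\}\le\phi_{(a,b)}(x)\le\mathbf 1\{x\le b\}$ for all $x\in\mathbb R^d$ and $\|\phi_{(a,b)}\|_{\mathcal G}\le\Psi\big(1/\min_{i=1,\dots,d}w_{F_i}(b_i-a_i)\big)$. If such $\Psi$ exists, $\mathcal G$ is said to approximate the indicator functions with $(\mathcal G,F)$-control function $\Psi$. Moment bound (M) with constants $C>0$, $r\ge1$, $p\in\mathbb N^*$ and nondecreasing $\Phi_1,\dots,\Phi_p:\mathbb R_0^+\to\mathbb R_0^+$, for a function $f$: for all $n\ge1$, $${\rm E}\Big|\sum_{i=1}^n\big(f(X_i)-{\rm E}f(X_0)\big)\Big|^{2p}\le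 C\sum_{i=1}^p n^i\,\|f(X_0)-{\rm E}f(X_0)\|_r^i\,\Phi_i\big(\|f-{\rm E}f(X_0)\|_{\mathcal G}\big),$$ where $\|\cdot\|_r$ is the $L^r$ norm. *)

theory Defs
  imports "HOL-Analysis.Analysis" "HOL-Probability.Probability" "HOL-Library.Landau_Symbols"
begin

definition vle :: "real^'d \<Rightarrow> ereal^'d \<Rightarrow> bool" where
  "vle x t \<longleftrightarrow> (\<forall>i. ereal (x $ i) \<le> t $ i)"

definition evless :: "ereal^'d \<Rightarrow> ereal^'d \<Rightarrow> bool" where
  "evless a b \<longleftrightarrow> (\<forall>i. a $ i < b $ i)"

definition mdf :: "'a measure \<Rightarrow> ('a \<Rightarrow> real^'d) \<Rightarrow> ereal^'d \<Rightarrow> real" where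
  "mdf M Y t = measure M {\<omega> \<in> space M. vle (Y \<omega>) t}"

definition marginal_df :: "'a measure \<Rightarrow> ('a \<Rightarrow> real^'d) \<Rightarrow> 'd \<Rightarrow> real \<Rightarrow> real" where
  "marginal_df M Y i x = measure M {\<omega> \<in> space M. Y \<omega> $ i \<le> x}"

definition modulus :: "(real \<Rightarrow> real) \<Rightarrow> ereal \<Rightarrow> real" where
  "modulus g \<delta> = Sup {\<bar>g t - g s\<bar> | s t. ereal \<bar>t - s\<bar> \<le> \<delta>}"

definition control_function ::
  "(real^'d \<Rightarrow> real) set \<Rightarrow> ((real^'d \<Rightarrow> real) \<Rightarrow> real) \<Rightarrow> ('d \<Rightarrow> real \<Rightarrow> real)
     \<Rightarrow> (real \<Rightarrow> real) \<Rightarrow> bool" where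
  "control_function G normG Fm \<Psi> \<longleftrightarrow>
     mono_on {0..} \<Psi> \<and> (\<forall>z\<ge>0. \<Psi> z \<ge> 0) \<and>
     (\<forall>a b. evless a b \<longrightarrow>
        (\<exists>\<phi>\<in>G. (\<forall>x. indicator {x. vle x a} x \<le> \<phi> x \<and> \<phi> x \<le> indicator {x. vle x b} x) \<and>
               normG \<phi> \<le> \<Psi> (1 / (MIN i. modulus (Fm i) (b $ i - a $ i)))))"

definition normal_law :: "real \<Rightarrow> real measure" where
  "normal_law s2 = (if s2 > 0 then density lborel (\<lambda>x. ennreal (normal_density 0 (sqrt s2) x))
                    else return borel 0)"

definition stationary :: "'a measure \<Rightarrow> (nat \<Rightarrow> 'a \<Rightarrow> 'b::topological_space) \<Rightarrow> bool" where
  "stationary M X \<longleftrightarrow>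
     (\<forall>k. distr M (Pi\<^sub>M UNIV (\<lambda>_. borel)) (\<lambda>\<omega> i. X (i + k) \<omega>)
        = distr M (Pi\<^sub>M UNIV (\<lambda>_. borel)) (\<lambda>\<omega> i. X i \<omega>))"

definition empirical_process ::
  "'a measure \<Rightarrow> (nat \<Rightarrow> 'a \<Rightarrow> real^'d) \<Rightarrow> nat \<Rightarrow> 'a \<Rightarrow> ereal^'d \<Rightarrow> real" where
  "empirical_process M X n \<omega> t =
     (1 / sqrt n) * (\<Sum>i=1..n. indicator {x. vle x t} (X i \<omega>) - mdf M (X 0) t)"

definition quadrant :: "'d set \<Rightarrow> ereal^'d \<Rightarrow> (ereal^'d) set" where
  "quadrant S t = {s. \<forall>i. (i \<in> S \<longrightarrow> s $ i < t $ i) \<and> (i \<notin> S \<longrightarrow> t $ i \<le> s $ i)}"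

definition cadlag_multi :: "(ereal^'d \<Rightarrow> real) \<Rightarrow> bool" where
  "cadlag_multi x \<longleftrightarrow>
     (\<forall>t. (x \<longlongrightarrow> x t) (at t within quadrant {} t) \<and>
          (\<forall>S. \<exists>l. (x \<longlongrightarrow> l) (at t within quadrant S t)))"

definition Dspace :: "(ereal^'d \<Rightarrow> real) set" where
  "Dspace = {x. cadlag_multi x}"

definition to_unit :: "ereal \<Rightarrow> real" where
  "to_unit t = (case t of ereal r \<Rightarrow> 1/2 + arctan r / pi | PInfty \<Rightarrow> 1 | MInfty \<Rightarrow> 0)"

text \<open>Time changes: strictly increasing bijections of [-inf,inf] (hence homeomorphisms).\<close>
definition time_changes :: "(ereal \<Rightarrow> ereal) set" where
  "time_changes = {l. strict_mono l \<and> bij l}"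

definition skorokhod_dist :: "(ereal^'d \<Rightarrow> real) \<Rightarrow> (ereal^'d \<Rightarrow> real) \<Rightarrow> real" where
  "skorokhod_dist x y =
     (INF l \<in> {l :: 'd \<Rightarrow> ereal \<Rightarrow> ereal. \<forall>i. l i \<in> time_changes}.
        max (SUP t. \<bar>x t - y (\<chi> i. l i (t $ i))\<bar>)
            (SUP p. \<bar>to_unit (l (fst p) (snd p)) - to_unit (snd p)\<bar>))"

definition D_continuous :: "((ereal^'d \<Rightarrow> real) \<Rightarrow> real) \<Rightarrow> bool" where
  "D_continuous h \<longleftrightarrow>
     (\<forall>x\<in>Dspace. \<forall>e>0. \<exists>\<delta>>0. \<forall>y\<in>Dspace. skorokhod_dist x y < \<delta> \<longrightarrow> \<bar>h y - h x\<bar> < e)"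

definition D_bounded :: "((ereal^'d \<Rightarrow> real) \<Rightarrow> real) \<Rightarrow> bool" where
  "D_bounded h \<longleftrightarrow> (\<exists>B. \<forall>x\<in>Dspace. \<bar>h x\<bar> \<le> B)"

definition converges_in_distribution_D ::
  "'a measure \<Rightarrow> (nat \<Rightarrow> 'a \<Rightarrow> ereal^'d \<Rightarrow> real) \<Rightarrow> (ereal^'d \<Rightarrow> real) measure \<Rightarrow> bool" where
  "converges_in_distribution_D M Z N \<longleftrightarrow>
     (\<forall>n. \<forall>\<omega>\<in>space M. Z n \<omega> \<in> Dspace) \<and> (AE w in N. w \<in> Dspace) \<and>
     (\<forall>h. D_bounded h \<and> D_continuous h \<longrightarrow>
        h \<in> borel_measurable N \<and>
        ((\<lambda>n. LINT \<omega>|M. h (Z n \<omega>)) \<longlonglongrightarrow> (LINT w|N. h w)))"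

definition centered_gaussian_law :: "('i \<Rightarrow> real) measure \<Rightarrow> bool" where
  "centered_gaussian_law N \<longleftrightarrow> prob_space N \<and>
     (\<forall>T c. finite T \<longrightarrow>
        (let Y = (\<lambda>w. \<Sum>t\<in>T. c t * w t) in
          Y \<in> borel_measurable N \<and>
          ((AE w in N. Y w = 0) \<or>
           (\<exists>\<sigma>>0. distributed N lborel Y (\<lambda>x. ennreal (normal_density 0 \<sigma> x))))))"

end

(*
  Chaining along quantile grids. On the grid of mesh 2^-k in quantile coordinates, every indicator of
  an orthant {x <= t} is bracketed by elements of G with seminorm at most Psi(2^k). The moment bound
  controls the increments between neighbouring grid functions of mesh 2^-l as long as 4^l is at most a
  constant times n, with a geometrically decaying probability of failure; beyond that level the mean of
  the brackets is of order n^(-1/2) and can be absorbed. So, up to a small error, the empirical process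
  is a step function of finitely many normalised sums of elements of G.

  The limit is built directly: the hypothesis (i) and the uniform integrability coming from the moment
  bound give a limiting covariance kernel, a Cholesky factorisation realises it as a Gaussian family on
  the grid indices, and the same increment bounds, inherited in the limit, make the step functions
  converge uniformly to a continuous process W. Convergence of expectations of a Skorokhod continuous
  functional h needs no tightness theorem: W has continuous paths, so h is approximated from below near W
  by functionals that are Lipschitz for the uniform distance, and these only see the finitely many
  normalised sums.
*)

theory Submission
  imports Defs
begin

section \<open>Gaussian families with a given covariance kernel\<close>

text \<open>The conditions on \<open>\<gamma> i\<close> are an exponent count. At level l there are
  about 2^(l d) increments, each with mean absolute value of order 2^(-l), and the strict
  inequalities say that every term of the moment bound beats this number by a geometric factor; the
  smallest slack is split in half between the thresholds of the chaining and the probabilities of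
  failure. A second obstacle is measurability: for the uniform distance the empirical process is in
  general not a random element, so already the expectation of h(U_n) has to be justified. Rounding
  the sample to a grid leaves countably many samples, and for the Skorokhod distance rounding is a
  small perturbation. Nontrivial time changes serve this purpose only; towards the limit, Skorokhod
  continuity enters through the continuity for the uniform distance that it implies. Finally, the
  envelope bounds h from one side, so only lower bounds for expectations are proved, and -h supplies
  the upper ones.\<close>

definition psd_kernel :: "('i \<Rightarrow> 'i \<Rightarrow> real) \<Rightarrow> bool" where
  "psd_kernel K \<longleftrightarrow> (\<forall>a b. K a b = K b a) \<and>
     (\<forall>A c. finite A \<longrightarrow> 0 \<le> (\<Sum>a\<in>A. \<Sum>b\<in>A. c a * c b * K a b))"

lemma psd_kernel_sum_nonneg:
  "psd_kernel K \<Longrightarrow> finite A \<Longrightarrow> 0 \<le> (\<Sum>a\<in>A. \<Sum>b\<in>A. c a * c b * K a b)"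
  by (simp add: psd_kernel_def)

lemma psd_kernel_diag: "psd_kernel K \<Longrightarrow> 0 \<le> K a a"
  using psd_kernel_sum_nonneg[of K "{a}" "\<lambda>_. 1"] by simp

text \<open>With a zero diagonal entry at \<open>k\<close> the quadratic form in the direction e_a +
  s e_k is affine in s, and an affine function that is bounded below on the whole line is
  constant.\<close>

lemma psd_kernel_null:
  assumes K: "psd_kernel K" and z: "K k k = 0"
  shows "K a k = 0"
proof (cases "a = k")
  case False
  have sym: "K k a = K a k" using K by (auto simp: psd_kernel_def)
  have ge: "0 \<le> K a a + 2 * s * K a k" for s
  proof -
    have "0 \<le> (\<Sum>x\<in>{a,k}. \<Sum>y\<in>{a,k}. (if x = a then 1 else s) * (if y = a then 1 else s) * K x y)"
      using psd_kernel_sum_nonneg[OF K, of "{a,k}" "\<lambda>x. if x = a then 1 else s"] by simp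
    also have "\<dots> = K a a + 2 * s * K a k" using False z sym by (simp add: algebra_simps)
    finally show ?thesis .
  qed
  show ?thesis
  proof (rule ccontr)
    assume nz: "K a k \<noteq> 0"
    \<comment> \<open>The value of s at which the affine function equals -1.\<close>
    have "0 \<le> K a a + 2 * (- (K a a + 1) / (2 * K a k)) * K a k" by (rule ge)
    also have "\<dots> = -1" using nz by (simp add: field_simps)
    finally show False by simp
  qed
qed (use z in simp)

text \<open>Schur complement: its form at c is the minimum over t of the form of \<open>K\<close> at
  c - t e_k. At a zero pivot nothing is subtracted, since division by zero yields zero.\<close>

lemma psd_kernel_eliminate:
  assumes K: "psd_kernel K"
  shows "psd_kernel (\<lambda>a b. K a b - K a k * K k b / K k k)"
proof (cases "K k k = 0")
  case True
  then show ?thesis using K by simp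
next
  case False
  have sym: "K a b = K b a" for a b using K by (auto simp: psd_kernel_def)
  show ?thesis unfolding psd_kernel_def
  proof (intro conjI allI impI)
    fix a b show "K a b - K a k * K k b / K k k = K b a - K b k * K k a / K k k"
      using sym[of a b] sym[of a k] sym[of b k] by simp
  next
    fix A :: "'a set" and c :: "'a \<Rightarrow> real" assume fin: "finite A"
    \<comment> \<open>The minimiser changes the k-th coordinate even when k lies outside A, so c is
      first extended by zero to a set that contains k.\<close>
    define B where "B = insert k A"
    define c0 where "c0 = (\<lambda>a. if a \<in> A then c a else 0)"
    have finB: "finite B" using fin by (simp add: B_def)
    have ext: "(\<Sum>a\<in>A. \<Sum>b\<in>A. c a * c b * L a b) = (\<Sum>a\<in>B. \<Sum>b\<in>B. c0 a * c0 b * L a b)" for L :: "'a \<Rightarrow> 'a \<Rightarrow> real"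
    proof -
      have "(\<Sum>a\<in>A. \<Sum>b\<in>A. c a * c b * L a b) = (\<Sum>a\<in>A. \<Sum>b\<in>A. c0 a * c0 b * L a b)"
        by (intro sum.cong) (auto simp: c0_def)
      also have "\<dots> = (\<Sum>a\<in>A. \<Sum>b\<in>B. c0 a * c0 b * L a b)"
        by (intro sum.cong sum.mono_neutral_left finB) (auto simp: B_def c0_def)
      also have "\<dots> = (\<Sum>a\<in>B. \<Sum>b\<in>B. c0 a * c0 b * L a b)"
        by (intro sum.mono_neutral_left finB) (auto simp: B_def c0_def)
      finally show ?thesis .
    qed
    define S where "S = (\<Sum>a\<in>B. c0 a * K a k)"
    \<comment> \<open>Minimiser of the quadratic function of t; the minimum lowers the form of
      \<open>K\<close> by S^2 / K k k.\<close>
    define t where "t = S / K k k"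
    define e where "e = (\<lambda>a. if a = k then t else 0)"
    have e1: "(\<Sum>b\<in>B. e b * g b) = t * g k" for g
    proof -
      have "(\<Sum>b\<in>B. e b * g b) = (\<Sum>b\<in>B. if b = k then t * g b else 0)"
        by (intro sum.cong) (auto simp: e_def)
      also have "\<dots> = t * g k" using finB by (simp add: B_def)
      finally show ?thesis .
    qed
    have S': "S = (\<Sum>a\<in>B. c0 a * K k a)" unfolding S_def by (intro sum.cong refl) (simp add: sym)
    have "0 \<le> (\<Sum>a\<in>B. \<Sum>b\<in>B. (c0 a - e a) * (c0 b - e b) * K a b)"
      by (rule psd_kernel_sum_nonneg[OF K finB])
    also have "\<dots> = (\<Sum>a\<in>B. \<Sum>b\<in>B. c0 a * c0 b * K a b) - (\<Sum>a\<in>B. c0 a * (\<Sum>b\<in>B. e b * K a b))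
        - (\<Sum>a\<in>B. e a * (\<Sum>b\<in>B. c0 b * K a b)) + (\<Sum>a\<in>B. e a * (\<Sum>b\<in>B. e b * K a b))"
      by (simp add: sum_subtractf sum.distrib sum_distrib_left algebra_simps)
    also have "\<dots> = (\<Sum>a\<in>B. \<Sum>b\<in>B. c0 a * c0 b * K a b) - t * S - t * S + t * (t * K k k)"
    proof -
      have "(\<Sum>a\<in>B. c0 a * (t * K a k)) = t * S"
        unfolding S_def by (simp add: sum_distrib_left algebra_simps)
      then show ?thesis by (simp add: e1 S'[symmetric])
    qed
    also have "\<dots> = (\<Sum>a\<in>B. \<Sum>b\<in>B. c0 a * c0 b * K a b) - S * S / K k k"
      using False by (simp add: t_def)
    also have "S * S / K k k = (\<Sum>a\<in>B. \<Sum>b\<in>B. c0 a * c0 b * (K a k * K k b / K k k))"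
    proof -
      have "S * S = (\<Sum>a\<in>B. \<Sum>b\<in>B. (c0 a * K a k) * (c0 b * K k b))"
        by (subst S', subst S_def) (simp add: sum_product)
      then show ?thesis by (simp add: sum_divide_distrib algebra_simps)
    qed
    finally show "0 \<le> (\<Sum>a\<in>A. \<Sum>b\<in>A. c a * c b * (K a b - K a k * K k b / K k k))"
      unfolding ext by (simp add: sum_subtractf algebra_simps)
  qed
qed

text \<open>Symmetric Gaussian elimination. A vanishing pivot is harmless: its whole row is zero, and
  division by zero yields zero.\<close>

fun eliminate :: "(nat \<Rightarrow> nat \<Rightarrow> real) \<Rightarrow> nat \<Rightarrow> nat \<Rightarrow> nat \<Rightarrow> real" where
  "eliminate K 0 = K"
| "eliminate K (Suc k) =
     (\<lambda>a b. eliminate K k a b - eliminate K k a k * eliminate K k k b / eliminate K k k k)"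

definition cholesky :: "(nat \<Rightarrow> nat \<Rightarrow> real) \<Rightarrow> nat \<Rightarrow> nat \<Rightarrow> real" where
  "cholesky K a k = eliminate K k a k / sqrt (eliminate K k k k)"

lemma psd_kernel_eliminated: "psd_kernel K \<Longrightarrow> psd_kernel (eliminate K n)"
proof (induction n)
  case (Suc n)
  then show ?case using psd_kernel_eliminate[of "eliminate K n" n] by simp
qed simp

text \<open>Row n disappears at step n: a nonzero pivot cancels it, and at a zero pivot it was null
  already by \<open>psd_kernel_null\<close>. Rows removed earlier stay zero because their entry in
  column n is zero.\<close>

lemma eliminate_eq_0:
  assumes K: "psd_kernel K"
  shows "a < n \<Longrightarrow> eliminate K n a b = 0"
proof (induction n arbitrary: a b)
  case (Suc n)
  have P: "psd_kernel (eliminate K n)" using K by (rule psd_kernel_eliminated)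
  show ?case
  proof (cases "a = n")
    case True
    have sym: "eliminate K n n b = eliminate K n b n" using P by (auto simp: psd_kernel_def)
    show ?thesis
      using psd_kernel_null[OF P, of n b] sym True by (cases "eliminate K n n n = 0") auto
  qed (use Suc in auto)
qed simp

text \<open>Each elimination step moves one rank-one term, the outer product of a Cholesky column,
  from the remainder into the sum; after n steps row a < n of the remainder is gone.\<close>

lemma cholesky_decomposition:
  assumes K: "psd_kernel K" and "a < n"
  shows "K a b = (\<Sum>k<n. cholesky K a k * cholesky K b k)"
proof -
  have "K a b = (\<Sum>k<n. cholesky K a k * cholesky K b k) + eliminate K n a b" for n
  proof (induction n)
    case (Suc n)
    have P: "psd_kernel (eliminate K n)" using K by (rule psd_kernel_eliminated)
    have "cholesky K a n * cholesky K b n = eliminate K n a n * eliminate K n n b / eliminate K n n n"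
    proof -
      have "eliminate K n n b = eliminate K n b n" using P by (auto simp: psd_kernel_def)
      then show ?thesis using psd_kernel_diag[OF P, of n] by (simp add: cholesky_def)
    qed
    then show ?case using Suc by simp
  qed simp
  from this[of n] show ?thesis using eliminate_eq_0[OF K \<open>a < n\<close>, of b] by simp
qed

section \<open>Independent standard normals and the Gaussian family of a kernel\<close>

abbreviation gauss_seq :: "(nat \<Rightarrow> real) measure" where
  "gauss_seq \<equiv> Pi\<^sub>M UNIV (\<lambda>_. std_normal_distribution)"

interpretation gauss_seq: product_prob_space "\<lambda>_::nat. std_normal_distribution" UNIV
proof -
  interpret real_distribution std_normal_distribution by (rule real_dist_normal_dist)
  show "product_prob_space (\<lambda>_::nat. std_normal_distribution)"
    by (rule product_prob_spaceI) (rule prob_space_axioms)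
qed

lemma gauss_seq_indep:
  assumes "finite I"
  shows "gauss_seq.P.indep_vars (\<lambda>_. borel) (\<lambda>i \<omega>. \<omega> i) I"
proof (cases "I = {}")
  case True
  then show ?thesis by (simp add: gauss_seq.P.indep_vars_def gauss_seq.P.indep_sets_def)
next
  case False
  have d1: "distr gauss_seq borel (\<lambda>x. x i) = std_normal_distribution" for i
  proof -
    have "distr gauss_seq borel (\<lambda>x. x i) = distr gauss_seq std_normal_distribution (\<lambda>x. x i)"
      by (intro distr_cong) auto
    then show ?thesis
      using distr_PiM_component[of UNIV "\<lambda>_. std_normal_distribution" i] real_dist_normal_dist
      by (simp add: real_distribution_def)
  qed
  have "distr gauss_seq (\<Pi>\<^sub>M i\<in>I. borel) (\<lambda>x. \<lambda>i\<in>I. x i)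
      = distr gauss_seq (Pi\<^sub>M I (\<lambda>_. std_normal_distribution)) (\<lambda>x. restrict x I)"
    by (intro distr_cong refl sets_PiM_cong) auto
  also have "\<dots> = (\<Pi>\<^sub>M i\<in>I. std_normal_distribution)"
    using assms by (intro gauss_seq.distr_PiM_restrict_finite) auto
  finally show ?thesis
    by (subst gauss_seq.P.indep_vars_iff_distr_eq_PiM[OF False]) (simp_all add: d1)
qed

lemma char_gauss_seq_sum:
  assumes "finite I"
  shows "char (distr gauss_seq borel (\<lambda>\<omega>. \<Sum>k\<in>I. d k * \<omega> k)) t = exp (- (t\<^sup>2 * (\<Sum>k\<in>I. (d k)\<^sup>2)) / 2)"
proof -
  have c: "char (distr gauss_seq borel (\<lambda>\<omega>. d k * \<omega> k)) t = exp (- (t\<^sup>2 * (d k)\<^sup>2) / 2)" for k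
  proof -
    have "distr gauss_seq borel (\<lambda>x. x k) = distr gauss_seq std_normal_distribution (\<lambda>x. x k)"
      by (intro distr_cong) auto
    then have d1: "distr gauss_seq borel (\<lambda>x. x k) = std_normal_distribution"
      using distr_PiM_component[of UNIV "\<lambda>_. std_normal_distribution" k] real_dist_normal_dist
      by (simp add: real_distribution_def)
    have "char (distr gauss_seq borel (\<lambda>\<omega>. d k * \<omega> k)) t = char (distr gauss_seq borel (\<lambda>x. x k)) (t * d k)"
      by (simp add: char_def integral_distr mult_ac)
    then show ?thesis unfolding d1 by (simp add: char_std_normal_distribution power_mult_distrib)
  qed
  have "gauss_seq.P.indep_vars (\<lambda>_. borel) (\<lambda>k \<omega>. d k * \<omega> k) I"
    using gauss_seq.P.indep_vars_compose2[OF gauss_seq_indep[OF assms], of "\<lambda>k x. d k * x" "\<lambda>_. borel"] by simp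
  from gauss_seq.P.char_distr_sum[OF this, of t]
  show ?thesis using assms
    by (simp add: c of_real_prod[symmetric] exp_sum[symmetric] sum_distrib_left sum_divide_distrib sum_negf
       flip: exp_of_real)
qed

text \<open>Triangular in the normals: coordinate \<open>a\<close> uses only those with index at
  most \<open>a\<close>, so one infinite product measure carries the families of all
  kernels.\<close>

definition gaussian_family :: "(nat \<Rightarrow> nat \<Rightarrow> real) \<Rightarrow> nat \<Rightarrow> (nat \<Rightarrow> real) \<Rightarrow> real" where
  "gaussian_family K a \<omega> = (\<Sum>k\<le>a. cholesky K a k * \<omega> k)"

lemma gaussian_family_measurable [measurable]: "gaussian_family K a \<in> borel_measurable gauss_seq"
proof -
  have [measurable]: "(\<lambda>\<omega>. \<omega> k) \<in> borel_measurable gauss_seq" for k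
    using measurable_component_singleton[of k UNIV "\<lambda>_. std_normal_distribution"] by simp
  show ?thesis unfolding gaussian_family_def[abs_def] by simp
qed

text \<open>Interchanging the sums gives a single linear form in the normals, whose squared
  coefficients add up to the quadratic form of \<open>K\<close>. This identifies all
  finite-dimensional laws.\<close>

lemma char_gaussian_family:
  assumes K: "psd_kernel K" and A: "finite A"
  shows "char (distr gauss_seq borel (\<lambda>\<omega>. \<Sum>a\<in>A. c a * gaussian_family K a \<omega>)) t
    = exp (- (t\<^sup>2 * (\<Sum>a\<in>A. \<Sum>b\<in>A. c a * c b * K a b)) / 2)"
proof -
  obtain n where n: "\<And>a. a \<in> A \<Longrightarrow> a < n" using finite_nat_set_iff_bounded[THEN iffD1, OF A] by auto
  \<comment> \<open>\<open>cholesky K a k\<close> vanishes for k > a because row a has been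
    eliminated by then, so all sums may run up to a common n.\<close>
  have ext: "gaussian_family K a \<omega> = (\<Sum>k<n. cholesky K a k * \<omega> k)" if "a \<in> A" for a \<omega>
    unfolding gaussian_family_def
  proof (rule sum.mono_neutral_left)
    show "\<forall>k\<in>{..<n} - {..a}. cholesky K a k * \<omega> k = 0"
      using eliminate_eq_0[OF K] by (auto simp: cholesky_def)
  qed (use n[OF that] in auto)
  define d where "d = (\<lambda>k. \<Sum>a\<in>A. c a * cholesky K a k)"
  have 1: "(\<Sum>a\<in>A. c a * gaussian_family K a \<omega>) = (\<Sum>k<n. d k * \<omega> k)" for \<omega>
  proof -
    have "(\<Sum>a\<in>A. c a * gaussian_family K a \<omega>) = (\<Sum>a\<in>A. \<Sum>k<n. c a * cholesky K a k * \<omega> k)"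
      by (simp add: ext sum_distrib_left mult_ac)
    also have "\<dots> = (\<Sum>k<n. d k * \<omega> k)"
      unfolding d_def by (subst sum.swap) (simp add: sum_distrib_right)
    finally show ?thesis .
  qed
  have 2: "(\<Sum>k<n. (d k)\<^sup>2) = (\<Sum>a\<in>A. \<Sum>b\<in>A. c a * c b * K a b)"
  proof -
    have "(\<Sum>k<n. (d k)\<^sup>2) = (\<Sum>k<n. \<Sum>a\<in>A. \<Sum>b\<in>A. c a * c b * (cholesky K a k * cholesky K b k))"
      unfolding d_def power2_eq_square sum_product by (simp add: mult_ac)
    also have "\<dots> = (\<Sum>a\<in>A. \<Sum>b\<in>A. \<Sum>k<n. c a * c b * (cholesky K a k * cholesky K b k))"
      by (subst sum.swap) (intro sum.cong refl sum.swap)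
    also have "\<dots> = (\<Sum>a\<in>A. \<Sum>b\<in>A. c a * c b * K a b)"
      by (intro sum.cong refl) (simp add: cholesky_decomposition[OF K n] sum_distrib_left)
    finally show ?thesis .
  qed
  show ?thesis unfolding 1 2[symmetric] by (rule char_gauss_seq_sum) simp
qed

section \<open>Multivariate convergence from characteristic functions\<close>

text \<open>An algebra of bounded test functions whose expectations can be read off from
  characteristic functions of linear forms; the phase \<open>d\<close> supplies the sines.\<close>

inductive trig_sum :: "(('i \<Rightarrow> real) \<Rightarrow> real) \<Rightarrow> bool" where
  cos: "finite A \<Longrightarrow> trig_sum (\<lambda>x. r * cos ((\<Sum>a\<in>A. c a * x a) + d))"
| add: "trig_sum f \<Longrightarrow> trig_sum g \<Longrightarrow> trig_sum (\<lambda>x. f x + g x)"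

lemma trig_sum_const: "trig_sum (\<lambda>x. c)"
  using trig_sum.cos[of "{}" c _ 0] by simp

lemma trig_sum_sin: "trig_sum (\<lambda>x. sin (t * x a))"
proof -
  have "trig_sum (\<lambda>x. 1 * cos ((\<Sum>b\<in>{a}. t * x b) + (- pi / 2)))"
    by (rule trig_sum.cos) simp
  also have "(\<lambda>x. 1 * cos ((\<Sum>b\<in>{a}. t * x b) + (- pi / 2))) = (\<lambda>x. sin (t * x a))"
    by (simp add: cos_add cos_diff)
  finally show ?thesis .
qed

text \<open>Product-to-sum formula, after both frequency vectors have been extended by zero to
  \<open>A \<union> B\<close>.\<close>

lemma trig_sum_cos_mult:
  assumes "finite A" "finite B"
  shows "trig_sum (\<lambda>x. (r * cos ((\<Sum>a\<in>A. c a * x a) + d)) * (s * cos ((\<Sum>a\<in>B. c' a * x a) + d')))"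
proof -
  define c1 where "c1 = (\<lambda>a. (if a \<in> A then c a else 0) + (if a \<in> B then c' a else 0))"
  define c2 where "c2 = (\<lambda>a. (if a \<in> A then c a else 0) - (if a \<in> B then c' a else 0))"
  have e: "(\<Sum>a\<in>A \<union> B. (if a \<in> A then c a else 0) * x a) = (\<Sum>a\<in>A. c a * x a)"
          "(\<Sum>a\<in>A \<union> B. (if a \<in> B then c' a else 0) * x a) = (\<Sum>a\<in>B. c' a * x a)" for x
    using assms by (intro sum.mono_neutral_cong_right; auto)+
  have 1: "(\<Sum>a\<in>A \<union> B. c1 a * x a) = (\<Sum>a\<in>A. c a * x a) + (\<Sum>a\<in>B. c' a * x a)" for x
    unfolding c1_def by (simp only: distrib_right sum.distrib e)
  have 2: "(\<Sum>a\<in>A \<union> B. c2 a * x a) = (\<Sum>a\<in>A. c a * x a) - (\<Sum>a\<in>B. c' a * x a)" for x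
    unfolding c2_def by (simp only: left_diff_distrib sum_subtractf e)
  have pr: "(r * cos (u + d)) * (s * cos (v + d')) =
      (r * s / 2) * cos ((u + v) + (d + d')) + (r * s / 2) * cos ((u - v) + (d - d'))" for u v
  proof -
    have "cos (u + d) * cos (v + d') = (cos ((u + d) - (v + d')) + cos ((u + d) + (v + d'))) / 2"
      by (rule cos_times_cos)
    then show ?thesis by (simp add: algebra_simps add_divide_distrib)
  qed
  have "trig_sum (\<lambda>x. (r * s / 2) * cos ((\<Sum>a\<in>A \<union> B. c1 a * x a) + (d + d'))
      + (r * s / 2) * cos ((\<Sum>a\<in>A \<union> B. c2 a * x a) + (d - d')))"
    by (intro trig_sum.intros) (use assms in auto)
  then show ?thesis unfolding 1 2 pr .
qed

lemma trig_sum_mult: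
  assumes "trig_sum f" "trig_sum g"
  shows "trig_sum (\<lambda>x. f x * g x)"
  using assms(1)
proof induction
  case (cos A r c d)
  show ?case using assms(2)
  proof induction
    case (cos B s c' d')
    then show ?case using \<open>finite A\<close> by (intro trig_sum_cos_mult)
  next
    case (add f g)
    then show ?case by (simp only: distrib_left) (rule trig_sum.add)
  qed
next
  case (add f h)
  then show ?case by (simp only: distrib_right) (rule trig_sum.add)
qed

lemma trig_sum_bounded: "trig_sum f \<Longrightarrow> \<exists>B. \<forall>x. \<bar>f x\<bar> \<le> B"
proof (induction rule: trig_sum.induct)
  case (cos A r c d)
  have "\<bar>r * cos ((\<Sum>a\<in>A. c a * x a) + d)\<bar> \<le> \<bar>r\<bar>" for x
    by (simp add: abs_mult mult_left_le)
  then show ?case by blast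
next
  case (add f g)
  then obtain B C where "\<And>x. \<bar>f x\<bar> \<le> B" "\<And>x. \<bar>g x\<bar> \<le> C" by blast
  then have "\<bar>f x + g x\<bar> \<le> B + C" for x by (meson abs_triangle_ineq add_mono order_trans)
  then show ?case by blast
qed

lemma trig_sum_measurable:
  assumes "trig_sum f" and [measurable]: "\<And>a. Y a \<in> borel_measurable M"
  shows "(\<lambda>\<omega>. f (\<lambda>a. Y a \<omega>)) \<in> borel_measurable M"
  using assms(1) by induction auto

text \<open>The expectation of cos(S + d) is the real part of exp(i d) times the characteristic
  function of S at 1, and every multiple of a linear form is again a linear form, so the argument 1
  suffices.\<close>

lemma trig_sum_integral_convergence:
  fixes Y :: "nat \<Rightarrow> 'i \<Rightarrow> 'a \<Rightarrow> real" and Z :: "'i \<Rightarrow> 'p \<Rightarrow> real"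
  assumes "prob_space M" "prob_space P"
    and [measurable]: "\<And>n a. Y n a \<in> borel_measurable M" "\<And>a. Z a \<in> borel_measurable P"
    and char: "\<And>A c. finite A \<Longrightarrow>
      (\<lambda>n. char (distr M borel (\<lambda>\<omega>. \<Sum>a\<in>A. c a * Y n a \<omega>)) 1)
        \<longlonglongrightarrow> char (distr P borel (\<lambda>\<omega>. \<Sum>a\<in>A. c a * Z a \<omega>)) 1"
    and "trig_sum f"
  shows "(\<lambda>n. LINT \<omega>|M. f (\<lambda>a. Y n a \<omega>)) \<longlonglongrightarrow> (LINT \<omega>|P. f (\<lambda>a. Z a \<omega>))"
  using \<open>trig_sum f\<close>
proof induction
  case (cos A r c d)
  interpret M: prob_space M by fact
  interpret P: prob_space P by fact
  have eq: "(LINT \<omega>|N. r * cos ((\<Sum>a\<in>A. c a * V a \<omega>) + d)) =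
      r * Re (iexp d * char (distr N borel (\<lambda>\<omega>. \<Sum>a\<in>A. c a * V a \<omega>)) 1)"
    if N: "prob_space N" and V[measurable]: "\<And>a. V a \<in> borel_measurable N"
    for N :: "'z measure" and V
  proof -
    interpret N: prob_space N by fact
    let ?S = "\<lambda>\<omega>. \<Sum>a\<in>A. c a * V a \<omega>"
    have int: "integrable N (\<lambda>\<omega>. iexp (?S \<omega>))" by (rule N.integrable_iexp) auto
    have "iexp d * char (distr N borel ?S) 1 = (CLINT \<omega>|N. iexp d * iexp (?S \<omega>))"
      by (simp add: char_def integral_distr)
    also have "Re \<dots> = (LINT \<omega>|N. Re (iexp d * iexp (?S \<omega>)))"
      by (rule integral_Re[symmetric]) (use int in auto)
    also have "\<dots> = (LINT \<omega>|N. cos (?S \<omega> + d))"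
      by (simp add: exp_add[symmetric] Re_exp algebra_simps)
    finally show ?thesis by simp
  qed
  show ?case
    unfolding eq[OF M.prob_space_axioms assms(3)] eq[OF P.prob_space_axioms assms(4)]
    by (intro tendsto_intros char cos)
next
  case (add f g)
  interpret M: prob_space M by fact
  interpret P: prob_space P by fact
  have int: "integrable N (\<lambda>\<omega>. h (\<lambda>a. V a \<omega>))"
    if N: "prob_space N" and V[measurable]: "\<And>a. V a \<in> borel_measurable N" and h: "trig_sum h"
    for N :: "'z measure" and V h
  proof -
    interpret N: prob_space N by fact
    obtain B where "\<And>x. \<bar>h x\<bar> \<le> B" using trig_sum_bounded[OF h] by blast
    then show ?thesis by (intro N.integrable_const_bound[of _ B] AE_I2 trig_sum_measurable[OF h V]) auto
  qed
  have "(\<lambda>n. (LINT \<omega>|M. f (\<lambda>a. Y n a \<omega>)) + (LINT \<omega>|M. g (\<lambda>a. Y n a \<omega>)))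
      \<longlonglongrightarrow> (LINT \<omega>|P. f (\<lambda>a. Z a \<omega>)) + (LINT \<omega>|P. g (\<lambda>a. Z a \<omega>))"
    by (rule tendsto_add[OF add.IH])
  moreover have "(LINT \<omega>|M. f (\<lambda>a. Y n a \<omega>)) + (LINT \<omega>|M. g (\<lambda>a. Y n a \<omega>))
      = (LINT \<omega>|M. f (\<lambda>a. Y n a \<omega>) + g (\<lambda>a. Y n a \<omega>))" for n
    by (rule Bochner_Integration.integral_add[symmetric])
      (rule int[OF M.prob_space_axioms assms(3) add.hyps(1)], rule int[OF M.prob_space_axioms assms(3) add.hyps(2)])
  moreover have "(LINT \<omega>|P. f (\<lambda>a. Z a \<omega>)) + (LINT \<omega>|P. g (\<lambda>a. Z a \<omega>))
      = (LINT \<omega>|P. f (\<lambda>a. Z a \<omega>) + g (\<lambda>a. Z a \<omega>))"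
    by (rule Bochner_Integration.integral_add[symmetric])
      (rule int[OF P.prob_space_axioms assms(4) add.hyps(1)], rule int[OF P.prob_space_axioms assms(4) add.hyps(2)])
  ultimately show ?case by simp
qed

text \<open>Approximating on a cube by polynomials in \<open>sin (t * x a)\<close>, whose zig-zag periodic limit
  function has the same bound as \<open>H\<close>, keeps the approximant bounded outside the cube as well.\<close>

lemma trig_sum_approximation:
  fixes H :: "('i::countable \<Rightarrow> real) \<Rightarrow> real"
  assumes cont: "continuous_on UNIV H" and B: "\<And>x. \<bar>H x\<bar> \<le> B" and "0 < K" "0 < e"
  obtains f where "trig_sum f" "\<And>x. \<bar>f x\<bar> \<le> B + e" "\<And>x. (\<And>a. \<bar>x a\<bar> \<le> K) \<Longrightarrow> \<bar>f x - H x\<bar> < e"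
proof -
  \<comment> \<open>With this frequency x is mapped to sin(t x) bijectively from [-K, K] onto
    [-1, 1], so arcsin inverts the map on the cube.\<close>
  define t where "t = pi / (2 * K)"
  have t: "0 < t" using \<open>0 < K\<close> by (simp add: t_def)
  define S :: "('i \<Rightarrow> real) set" where "S = Pi\<^sub>E UNIV (\<lambda>_. {-1..1})"
  have S: "u \<in> S \<longleftrightarrow> (\<forall>a. -1 \<le> u a \<and> u a \<le> 1)" for u by (auto simp: S_def PiE_iff)
  have "compactin (product_topology (\<lambda>i. euclidean) UNIV) S"
    unfolding S_def by (subst compactin_PiE) auto
  then have compS: "compact S" by (simp add: euclidean_product_topology)
  \<comment> \<open>\<open>H\<close> in the coordinates u = sin(t x). By Tychonoff the cube
    \<open>S\<close> is compact even with infinitely many coordinates, so the Stone-Weierstrass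
    theorem applies to \<open>Q\<close>.\<close>
  define Q where "Q = (\<lambda>u. H (\<lambda>a. arcsin (u a) / t))"
  define P where "P = (\<lambda>g. continuous_on S g \<and> trig_sum (\<lambda>x. g (\<lambda>a. sin (t * x a))))"
  have coord: "continuous_on S (\<lambda>u. u a)" for a
    by (rule continuous_on_subset[OF continuous_on_product_coordinates]) simp
  have Qc: "continuous_on S Q" unfolding Q_def
  proof (rule continuous_on_compose2[OF cont])
    show "continuous_on S (\<lambda>u a. arcsin (u a) / t)"
      by (intro continuous_on_coordinatewise_then_product continuous_intros coord) (use S t in auto)
  qed simp
  have "\<exists>g. P g \<and> (\<forall>x\<in>S. \<bar>Q x - g x\<bar> < e)"
  proof (rule Stone_Weierstrass_HOL[OF compS])
    show "P (\<lambda>x. c)" for c by (auto simp: P_def trig_sum_const)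
    show "\<exists>f. P f \<and> f x \<noteq> f y" if "x \<in> S \<and> y \<in> S \<and> x \<noteq> y" for x y
    proof -
      have "\<exists>a. x a \<noteq> y a" using that by (simp add: fun_eq_iff)
      then obtain a where "x a \<noteq> y a" ..
      moreover have "P (\<lambda>u. u a)" by (auto simp: P_def coord trig_sum_sin)
      ultimately show ?thesis by blast
    qed
    show "P (\<lambda>x. f x + g x)" if "P f \<and> P g" for f g
      using that by (auto simp: P_def intro: continuous_intros trig_sum.add)
    show "P (\<lambda>x. f x * g x)" if "P f \<and> P g" for f g
      using that by (auto simp: P_def intro: continuous_intros trig_sum_mult)
  qed (use Qc \<open>0 < e\<close> P_def in auto)
  then obtain g where g: "trig_sum (\<lambda>x. g (\<lambda>a. sin (t * x a)))" "\<And>x. x \<in> S \<Longrightarrow> \<bar>Q x - g x\<bar> < e"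
    unfolding P_def by blast
  define s where "s = (\<lambda>x::'i \<Rightarrow> real. \<lambda>a. sin (t * x a))"
  have sS: "s x \<in> S" for x by (auto simp: S s_def)
  show ?thesis
  proof
    show "trig_sum (\<lambda>x. g (s x))" using g(1) by (simp add: s_def)
    show "\<bar>g (s x)\<bar> \<le> B + e" for x
    proof -
      have "\<bar>Q (s x)\<bar> \<le> B" unfolding Q_def by (rule B)
      then show ?thesis using g(2)[OF sS[of x]] by linarith
    qed
    show "\<bar>g (s x) - H x\<bar> < e" if x: "\<And>a. \<bar>x a\<bar> \<le> K" for x
    proof -
      have "arcsin (s x a) / t = x a" for a
      proof -
        have "\<bar>t * x a\<bar> \<le> pi / 2"
        proof -
          have "\<bar>t * x a\<bar> \<le> t * K" using t x[of a] by (simp add: abs_mult)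
          then show ?thesis using \<open>0 < K\<close> by (simp add: t_def)
        qed
        then have "arcsin (sin (t * x a)) = t * x a" by (intro arcsin_sin) (auto simp: abs_le_iff)
        then show ?thesis using t by (simp add: s_def)
      qed
      then have "Q (s x) = H x" by (simp add: Q_def)
      then show ?thesis using g(2)[OF sS[of x]] by linarith
    qed
  qed
qed

lemma (in prob_space) tight_real:
  fixes Z :: "'a \<Rightarrow> real"
  assumes [measurable]: "Z \<in> borel_measurable M" and "0 < e"
  shows "\<exists>K>0. prob {\<omega>\<in>space M. K < \<bar>Z \<omega>\<bar>} \<le> e"
proof -
  have "(\<lambda>n. prob {\<omega>\<in>space M. real n < \<bar>Z \<omega>\<bar>}) \<longlonglongrightarrow> prob (\<Inter>n. {\<omega>\<in>space M. real n < \<bar>Z \<omega>\<bar>})"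
    by (rule finite_Lim_measure_decseq) (auto simp: decseq_def)
  also have "(\<Inter>n. {\<omega>\<in>space M. real n < \<bar>Z \<omega>\<bar>}) = {}"
    by auto (meson not_less real_arch_simple)
  finally have "\<forall>\<^sub>F n in sequentially. prob {\<omega>\<in>space M. real n < \<bar>Z \<omega>\<bar>} < e"
    using \<open>0 < e\<close> by (auto dest: order_tendstoD)
  then have "\<forall>\<^sub>F n in sequentially. 0 < n \<and> prob {\<omega>\<in>space M. real n < \<bar>Z \<omega>\<bar>} < e"
    using eventually_gt_at_top by eventually_elim auto
  then obtain n :: nat where "0 < n" "prob {\<omega>\<in>space M. real n < \<bar>Z \<omega>\<bar>} < e"
    by (auto simp: eventually_sequentially)
  then show ?thesis by (intro exI[of _ "real n"]) auto
qed

text \<open>By tightness the coordinates in \<open>A\<close> lie in one cube outside an event of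
  small probability. On the cube \<open>H\<close> is close to a trigonometric sum; on the event the
  two differ by at most 2 B + 1, which costs that factor times its probability.\<close>

theorem integral_convergence_of_char:
  fixes Y :: "nat \<Rightarrow> 'i::countable \<Rightarrow> 'a \<Rightarrow> real" and Z :: "'i \<Rightarrow> 'p \<Rightarrow> real"
    and H :: "('i \<Rightarrow> real) \<Rightarrow> real"
  assumes M: "prob_space M" and P: "prob_space P"
    and Y[measurable]: "\<And>n a. Y n a \<in> borel_measurable M"
    and Z[measurable]: "\<And>a. Z a \<in> borel_measurable P"
    and char: "\<And>A c. finite A \<Longrightarrow>
      (\<lambda>n. char (distr M borel (\<lambda>\<omega>. \<Sum>a\<in>A. c a * Y n a \<omega>)) 1)
        \<longlonglongrightarrow> char (distr P borel (\<lambda>\<omega>. \<Sum>a\<in>A. c a * Z a \<omega>)) 1"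
    and tight: "\<And>a e. 0 < e \<Longrightarrow> \<exists>K. \<forall>n. measure M {\<omega>\<in>space M. K < \<bar>Y n a \<omega>\<bar>} \<le> e"
    and cont: "continuous_on UNIV H" and B: "\<And>x. \<bar>H x\<bar> \<le> B"
    and A: "finite A" and dep: "\<And>x. H x = H (\<lambda>a. if a \<in> A then x a else 0)"
  shows "(\<lambda>n. LINT \<omega>|M. H (\<lambda>a. Y n a \<omega>)) \<longlonglongrightarrow> (LINT \<omega>|P. H (\<lambda>a. Z a \<omega>))"
proof (rule LIMSEQ_I)
  interpret M: prob_space M by fact
  interpret P: prob_space P by fact
  fix e :: real assume "0 < e"
  have B0: "0 \<le> B" using B[of undefined] by linarith
  \<comment> \<open>Two replacements cost 2 e1 each and the convergence costs e1, in all less than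
    e; e1 <= 1 gives the bound 2 B + 1 off the cube.\<close>
  define e1 where "e1 = min 1 (e / 8)"
  have e1: "0 < e1" "e1 \<le> 1" "e1 \<le> e / 8" using \<open>0 < e\<close> by (auto simp: e1_def)
  \<comment> \<open>Summed over the coordinates in \<open>A\<close> and multiplied by 2 B + 1 this
    stays below e1; the summand 1 covers an empty \<open>A\<close>.\<close>
  define q where "q = e1 / (2 * B + 1) / (1 + real (card A))"
  have q: "0 < q" using e1 B0 by (simp add: q_def)
  have "\<exists>K. \<forall>a. (\<forall>n. measure M {\<omega>\<in>space M. K a < \<bar>Y n a \<omega>\<bar>} \<le> q) \<and> measure P {\<omega>\<in>space P. K a < \<bar>Z a \<omega>\<bar>} \<le> q"
  proof (rule choice, rule allI)
    fix a
    obtain K1 where K1: "\<And>n. measure M {\<omega>\<in>space M. K1 < \<bar>Y n a \<omega>\<bar>} \<le> q" using tight[OF q] by blast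
    obtain K2 where K2: "measure P {\<omega>\<in>space P. K2 < \<bar>Z a \<omega>\<bar>} \<le> q" using P.tight_real[OF Z q] by blast
    have "measure M {\<omega>\<in>space M. max K1 K2 < \<bar>Y n a \<omega>\<bar>} \<le> q" for n
      by (rule order_trans[OF M.finite_measure_mono K1]) auto
    moreover have "measure P {\<omega>\<in>space P. max K1 K2 < \<bar>Z a \<omega>\<bar>} \<le> q"
      by (rule order_trans[OF P.finite_measure_mono K2]) auto
    ultimately show "\<exists>K. (\<forall>n. measure M {\<omega>\<in>space M. K < \<bar>Y n a \<omega>\<bar>} \<le> q) \<and> measure P {\<omega>\<in>space P. K < \<bar>Z a \<omega>\<bar>} \<le> q"
      by blast
  qed
  then obtain K0 where K0: "\<And>a n. measure M {\<omega>\<in>space M. K0 a < \<bar>Y n a \<omega>\<bar>} \<le> q"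
    "\<And>a. measure P {\<omega>\<in>space P. K0 a < \<bar>Z a \<omega>\<bar>} \<le> q" by metis
  define K where "K = 1 + (\<Sum>a\<in>A. \<bar>K0 a\<bar>)"
  have K: "0 < K" unfolding K_def by (meson add_pos_nonneg sum_nonneg abs_ge_zero zero_less_one)
  have K0K: "K0 a \<le> K" if "a \<in> A" for a
    using member_le_sum[of a A "\<lambda>a. \<bar>K0 a\<bar>"] that A unfolding K_def by auto
  obtain f where f: "trig_sum f" "\<And>x. \<bar>f x\<bar> \<le> B + e1" "\<And>x. (\<And>a. \<bar>x a\<bar> \<le> K) \<Longrightarrow> \<bar>f x - H x\<bar> < e1"
    using trig_sum_approximation[OF cont B K e1(1)] by blast
  \<comment> \<open>Coordinates outside \<open>A\<close> are set to zero because the approximation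
    asks for a bound on every coordinate; by \<open>dep\<close> this leaves \<open>H\<close>
    unchanged.\<close>
  define R where "R = (\<lambda>x::'i \<Rightarrow> real. \<lambda>a. if a \<in> A then x a else 0)"
  have close: "\<bar>(LINT \<omega>|N. f (R (\<lambda>a. V a \<omega>))) - (LINT \<omega>|N. H (\<lambda>a. V a \<omega>))\<bar> \<le> 2 * e1"
    if N: "prob_space N" and V[measurable]: "\<And>a. V a \<in> borel_measurable N"
      and t: "\<And>a. measure N {\<omega>\<in>space N. K0 a < \<bar>V a \<omega>\<bar>} \<le> q"
    for N :: "'z measure" and V
  proof -
    interpret N: prob_space N by fact
    have HV[measurable]: "(\<lambda>\<omega>. H (\<lambda>a. V a \<omega>)) \<in> borel_measurable N"
      by (rule measurable_compose[OF measurable_coordinatewise_then_product borel_measurable_continuous_onI[OF cont]]) auto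
    have RV[measurable]: "\<And>a. (\<lambda>\<omega>. R (\<lambda>a. V a \<omega>) a) \<in> borel_measurable N" by (simp add: R_def)
    have fV[measurable]: "(\<lambda>\<omega>. f (R (\<lambda>a. V a \<omega>))) \<in> borel_measurable N"
      by (rule trig_sum_measurable[OF f(1) RV])
    define C where "C = (\<Union>a\<in>A. {\<omega>\<in>space N. K0 a < \<bar>V a \<omega>\<bar>})"
    have C[measurable]: "C \<in> sets N" unfolding C_def using A by auto
    have "measure N C \<le> (\<Sum>a\<in>A. measure N {\<omega>\<in>space N. K0 a < \<bar>V a \<omega>\<bar>})"
      unfolding C_def by (rule N.finite_measure_subadditive_finite) (use A in auto)
    also have "\<dots> \<le> card A * q" by (rule sum_bounded_above) (rule t)
    also have "\<dots> \<le> (1 + real (card A)) * q" using q by simp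
    also have "\<dots> = e1 / (2 * B + 1)" by (simp add: q_def)
    finally have mC: "measure N C \<le> e1 / (2 * B + 1)" .
    have pw: "\<bar>f (R (\<lambda>a. V a \<omega>)) - H (\<lambda>a. V a \<omega>)\<bar> \<le> e1 + (2 * B + 1) * indicator C \<omega>" if "\<omega> \<in> space N" for \<omega>
    proof (cases "\<omega> \<in> C")
      case True
      then show ?thesis using f(2)[of "R (\<lambda>a. V a \<omega>)"] B[of "\<lambda>a. V a \<omega>"] e1 by auto
    next
      case False
      then have "\<bar>V a \<omega>\<bar> \<le> K0 a" if "a \<in> A" for a using that \<open>\<omega> \<in> space N\<close> by (auto simp: C_def not_less)
      then have "\<bar>R (\<lambda>a. V a \<omega>) a\<bar> \<le> K" for a using K0K K by (fastforce simp: R_def)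
      from f(3)[OF this] have "\<bar>f (R (\<lambda>a. V a \<omega>)) - H (R (\<lambda>a. V a \<omega>))\<bar> < e1" .
      moreover have "H (R (\<lambda>a. V a \<omega>)) = H (\<lambda>a. V a \<omega>)" using dep by (simp add: R_def)
      ultimately show ?thesis using False by simp
    qed
    have i1: "integrable N (\<lambda>\<omega>. f (R (\<lambda>a. V a \<omega>)))" by (rule N.integrable_const_bound[of _ "B + e1"]) (use f in auto)
    have i2: "integrable N (\<lambda>\<omega>. H (\<lambda>a. V a \<omega>))" by (rule N.integrable_const_bound[of _ B]) (use B in auto)
    have "\<bar>(LINT \<omega>|N. f (R (\<lambda>a. V a \<omega>))) - (LINT \<omega>|N. H (\<lambda>a. V a \<omega>))\<bar>
        = \<bar>LINT \<omega>|N. f (R (\<lambda>a. V a \<omega>)) - H (\<lambda>a. V a \<omega>)\<bar>" by (simp add: i1 i2)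
    also have "\<dots> \<le> (LINT \<omega>|N. \<bar>f (R (\<lambda>a. V a \<omega>)) - H (\<lambda>a. V a \<omega>)\<bar>)" by (rule integral_abs_bound)
    also have "\<dots> \<le> (LINT \<omega>|N. e1 + (2 * B + 1) * indicator C \<omega>)"
      by (rule integral_mono) (use i1 i2 pw in \<open>auto simp: N.integrable_const N.emeasure_finite less_top[symmetric]
          intro!: Bochner_Integration.integrable_add integrable_real_indicator\<close>)
    also have "\<dots> = e1 + (2 * B + 1) * measure N C"
    proof -
      have "integrable N (indicator C :: _ \<Rightarrow> real)"
        by (rule integrable_real_indicator) (auto simp: N.emeasure_finite less_top[symmetric])
      then have iC: "integrable N (\<lambda>\<omega>. (2 * B + 1) * indicator C \<omega>)" by (rule integrable_mult_right)
      show ?thesis by (subst Bochner_Integration.integral_add[OF N.integrable_const iC]) (simp add: N.prob_space)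
    qed
    also have "\<dots> \<le> 2 * e1" using mC B0 by (simp add: field_simps)
    finally show ?thesis .
  qed
  have conv: "(\<lambda>n. LINT \<omega>|M. f (R (\<lambda>a. Y n a \<omega>))) \<longlonglongrightarrow> (LINT \<omega>|P. f (R (\<lambda>a. Z a \<omega>)))"
  proof -
    have sR: "(\<Sum>a\<in>D. c a * (if a \<in> A then v a else 0)) = (\<Sum>a\<in>D \<inter> A. c a * v a)" if "finite D" for D c and v :: "'i \<Rightarrow> real"
      using that by (simp add: sum.inter_restrict if_distrib cong: if_cong)
    have "(\<lambda>n. LINT \<omega>|M. f (\<lambda>a. (\<lambda>n a \<omega>. if a \<in> A then Y n a \<omega> else 0) n a \<omega>))
        \<longlonglongrightarrow> (LINT \<omega>|P. f (\<lambda>a. (\<lambda>a \<omega>. if a \<in> A then Z a \<omega> else 0) a \<omega>))"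
      by (rule trig_sum_integral_convergence[OF M P _ _ _ f(1)]) (auto simp: sR intro!: char)
    then show ?thesis by (simp add: R_def)
  qed
  then obtain N where N: "\<And>n. n \<ge> N \<Longrightarrow> \<bar>(LINT \<omega>|M. f (R (\<lambda>a. Y n a \<omega>))) - (LINT \<omega>|P. f (R (\<lambda>a. Z a \<omega>)))\<bar> < e1"
    using LIMSEQ_D[OF conv e1(1)] by (auto simp: real_norm_def)
  have "norm ((LINT \<omega>|M. H (\<lambda>a. Y n a \<omega>)) - (LINT \<omega>|P. H (\<lambda>a. Z a \<omega>))) < e" if "n \<ge> N" for n
    using N[OF that] close[of M "Y n", OF M Y K0(1)] close[of P Z, OF P Z K0(2)] e1 by (simp only: real_norm_def)
  then show "\<exists>no. \<forall>n\<ge>no. norm ((LINT \<omega>|M. H (\<lambda>a. Y n a \<omega>)) - (LINT \<omega>|P. H (\<lambda>a. Z a \<omega>))) < e" by blast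
qed

section \<open>Gaussian limits\<close>

lemma distributed_scale_std_normal:
  assumes "0 < s"
  shows "distr std_normal_distribution borel (\<lambda>x. s * x) = density lborel (\<lambda>x. ennreal (normal_density 0 s x))"
proof -
  have N: "prob_space std_normal_distribution"
    using real_dist_normal_dist by (simp add: real_distribution_def)
  have "distributed std_normal_distribution lborel (\<lambda>x. x) (\<lambda>x. ennreal (normal_density 0 1 x))"
    unfolding distributed_def
    by (auto simp: distr_id2 intro!: measure_eqI)
  from prob_space.normal_density_affine[OF N this, of s 0] \<open>0 < s\<close>
  have "distributed std_normal_distribution lborel (\<lambda>x. s * x) (\<lambda>x. ennreal (normal_density 0 s x))" by simp
  then have "distr std_normal_distribution lborel (\<lambda>x. s * x) = density lborel (\<lambda>x. ennreal (normal_density 0 s x))"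
    by (simp add: distributed_def)
  moreover have "distr std_normal_distribution lborel (\<lambda>x. s * x) = distr std_normal_distribution borel (\<lambda>x. s * x)"
    by (rule distr_cong) auto
  ultimately show ?thesis by simp
qed

lemma real_distribution_normal_law: "real_distribution (normal_law s)"
proof (cases "s > 0")
  case True
  interpret prob_space "density lborel (\<lambda>x. ennreal (normal_density 0 (sqrt s) x))"
    by (rule prob_space_normal_density) (use True in simp)
  show ?thesis using True by (simp add: normal_law_def real_distribution_def real_distribution_axioms_def prob_space_axioms)
next
  case False
  then show ?thesis
    by (simp add: normal_law_def real_distribution_def real_distribution_axioms_def prob_space_return)
qed

lemma char_normal_law:
  assumes "0 \<le> s"
  shows "char (normal_law s) t = exp (- (t\<^sup>2 * s) / 2)"
proof (cases "s > 0")
  case True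
  have "char (normal_law s) t = char (distr std_normal_distribution borel (\<lambda>x. sqrt s * x)) t"
    using True by (simp add: normal_law_def distributed_scale_std_normal)
  also have "\<dots> = char std_normal_distribution (t * sqrt s)"
    by (simp add: char_def integral_distr mult_ac)
  also have "\<dots> = exp (- (t\<^sup>2 * s) / 2)"
    using True by (simp add: char_std_normal_distribution power_mult_distrib)
  finally show ?thesis .
next
  case False
  then have "s = 0" using assms by simp
  then show ?thesis by (simp add: normal_law_def char_def integral_return)
qed

text \<open>Real part of the third-order Taylor estimate for exp(i x); the remainder is a fourth
  power, the moment that will be bounded.\<close>

lemma one_minus_cos_approx: "\<bar>(1 - cos x) - x\<^sup>2 / 2\<bar> \<le> x ^ 4 / 24" for x :: real
proof -
  have "cmod (iexp x - (\<Sum>k \<le> 3. (\<i> * x)^k / fact k)) \<le> \<bar>x\<bar>^(Suc 3) / fact (Suc 3)"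
    by (rule iexp_approx1)
  moreover have "\<bar>Re (iexp x - (\<Sum>k \<le> 3. (\<i> * x)^k / fact k))\<bar> \<le> cmod (iexp x - (\<Sum>k \<le> 3. (\<i> * x)^k / fact k))"
    by (rule abs_Re_le_cmod)
  moreover have "Re (iexp x - (\<Sum>k \<le> 3. (\<i> * x)^k / fact k)) = cos x - 1 + x\<^sup>2 / 2"
    by (simp add: eval_nat_numeral Re_exp fact_numeral power2_eq_square power_mult_distrib)
  moreover have "\<bar>x\<bar>^(Suc 3) / fact (Suc 3) = x ^ 4 / 24"
    by (simp add: eval_nat_numeral abs_mult[symmetric])
  ultimately have "\<bar>cos x - 1 + x\<^sup>2 / 2\<bar> \<le> x ^ 4 / 24"
    by linarith
  then show ?thesis unfolding abs_le_iff by linarith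
qed

lemma one_minus_exp_bounds:
  fixes u :: real
  assumes "0 \<le> u" shows "\<bar>(1 - exp (- u)) - u\<bar> \<le> u\<^sup>2"
proof -
  have 1: "1 - exp (- u) \<le> u" using exp_ge_add_one_self[of "- u"] by simp
  have "exp (- u) \<le> 1 / (1 + u)"
    using exp_ge_add_one_self[of u] assms by (simp add: exp_minus inverse_eq_divide frac_le)
  moreover have "1 / (1 + u) \<le> 1 - u + u\<^sup>2"
  proof -
    have "1 \<le> (1 - u + u\<^sup>2) * (1 + u)" using assms by (simp add: algebra_simps power2_eq_square)
    then show ?thesis using assms by (simp add: divide_le_eq)
  qed
  ultimately show ?thesis using 1 by (simp add: abs_le_iff)
qed

lemma square_le_power4: "x\<^sup>2 \<le> 1 + x ^ 4" for x :: real
proof -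
  have "0 \<le> (x\<^sup>2 - 1)\<^sup>2" by simp
  then have "2 * x\<^sup>2 \<le> 1 + x ^ 4" by (simp add: power2_diff power_mult[symmetric])
  then show ?thesis using zero_le_power2[of x] by linarith
qed

lemma (in prob_space) integrable_square_of_power4:
  fixes S :: "'a \<Rightarrow> real"
  assumes [measurable]: "S \<in> borel_measurable M" and "integrable M (\<lambda>\<omega>. S \<omega> ^ 4)"
  shows "integrable M (\<lambda>\<omega>. (S \<omega>)\<^sup>2)"
proof (rule Bochner_Integration.integrable_bound)
  show "integrable M (\<lambda>\<omega>. 1 + S \<omega> ^ 4)" using assms by (intro Bochner_Integration.integrable_add) auto
qed (use square_le_power4 in auto)

text \<open>By the fourth moments, 2 (1 - Re char(t)) / t^2 differs from the second moment by at
  most t^2 K, uniformly in n. For fixed small t this quotient converges by the weak limit, and its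
  limit is within t^2 s^2 of \<open>s\<close>.\<close>

lemma (in prob_space) second_moment_convergence:
  fixes S :: "nat \<Rightarrow> 'a \<Rightarrow> real"
  assumes [measurable]: "\<And>n. S n \<in> borel_measurable M"
    and s: "0 \<le> s" and wc: "weak_conv_m (\<lambda>n. distr M borel (S n)) (normal_law s)"
    and int: "\<And>n. integrable M (\<lambda>\<omega>. S n \<omega> ^ 4)" and K: "\<And>n. expectation (\<lambda>\<omega>. S n \<omega> ^ 4) \<le> K"
  shows "(\<lambda>n. expectation (\<lambda>\<omega>. (S n \<omega>)\<^sup>2)) \<longlonglongrightarrow> s"
    and "(\<lambda>n. char (distr M borel (S n)) t) \<longlonglongrightarrow> exp (- (t\<^sup>2 * s) / 2)"
proof -
  have cc: "(\<lambda>n. char (distr M borel (S n)) t) \<longlonglongrightarrow> complex_of_real (exp (- (t\<^sup>2 * s) / 2))" for t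
    unfolding char_normal_law[OF s, symmetric]
    by (rule levy_continuity1[OF _ real_distribution_normal_law wc]) simp
  show "(\<lambda>n. char (distr M borel (S n)) t) \<longlonglongrightarrow> exp (- (t\<^sup>2 * s) / 2)" by (rule cc)
  have int2: "integrable M (\<lambda>\<omega>. (S n \<omega>)\<^sup>2)" for n by (rule integrable_square_of_power4) (use int in auto)
  have K0: "0 \<le> K" using K[of 0] by (rule order_trans[rotated]) (simp add: integral_nonneg)
  define c where "c = (\<lambda>n t. Re (char (distr M borel (S n)) t))"
  have approx: "\<bar>2 * (1 - c n t) / t\<^sup>2 - expectation (\<lambda>\<omega>. (S n \<omega>)\<^sup>2)\<bar> \<le> t\<^sup>2 * K" if "t \<noteq> 0" for n t
  proof -
    have i1: "integrable M (\<lambda>\<omega>. iexp (t * S n \<omega>))" by (rule integrable_iexp) auto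
    have i1': "integrable M (\<lambda>\<omega>. cos (t * S n \<omega>))" using integrable_Re[OF i1] by (simp add: Re_exp)
    have c: "c n t = expectation (\<lambda>\<omega>. cos (t * S n \<omega>))"
      unfolding c_def char_def using integral_Re[OF i1] by (simp add: integral_distr Re_exp)
    have "\<bar>(1 - c n t) - t\<^sup>2 * expectation (\<lambda>\<omega>. (S n \<omega>)\<^sup>2) / 2\<bar>
       = \<bar>expectation (\<lambda>\<omega>. (1 - cos (t * S n \<omega>)) - (t * S n \<omega>)\<^sup>2 / 2)\<bar>"
      using i1' int2[of n] by (simp add: c prob_space power_mult_distrib)
    also have "\<dots> \<le> expectation (\<lambda>\<omega>. \<bar>(1 - cos (t * S n \<omega>)) - (t * S n \<omega>)\<^sup>2 / 2\<bar>)" by (rule integral_abs_bound)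
    also have "\<dots> \<le> expectation (\<lambda>\<omega>. t ^ 4 / 24 * S n \<omega> ^ 4)"
    proof (rule integral_mono)
      show "integrable M (\<lambda>\<omega>. \<bar>(1 - cos (t * S n \<omega>)) - (t * S n \<omega>)\<^sup>2 / 2\<bar>)"
        using i1' int2[of n] by (auto simp: power_mult_distrib)
      show "\<bar>(1 - cos (t * S n \<omega>)) - (t * S n \<omega>)\<^sup>2 / 2\<bar> \<le> t ^ 4 / 24 * S n \<omega> ^ 4" for \<omega>
        using one_minus_cos_approx[of "t * S n \<omega>"] by (simp add: power_mult_distrib)
    qed (use int[of n] in auto)
    also have "\<dots> \<le> t ^ 4 / 24 * K" using K[of n] by (simp add: mult_left_mono)
    also have "\<dots> \<le> t ^ 4 / 2 * K" using K0 by (intro mult_right_mono) auto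
    finally have "\<bar>(1 - c n t) - t\<^sup>2 * expectation (\<lambda>\<omega>. (S n \<omega>)\<^sup>2) / 2\<bar> * (2 / t\<^sup>2) \<le> t ^ 4 / 2 * K * (2 / t\<^sup>2)"
      by (rule mult_right_mono) simp
    moreover have "\<bar>(1 - c n t) - t\<^sup>2 * expectation (\<lambda>\<omega>. (S n \<omega>)\<^sup>2) / 2\<bar> * (2 / t\<^sup>2)
        = \<bar>((1 - c n t) - t\<^sup>2 * expectation (\<lambda>\<omega>. (S n \<omega>)\<^sup>2) / 2) * (2 / t\<^sup>2)\<bar>"
      unfolding abs_mult by simp
    moreover have "((1 - c n t) - t\<^sup>2 * expectation (\<lambda>\<omega>. (S n \<omega>)\<^sup>2) / 2) * (2 / t\<^sup>2)
        = 2 * (1 - c n t) / t\<^sup>2 - expectation (\<lambda>\<omega>. (S n \<omega>)\<^sup>2)" using that by (simp add: field_simps)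
    moreover have "t ^ 4 / 2 * K * (2 / t\<^sup>2) = t\<^sup>2 * K" using that by (simp add: power_eq_if)
    ultimately show ?thesis by (simp only:)
  qed
  show "(\<lambda>n. expectation (\<lambda>\<omega>. (S n \<omega>)\<^sup>2)) \<longlonglongrightarrow> s"
  proof (rule LIMSEQ_I)
    fix e :: real assume e: "0 < e"
    \<comment> \<open>Chosen so that t^2 K + t^2 s^2 + t^2 = e / 3; the 1 keeps the denominator
      positive.\<close>
    define t where "t = sqrt (e / (3 * (K + s\<^sup>2 + 1)))"
    have D: "0 < K + s\<^sup>2 + 1" using K0 by (simp add: add_nonneg_pos)
    have t: "0 < t" "t\<^sup>2 = e / (3 * (K + s\<^sup>2 + 1))" using e D by (auto simp: t_def)
    have "t\<^sup>2 * (K + s\<^sup>2 + 1) = e / 3" using D unfolding t(2) by (simp add: field_simps)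
    then have te: "t\<^sup>2 * K + t\<^sup>2 * s\<^sup>2 + t\<^sup>2 = e / 3" by (simp add: algebra_simps)
    have tp: "0 < t\<^sup>2" "0 \<le> t\<^sup>2 * K" "0 \<le> t\<^sup>2 * s\<^sup>2" using t(1) K0 by auto
    have lim: "\<bar>2 * (1 - exp (- (t\<^sup>2 * s) / 2)) / t\<^sup>2 - s\<bar> \<le> t\<^sup>2 * s\<^sup>2"
    proof -
      have "\<bar>(1 - exp (- (t\<^sup>2 * s / 2))) - t\<^sup>2 * s / 2\<bar> * (2 / t\<^sup>2) \<le> (t\<^sup>2 * s / 2)\<^sup>2 * (2 / t\<^sup>2)"
        using s by (intro mult_right_mono one_minus_exp_bounds) auto
      also have "\<dots> = t\<^sup>2 * s\<^sup>2 / 2" using t(1) by (simp add: power2_eq_square)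
      also have "\<dots> \<le> t\<^sup>2 * s\<^sup>2" by simp
      also have "\<bar>(1 - exp (- (t\<^sup>2 * s / 2))) - t\<^sup>2 * s / 2\<bar> * (2 / t\<^sup>2)
        = \<bar>((1 - exp (- (t\<^sup>2 * s / 2))) - t\<^sup>2 * s / 2) * (2 / t\<^sup>2)\<bar>" unfolding abs_mult by simp
      also have "((1 - exp (- (t\<^sup>2 * s / 2))) - t\<^sup>2 * s / 2) * (2 / t\<^sup>2) = 2 * (1 - exp (- (t\<^sup>2 * s) / 2)) / t\<^sup>2 - s"
        using t(1) by (simp add: field_simps)
      finally show ?thesis .
    qed
    have "(\<lambda>n. 2 * (1 - c n t) / t\<^sup>2) \<longlonglongrightarrow> 2 * (1 - Re (complex_of_real (exp (- (t\<^sup>2 * s) / 2)))) / t\<^sup>2"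
      unfolding c_def using t(1) by (intro tendsto_intros tendsto_Re cc) auto
    then have "(\<lambda>n. 2 * (1 - c n t) / t\<^sup>2) \<longlonglongrightarrow> 2 * (1 - exp (- (t\<^sup>2 * s) / 2)) / t\<^sup>2" by simp
    from LIMSEQ_D[OF this, of "e / 3"] e obtain N where
      N: "\<And>n. n \<ge> N \<Longrightarrow> \<bar>2 * (1 - c n t) / t\<^sup>2 - 2 * (1 - exp (- (t\<^sup>2 * s) / 2)) / t\<^sup>2\<bar> < e / 3"
      by (auto simp: real_norm_def)
    then have "\<bar>expectation (\<lambda>\<omega>. (S n \<omega>)\<^sup>2) - s\<bar> < e" if "n \<ge> N" for n
      
    proof -
      have "\<bar>2 * (1 - c n t) / t\<^sup>2 - expectation (\<lambda>\<omega>. (S n \<omega>)\<^sup>2)\<bar> \<le> t\<^sup>2 * K" using t(1) by (intro approx) simp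
      then show ?thesis using N[OF that] lim te tp by linarith
    qed
    then show "\<exists>no. \<forall>n\<ge>no. norm (expectation (\<lambda>\<omega>. (S n \<omega>)\<^sup>2) - s) < e" by (auto simp: real_norm_def)
  qed
qed

text \<open>Assumption \<open>clt\<close> yields some variance for each linear combination
  separately. Convergence of second moments and polarisation produce one limiting covariance, and
  uniqueness of limits forces each variance to be its quadratic form.\<close>

lemma (in prob_space) gaussian_limit_kernel:
  fixes Y :: "nat \<Rightarrow> 'i \<Rightarrow> 'a \<Rightarrow> real"
  assumes Y[measurable]: "\<And>n a. Y n a \<in> borel_measurable M"
    and clt: "\<And>A c. finite A \<Longrightarrow>
      \<exists>s\<ge>0. weak_conv_m (\<lambda>n. distr M borel (\<lambda>\<omega>. \<Sum>a\<in>A. c a * Y n a \<omega>)) (normal_law s)"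
    and mom: "\<And>A c. finite A \<Longrightarrow> \<exists>K. \<forall>n. integrable M (\<lambda>\<omega>. (\<Sum>a\<in>A. c a * Y n a \<omega>) ^ 4) \<and>
       expectation (\<lambda>\<omega>. (\<Sum>a\<in>A. c a * Y n a \<omega>) ^ 4) \<le> K"
  shows "\<exists>K. psd_kernel K \<and> (\<forall>A c t. finite A \<longrightarrow>
     (\<lambda>n. char (distr M borel (\<lambda>\<omega>. \<Sum>a\<in>A. c a * Y n a \<omega>)) t)
        \<longlonglongrightarrow> exp (- (t\<^sup>2 * (\<Sum>a\<in>A. \<Sum>b\<in>A. c a * c b * K a b)) / 2))"
proof -
  let ?S = "\<lambda>A c n \<omega>. \<Sum>a\<in>A. c a * Y n a \<omega>"
  have 1: "\<exists>s\<ge>0. ((\<lambda>n. expectation (\<lambda>\<omega>. (?S A c n \<omega>)\<^sup>2)) \<longlonglongrightarrow> s) \<and>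
      (\<forall>t. (\<lambda>n. char (distr M borel (?S A c n)) t) \<longlonglongrightarrow> exp (- (t\<^sup>2 * s) / 2))" if A: "finite A" for A c
  proof -
    obtain s where s: "0 \<le> s" "weak_conv_m (\<lambda>n. distr M borel (?S A c n)) (normal_law s)" using clt[OF A] by blast
    obtain K where K: "\<And>n. integrable M (\<lambda>\<omega>. (?S A c n \<omega>) ^ 4)" "\<And>n. expectation (\<lambda>\<omega>. (?S A c n \<omega>) ^ 4) \<le> K"
      using mom[OF A] by blast
    have m: "?S A c n \<in> borel_measurable M" for n by measurable
    show ?thesis using second_moment_convergence[OF m s K] s(1) by blast
  qed
  have int2: "integrable M (\<lambda>\<omega>. (?S A c n \<omega>)\<^sup>2)" if A: "finite A" for A c n
    using mom[OF A] by (intro integrable_square_of_power4) auto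
  have intY: "integrable M (\<lambda>\<omega>. (Y n a \<omega>)\<^sup>2)" for n a
    using int2[of "{a}" "\<lambda>_. 1"] by simp
  have intYY: "integrable M (\<lambda>\<omega>. Y n a \<omega> * Y n b \<omega>)" for n a b
  proof (rule Bochner_Integration.integrable_bound)
    show "integrable M (\<lambda>\<omega>. (Y n a \<omega>)\<^sup>2 + (Y n b \<omega>)\<^sup>2)" using intY by auto
    have "\<bar>x * y\<bar> \<le> x\<^sup>2 + y\<^sup>2" for x y :: real
    proof -
      have "0 \<le> (\<bar>x\<bar> - \<bar>y\<bar>)\<^sup>2" by simp
      then have "2 * \<bar>x * y\<bar> \<le> x\<^sup>2 + y\<^sup>2" by (simp add: power2_diff abs_mult)
      then show ?thesis using abs_ge_zero[of "x * y"] by linarith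
    qed
    then show "AE \<omega> in M. norm (Y n a \<omega> * Y n b \<omega>) \<le> norm ((Y n a \<omega>)\<^sup>2 + (Y n b \<omega>)\<^sup>2)"
      by (intro AE_I2) (simp add: abs_of_nonneg)
  qed measurable
  define K where "K = (\<lambda>a b. lim (\<lambda>n. expectation (\<lambda>\<omega>. Y n a \<omega> * Y n b \<omega>)))"
  have "convergent (\<lambda>n. expectation (\<lambda>\<omega>. Y n a \<omega> * Y n b \<omega>))" for a b
  proof (cases "a = b")
    case True
    obtain s where "(\<lambda>n. expectation (\<lambda>\<omega>. (?S {a} (\<lambda>_. 1) n \<omega>)\<^sup>2)) \<longlonglongrightarrow> s" using 1[of "{a}" "\<lambda>_. 1"] by blast
    then show ?thesis using True by (auto simp: power2_eq_square convergent_def)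
  next
    case False
    \<comment> \<open>Polarisation with Y_a + Y_b and Y_a - Y_b. The coefficients are a function of
      the index, so the two indices have to be distinct.\<close>
    obtain s where s: "(\<lambda>n. expectation (\<lambda>\<omega>. (?S {a,b} (\<lambda>_. 1) n \<omega>)\<^sup>2)) \<longlonglongrightarrow> s"
      using 1[of "{a,b}" "\<lambda>_. 1"] by blast
    obtain s' where s': "(\<lambda>n. expectation (\<lambda>\<omega>. (?S {a,b} (\<lambda>x. if x = a then 1 else -1) n \<omega>)\<^sup>2)) \<longlonglongrightarrow> s'"
      using 1[of "{a,b}" "\<lambda>x. if x = a then 1 else -1"] by blast
    have "expectation (\<lambda>\<omega>. (?S {a,b} (\<lambda>_. 1) n \<omega>)\<^sup>2) - expectation (\<lambda>\<omega>. (?S {a,b} (\<lambda>x. if x = a then 1 else -1) n \<omega>)\<^sup>2)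
       = 4 * expectation (\<lambda>\<omega>. Y n a \<omega> * Y n b \<omega>)" for n
    proof -
      have "expectation (\<lambda>\<omega>. (?S {a,b} (\<lambda>_. 1) n \<omega>)\<^sup>2) - expectation (\<lambda>\<omega>. (?S {a,b} (\<lambda>x. if x = a then 1 else -1) n \<omega>)\<^sup>2)
        = expectation (\<lambda>\<omega>. (?S {a,b} (\<lambda>_. 1) n \<omega>)\<^sup>2 - (?S {a,b} (\<lambda>x. if x = a then 1 else -1) n \<omega>)\<^sup>2)"
        by (rule Bochner_Integration.integral_diff[symmetric]) (rule int2; simp)+
      also have "\<dots> = expectation (\<lambda>\<omega>. 4 * (Y n a \<omega> * Y n b \<omega>))"
        using False by (intro Bochner_Integration.integral_cong) (auto simp: power2_eq_square algebra_simps)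
      finally show ?thesis by simp
    qed
    then have "(\<lambda>n. 4 * expectation (\<lambda>\<omega>. Y n a \<omega> * Y n b \<omega>)) \<longlonglongrightarrow> s - s'"
      using tendsto_diff[OF s s'] by simp
    from tendsto_mult_left[OF this, of "1/4"] show ?thesis by (auto simp: convergent_def)
  qed
  then have K: "(\<lambda>n. expectation (\<lambda>\<omega>. Y n a \<omega> * Y n b \<omega>)) \<longlonglongrightarrow> K a b" for a b
    unfolding K_def by (simp add: convergent_LIMSEQ_iff)
  have ex: "expectation (\<lambda>\<omega>. (?S A c n \<omega>)\<^sup>2) = (\<Sum>a\<in>A. \<Sum>b\<in>A. c a * c b * expectation (\<lambda>\<omega>. Y n a \<omega> * Y n b \<omega>))" for A c n
  proof -
    have "expectation (\<lambda>\<omega>. (?S A c n \<omega>)\<^sup>2) = expectation (\<lambda>\<omega>. \<Sum>a\<in>A. \<Sum>b\<in>A. c a * c b * (Y n a \<omega> * Y n b \<omega>))"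
      unfolding power2_eq_square sum_product by (simp add: mult_ac)
    then show ?thesis using intYY by (simp add: Bochner_Integration.integral_sum)
  qed
  have lim: "(\<lambda>n. expectation (\<lambda>\<omega>. (?S A c n \<omega>)\<^sup>2)) \<longlonglongrightarrow> (\<Sum>a\<in>A. \<Sum>b\<in>A. c a * c b * K a b)" for A c
    unfolding ex by (intro tendsto_intros K)
  have "psd_kernel K" unfolding psd_kernel_def
  proof (intro conjI allI impI)
    show "K a b = K b a" for a b unfolding K_def by (simp add: mult.commute)
    show "0 \<le> (\<Sum>a\<in>A. \<Sum>b\<in>A. c a * c b * K a b)" if "finite A" for A c
      using lim by (rule LIMSEQ_le_const) (auto intro!: exI[of _ 0] integral_nonneg)
  qed
  moreover have "(\<lambda>n. char (distr M borel (?S A c n)) t) \<longlonglongrightarrow> exp (- (t\<^sup>2 * (\<Sum>a\<in>A. \<Sum>b\<in>A. c a * c b * K a b)) / 2)"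
    if A: "finite A" for A c t
  proof -
    obtain s where s: "(\<lambda>n. expectation (\<lambda>\<omega>. (?S A c n \<omega>)\<^sup>2)) \<longlonglongrightarrow> s"
      "(\<lambda>n. char (distr M borel (?S A c n)) t) \<longlonglongrightarrow> exp (- (t\<^sup>2 * s) / 2)" using 1[OF A, of c] by blast
    have "s = (\<Sum>a\<in>A. \<Sum>b\<in>A. c a * c b * K a b)" by (rule LIMSEQ_unique[OF s(1) lim])
    then show ?thesis using s(2) by simp
  qed
  ultimately show ?thesis by blast
qed

text \<open>Dominated convergence passes to characteristic functions. The limit is continuous with
  value 1 at 0, hence positive at some u > 0, and the logarithm there shows that the variances
  converge; Levy's uniqueness theorem does the rest.\<close>

lemma (in prob_space) gaussian_limit:
  fixes V :: "nat \<Rightarrow> 'a \<Rightarrow> real"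
  assumes V: "\<And>k. V k \<in> borel_measurable M" and W: "W \<in> borel_measurable M"
    and char: "\<And>k t. char (distr M borel (V k)) t = exp (- (t\<^sup>2 * s k) / 2)" and s0: "\<And>k. 0 \<le> s k"
    and conv: "AE \<omega> in M. (\<lambda>k. V k \<omega>) \<longlonglongrightarrow> W \<omega>"
  shows "(AE \<omega> in M. W \<omega> = 0) \<or>
    (\<exists>\<sigma>>0. distributed M lborel W (\<lambda>x. ennreal (normal_density 0 \<sigma> x)))"
proof -
  note [measurable] = V W
  let ?c = "char (distr M borel W)"
  have cc: "(\<lambda>k. complex_of_real (exp (- (t\<^sup>2 * s k) / 2))) \<longlonglongrightarrow> ?c t" for t
  proof -
    have "(\<lambda>k. CLINT \<omega>|M. iexp (t * V k \<omega>)) \<longlonglongrightarrow> (CLINT \<omega>|M. iexp (t * W \<omega>))"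
    proof (rule integral_dominated_convergence[where w = "\<lambda>_. 1"])
      show "AE \<omega> in M. (\<lambda>k. iexp (t * V k \<omega>)) \<longlonglongrightarrow> iexp (t * W \<omega>)"
        using conv by eventually_elim (intro tendsto_intros)
    qed auto
    moreover have "(CLINT \<omega>|M. iexp (t * V k \<omega>)) = complex_of_real (exp (- (t\<^sup>2 * s k) / 2))" for k
      using char[of k t] by (simp add: char_def integral_distr)
    ultimately show ?thesis by (simp add: char_def integral_distr)
  qed
  have rd: "real_distribution (distr M borel W)" by simp
  interpret D: real_distribution "distr M borel W" by (rule rd)
  have cr: "(\<lambda>k. exp (- (t\<^sup>2 * s k) / 2)) \<longlonglongrightarrow> Re (?c t)" for t
    using tendsto_Re[OF cc[of t]] by simp
  have "(?c \<longlongrightarrow> ?c 0) (at 0)" using D.isCont_char[of 0] by (simp add: isCont_def)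
  then have "((\<lambda>t. Re (?c t)) \<longlongrightarrow> 1) (at 0)" using D.char_zero tendsto_Re by fastforce
  then have "\<forall>\<^sub>F t in at 0. 0 < Re (?c t)" by (rule order_tendstoD) simp
  then obtain d where d: "d > 0" "\<And>t. t \<noteq> 0 \<Longrightarrow> dist t 0 < d \<Longrightarrow> 0 < Re (?c t)"
    unfolding eventually_at by blast
  define u where "u = d / 2"
  have u: "0 < u" "0 < Re (?c u)" using d by (auto simp: u_def dist_real_def)
  have "(\<lambda>k. ln (exp (- (u\<^sup>2 * s k) / 2))) \<longlonglongrightarrow> ln (Re (?c u))"
    using cr[of u] u by (intro tendsto_ln) auto
  then have "(\<lambda>k. - (u\<^sup>2 * s k) / 2) \<longlonglongrightarrow> ln (Re (?c u))" by simp
  from tendsto_mult_left[OF this, of "- 2 / u\<^sup>2"]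
  obtain v where v: "s \<longlonglongrightarrow> v" using u by auto
  have v0: "0 \<le> v" by (rule LIMSEQ_le_const[OF v]) (use s0 in auto)
  have cW: "?c t = exp (- (t\<^sup>2 * v) / 2)" for t
  proof (rule LIMSEQ_unique[OF cc])
    show "(\<lambda>k. complex_of_real (exp (- (t\<^sup>2 * s k) / 2))) \<longlonglongrightarrow> complex_of_real (exp (- (t\<^sup>2 * v) / 2))"
      by (intro tendsto_intros v) auto
  qed
  have eq: "distr M borel W = normal_law v"
    by (rule Levy_uniqueness[OF rd real_distribution_normal_law]) (auto simp: cW char_normal_law[OF v0])
  show ?thesis
  proof (cases "v > 0")
    case True
    have "distr M lborel W = distr M borel W" by (rule distr_cong) auto
    then have "distr M lborel W = density lborel (\<lambda>x. ennreal (normal_density 0 (sqrt v) x))"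
      using eq True by (simp add: normal_law_def)
    then have "distributed M lborel W (\<lambda>x. ennreal (normal_density 0 (sqrt v) x))"
      by (simp add: distributed_def)
    then show ?thesis using True by (metis real_sqrt_gt_0_iff)
  next
    case False
    then have d: "distr M borel W = return borel 0" using eq by (simp add: normal_law_def)
    have "AE x in distr M borel W. x = 0" unfolding d by (subst AE_return) auto
    then show ?thesis by (subst (asm) AE_distr_iff) auto
  qed
qed

section \<open>Continuous distribution functions and quantiles\<close>

locale continuous_df = prob_space M for M :: "'a measure" +
  fixes Y :: "'a \<Rightarrow> real^'d"
  assumes Y_measurable [measurable]: "Y \<in> borel_measurable M"
    and df_continuous: "continuous_on UNIV (\<lambda>t::real^'d. measure M {\<omega> \<in> space M. \<forall>j. Y \<omega> $ j \<le> t $ j})"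
begin

lemma coordinate_measurable [measurable]: "(\<lambda>\<omega>. Y \<omega> $ i) \<in> borel_measurable M"
proof -
  have "(\<lambda>x::real^'d. x $ i) \<in> borel_measurable borel"
    by (intro borel_measurable_continuous_onI continuous_on_component continuous_on_id)
  then show ?thesis by (rule measurable_compose[OF Y_measurable])
qed

text \<open>The event that Y_i = x and the other coordinates are at most N lies in an increment of
  the joint distribution function in direction i, which tends to 0 by continuity. The truncation at
  N is removed at the end; it is there because continuity is assumed at finite arguments.\<close>

lemma no_atom: "prob {\<omega> \<in> space M. Y \<omega> $ i = x} = 0"
proof -
  define E where "E N = {\<omega> \<in> space M. Y \<omega> $ i = x \<and> (\<forall>j. j \<noteq> i \<longrightarrow> Y \<omega> $ j \<le> real N)}" for N :: nat
  have E[measurable]: "E N \<in> sets M" for N unfolding E_def by measurable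
  have "prob (E N) = 0" for N
  proof -
    define F where "F = (\<lambda>t::real^'d. prob {\<omega> \<in> space M. \<forall>j. Y \<omega> $ j \<le> t $ j})"
    define T where "T = (\<lambda>y. (\<chi> j. if j = i then y else real N) :: real^'d)"
    have "(\<lambda>m. x - 1 / real (Suc m)) \<longlonglongrightarrow> x - 0"
      by (intro tendsto_diff tendsto_const LIMSEQ_Suc lim_1_over_n)
    then have "(\<lambda>m. T (x - 1 / real (Suc m)) $ j) \<longlonglongrightarrow> T x $ j" for j
      by (cases "j = i") (simp_all only: T_def vec_lambda_beta if_True if_False diff_zero tendsto_const simp_thms)
    then have "(\<lambda>m. T (x - 1 / real (Suc m))) \<longlonglongrightarrow> T x"
      by (rule vec_tendstoI)
    moreover have "continuous_on UNIV F" unfolding F_def by (rule df_continuous)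
    ultimately have "(\<lambda>m. F (T (x - 1 / real (Suc m)))) \<longlonglongrightarrow> F (T x)"
      by (intro continuous_on_tendsto_compose[of UNIV F]) auto
    then have lim: "(\<lambda>m. F (T x) - F (T (x - 1 / real (Suc m)))) \<longlonglongrightarrow> F (T x) - F (T x)"
      by (intro tendsto_intros)
    have "prob (E N) \<le> F (T x) - F (T (x - 1 / real (Suc m)))" for m
    proof -
      define A where "A = (\<lambda>y. {\<omega> \<in> space M. \<forall>j. Y \<omega> $ j \<le> T y $ j})"
      have [measurable]: "A y \<in> sets M" for y unfolding A_def by measurable
      have sub: "A (x - 1 / real (Suc m)) \<subseteq> A x"
      proof
        fix \<omega> assume \<omega>: "\<omega> \<in> A (x - 1 / real (Suc m))"
        have "T (x - 1 / real (Suc m)) $ j \<le> T x $ j" for j by (simp add: T_def)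
        then show "\<omega> \<in> A x" using \<omega> unfolding A_def by (auto intro: order_trans)
      qed
      have "E N \<subseteq> A x - A (x - 1 / real (Suc m))"
        unfolding E_def A_def T_def by (auto intro!: exI[of _ i])
      then have "prob (E N) \<le> prob (A x - A (x - 1 / real (Suc m)))"
        by (intro finite_measure_mono) auto
      also have "\<dots> = prob (A x) - prob (A (x - 1 / real (Suc m)))"
        using sub by (intro finite_measure_Diff) auto
      finally show ?thesis by (simp add: F_def A_def)
    qed
    then have "prob (E N) \<le> F (T x) - F (T x)"
      by (intro LIMSEQ_le_const[OF lim]) auto
    then show ?thesis by (simp add: measure_le_0_iff)
  qed
  then have "E N \<in> null_sets M" for N using E by (simp add: emeasure_eq_measure null_sets_def)
  then have "(\<Union>N. E N) \<in> null_sets M" by (rule null_sets_UN)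
  moreover have "{\<omega> \<in> space M. Y \<omega> $ i = x} = (\<Union>N. E N)"
  proof -
    have "\<exists>N. \<forall>j. j \<noteq> i \<longrightarrow> Y \<omega> $ j \<le> real N" for \<omega>
    proof -
      obtain N where "(\<Sum>j\<in>UNIV. \<bar>Y \<omega> $ j\<bar>) \<le> real N" using real_arch_simple by blast
      moreover have "Y \<omega> $ j \<le> (\<Sum>j\<in>UNIV. \<bar>Y \<omega> $ j\<bar>)" for j
        using member_le_sum[of j UNIV "\<lambda>j. \<bar>Y \<omega> $ j\<bar>"] abs_ge_self[of "Y \<omega> $ j"] by simp
      ultimately show ?thesis by (meson order_trans)
    qed
    then show ?thesis unfolding E_def by blast
  qed
  ultimately show ?thesis by (simp add: measure_eq_0_null_sets)
qed

section \<open>Marginal distribution functions and quantiles on the extended line\<close>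

definition marginal_cdf :: "'d \<Rightarrow> ereal \<Rightarrow> real" where
  "marginal_cdf i x = prob {\<omega> \<in> space M. ereal (Y \<omega> $ i) \<le> x}"

lemma marginal_cdf_mono: "x \<le> y \<Longrightarrow> marginal_cdf i x \<le> marginal_cdf i y"
  unfolding marginal_cdf_def by (rule finite_measure_mono) (auto intro: order_trans)

lemma marginal_cdf_bounds: "0 \<le> marginal_cdf i x" "marginal_cdf i x \<le> 1"
  by (simp_all add: marginal_cdf_def)

lemma marginal_cdf_infinity [simp]: "marginal_cdf i \<infinity> = 1" "marginal_cdf i (-\<infinity>) = 0"
  by (simp_all add: marginal_cdf_def prob_space)

lemma marginal_cdf_eq_marginal_df: "marginal_cdf i (ereal x) = marginal_df M Y i x"
  by (simp add: marginal_cdf_def marginal_df_def)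

text \<open>Dominated convergence: off the null event that Y_i equals the limit point, the
  indicators are eventually constant. The points at infinity are included, which makes this
  continuity on a compact space.\<close>

lemma marginal_cdf_continuous: "continuous_on UNIV (marginal_cdf i)"
proof (rule continuous_on_sequentiallyI)
  fix u :: "nat \<Rightarrow> ereal" and a assume u: "u \<longlonglongrightarrow> a"
  have eq: "marginal_cdf i x = (LINT \<omega>|M. indicator {\<omega> \<in> space M. ereal (Y \<omega> $ i) \<le> x} \<omega>)" for x
    unfolding marginal_cdf_def by simp
  have "AE \<omega> in M. ereal (Y \<omega> $ i) \<noteq> a"
  proof (cases a)
    case (real r)
    have "{\<omega> \<in> space M. Y \<omega> $ i = r} \<in> null_sets M"
      using no_atom[of i r] by (intro null_setsI) (auto simp: emeasure_eq_measure)
    then have "AE \<omega> in M. \<omega> \<notin> {\<omega> \<in> space M. Y \<omega> $ i = r}" by (rule AE_not_in)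
    then show ?thesis using real by (auto elim: AE_mp)
  qed auto
  then have "AE \<omega> in M. (\<lambda>n. indicator {\<omega> \<in> space M. ereal (Y \<omega> $ i) \<le> u n} \<omega> :: real)
      \<longlonglongrightarrow> indicator {\<omega> \<in> space M. ereal (Y \<omega> $ i) \<le> a} \<omega>"
  proof (rule AE_mp, intro AE_I2 impI)
    fix \<omega> assume "\<omega> \<in> space M" "ereal (Y \<omega> $ i) \<noteq> a"
    then consider "ereal (Y \<omega> $ i) < a" | "ereal (Y \<omega> $ i) > a" by fastforce
    then have "\<forall>\<^sub>F n in sequentially. indicator {\<omega> \<in> space M. ereal (Y \<omega> $ i) \<le> u n} \<omega> =
      (indicator {\<omega> \<in> space M. ereal (Y \<omega> $ i) \<le> a} \<omega> :: real)"
    proof cases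
      case 1
      then have "\<forall>\<^sub>F n in sequentially. ereal (Y \<omega> $ i) < u n" using u by (simp add: order_tendstoD)
      then show ?thesis by eventually_elim (use 1 in \<open>auto simp: indicator_def\<close>)
    next
      case 2
      then have "\<forall>\<^sub>F n in sequentially. ereal (Y \<omega> $ i) > u n" using u by (simp add: order_tendstoD)
      then show ?thesis by eventually_elim (use 2 in \<open>auto simp: indicator_def\<close>)
    qed
    then show "(\<lambda>n. indicator {\<omega> \<in> space M. ereal (Y \<omega> $ i) \<le> u n} \<omega> :: real)
      \<longlonglongrightarrow> indicator {\<omega> \<in> space M. ereal (Y \<omega> $ i) \<le> a} \<omega>" by (rule tendsto_eventually)
  qed
  then show "(\<lambda>n. marginal_cdf i (u n)) \<longlonglongrightarrow> marginal_cdf i a"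
    unfolding eq by (intro integral_dominated_convergence[where w = "\<lambda>_. 1"]) (auto simp: indicator_def)
qed

text \<open>The infimum is taken in the extended line, so it always exists: levels at most 0 give
  -\<infinity>, and \<infinity> belongs to the set for every level at most 1.\<close>

definition quantile :: "'d \<Rightarrow> real \<Rightarrow> ereal" where
  "quantile i u = Inf {x. u \<le> marginal_cdf i x}"

lemma marginal_cdf_quantile_ge:
  assumes "u \<le> 1" shows "u \<le> marginal_cdf i (quantile i u)"
proof -
  have "closed {x. u \<le> marginal_cdf i x}"
    using marginal_cdf_continuous by (intro closed_Collect_le continuous_intros) auto
  moreover have "\<infinity> \<in> {x. u \<le> marginal_cdf i x}" using assms by simp
  ultimately have "Inf {x. u \<le> marginal_cdf i x} \<in> {x. u \<le> marginal_cdf i x}"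
    by (intro closed_contains_Inf_cl) blast+
  then show ?thesis by (simp add: quantile_def)
qed

text \<open>Galois connection, available because continuity turns the infimum into a minimum. The
  comparisons of a point with grid quantiles rest on it.\<close>

lemma quantile_le_iff: "u \<le> 1 \<Longrightarrow> quantile i u \<le> t \<longleftrightarrow> u \<le> marginal_cdf i t"
  using marginal_cdf_quantile_ge[of u i] marginal_cdf_mono[of "quantile i u" t i]
  by (auto simp: quantile_def intro: Inf_lower)

text \<open>If the value exceeded the level, continuity would leave some excess slightly further
  left, against minimality. The maximum with 0 is for negative levels, which occur as lower levels
  of cells with index 0.\<close>

lemma marginal_cdf_quantile:
  assumes "u \<le> 1" shows "marginal_cdf i (quantile i u) = max 0 u"
proof (cases "u \<le> 0")
  case True
  then have "quantile i u \<le> -\<infinity>" using marginal_cdf_bounds(1) by (subst quantile_le_iff) auto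
  then show ?thesis using True by simp
next
  case False
  then have nb: "-\<infinity> < quantile i u" using quantile_le_iff[OF assms, of i "-\<infinity>"] by simp
  have "marginal_cdf i (quantile i u) \<le> u"
  proof (rule ccontr)
    assume "\<not> marginal_cdf i (quantile i u) \<le> u"
    then have "quantile i u \<in> {x. u < marginal_cdf i x}" by simp
    moreover have "open {x. u < marginal_cdf i x}"
      using marginal_cdf_continuous by (intro open_Collect_less continuous_intros) auto
    ultimately obtain b where b: "b < quantile i u" "{b<..quantile i u} \<subseteq> {x. u < marginal_cdf i x}"
      using open_left[OF _ _ nb] by blast
    obtain z where z: "b < z" "z < quantile i u" using dense[OF b(1)] by blast
    then have "u < marginal_cdf i z" using b(2) by (auto simp: subset_iff)
    then have "quantile i u \<le> z" using quantile_le_iff[OF assms] by simp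
    then show False using z by simp
  qed
  then show ?thesis using marginal_cdf_quantile_ge[OF assms, of i] False by simp
qed

lemma quantile_mono: "u \<le> v \<Longrightarrow> quantile i u \<le> quantile i v"
  unfolding quantile_def by (rule Inf_superset_mono) auto

lemma quantile_nonpos: "u \<le> 0 \<Longrightarrow> quantile i u = -\<infinity>"
  using quantile_le_iff[of u i "-\<infinity>"] by simp

lemma quantile_strict_mono: "0 \<le> u \<Longrightarrow> u < v \<Longrightarrow> v \<le> 1 \<Longrightarrow> quantile i u < quantile i v"
  using quantile_mono[of u v i] marginal_cdf_quantile[of u i] marginal_cdf_quantile[of v i] by (cases "quantile i u = quantile i v") auto

lemma quantile_real:
  assumes "0 < u" "u < 1" obtains x where "quantile i u = ereal x" "marginal_df M Y i x = u"
proof (cases "quantile i u")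
  case (real r)
  then show ?thesis using that marginal_cdf_quantile[of u i] assms by (simp add: marginal_cdf_eq_marginal_df[symmetric])
qed (use marginal_cdf_quantile[of u i] assms in auto)

text \<open>Between the two quantiles the marginal grows by v - u, but these quantiles may be
  infinite while \<open>modulus\<close> sees only real arguments. The levels u + e and v - e lie
  strictly between 0 and 1, so their quantiles are real and no further apart; then e tends to
  0.\<close>

lemma modulus_ge:
  assumes "0 \<le> u" "u < v" "v \<le> 1"
  shows "v - u \<le> modulus (marginal_df M Y i) (quantile i v - quantile i u)"
proof -
  define S where "S = {\<bar>marginal_df M Y i t - marginal_df M Y i s\<bar> | s t. ereal \<bar>t - s\<bar> \<le> quantile i v - quantile i u}"
  have bdd: "bdd_above S"
  proof (rule bdd_aboveI)
    show "x \<le> 1" if x: "x \<in> S" for x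
    proof -
      obtain s t where "x = \<bar>marginal_cdf i (ereal t) - marginal_cdf i (ereal s)\<bar>"
        using x by (auto simp: S_def marginal_cdf_eq_marginal_df)
      then show ?thesis
        using marginal_cdf_bounds[of i "ereal s"] marginal_cdf_bounds[of i "ereal t"] by linarith
    qed
  qed
  have main: "(v - e) - (u + e) \<le> Sup S" if e: "0 < e" "u + e \<le> v - e" for e
  proof -
    have r: "0 < u + e" "u + e < 1" "0 < v - e" "v - e < 1" using e assms by auto
    obtain x where x: "quantile i (u + e) = ereal x" "marginal_df M Y i x = u + e"
      by (rule quantile_real[OF r(1,2)])
    obtain y where y: "quantile i (v - e) = ereal y" "marginal_df M Y i y = v - e"
      by (rule quantile_real[OF r(3,4)])
    have "x \<le> y" using quantile_mono[OF e(2), of i] x y by simp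
    have "ereal y - ereal x \<le> quantile i v - quantile i u"
      unfolding x(1)[symmetric] y(1)[symmetric] using e by (intro ereal_minus_mono quantile_mono) auto
    then have d: "ereal \<bar>y - x\<bar> \<le> quantile i v - quantile i u" using \<open>x \<le> y\<close> by simp
    have "\<bar>marginal_df M Y i y - marginal_df M Y i x\<bar> \<in> S"
      unfolding S_def by (rule CollectI, rule exI[of _ x], rule exI[of _ y], rule conjI[OF refl d])
    then have "\<bar>marginal_df M Y i y - marginal_df M Y i x\<bar> \<le> Sup S" by (rule cSup_upper[OF _ bdd])
    then show ?thesis using x y e by simp
  qed
  have "v - u \<le> Sup S"
  proof (rule field_le_epsilon)
    fix e :: real assume "0 < e"
    define e' where "e' = min (e / 2) ((v - u) / 2)"
    have "0 < e'" "u + e' \<le> v - e'" "2 * e' \<le> e"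
      using \<open>u < v\<close> \<open>0 < e\<close> by (auto simp: e'_def min_def field_simps)
    then show "v - u \<le> Sup S + e" using main[of e'] by linarith
  qed
  then show ?thesis by (simp add: modulus_def S_def)
qed

section \<open>The joint distribution function at extended arguments\<close>

lemma mdf_eq: "mdf M Y t = prob {\<omega> \<in> space M. \<forall>i. ereal (Y \<omega> $ i) \<le> t $ i}"
  by (simp add: mdf_def vle_def)

lemma vle_sets [measurable]: "{\<omega> \<in> space M. vle (Y \<omega>) t} \<in> sets M"
  unfolding vle_def by measurable

lemma mdf_mono: "(\<And>i. s $ i \<le> t $ i) \<Longrightarrow> mdf M Y s \<le> mdf M Y t"
  unfolding mdf_def by (rule finite_measure_mono) (auto simp: vle_def intro: order_trans)

text \<open>The difference of the two orthant events is covered by the slabs s_i < Y_i <=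
  t_i.\<close>

lemma mdf_diff_le:
  assumes le: "\<And>i. s $ i \<le> t $ i"
  shows "mdf M Y t - mdf M Y s \<le> (\<Sum>i\<in>UNIV. marginal_cdf i (t $ i) - marginal_cdf i (s $ i))"
proof -
  define A where "A = (\<lambda>t. {\<omega> \<in> space M. vle (Y \<omega>) t})"
  define B where "B = (\<lambda>i x. {\<omega> \<in> space M. ereal (Y \<omega> $ i) \<le> x})"
  have [measurable]: "A t \<in> sets M" "B i x \<in> sets M" for t i x unfolding A_def B_def by measurable
  have "mdf M Y r = prob (A r)" for r by (simp add: mdf_def A_def)
  then have "mdf M Y t - mdf M Y s = prob (A t) - prob (A s)" by simp
  also have "\<dots> = prob (A t - A s)"
    by (rule finite_measure_Diff[symmetric]) (use le in \<open>auto simp: A_def vle_def intro: order_trans\<close>)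
  also have "\<dots> \<le> prob (\<Union>i. B i (t $ i) - B i (s $ i))"
    by (rule finite_measure_mono) (auto simp: A_def B_def vle_def)
  also have "\<dots> \<le> (\<Sum>i\<in>UNIV. prob (B i (t $ i) - B i (s $ i)))"
    by (rule finite_measure_subadditive_finite) auto
  also have "\<dots> = (\<Sum>i\<in>UNIV. marginal_cdf i (t $ i) - marginal_cdf i (s $ i))"
  proof (rule sum.cong[OF refl])
    fix i
    have "B i (s $ i) \<subseteq> B i (t $ i)" using le[of i] by (auto simp: B_def intro: order_trans)
    then have "prob (B i (t $ i) - B i (s $ i)) = prob (B i (t $ i)) - prob (B i (s $ i))"
      by (intro finite_measure_Diff) auto
    then show "prob (B i (t $ i) - B i (s $ i)) = marginal_cdf i (t $ i) - marginal_cdf i (s $ i)"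
      by (simp add: marginal_cdf_def B_def)
  qed
  finally show ?thesis .
qed

text \<open>Points that are not ordered are both compared with their componentwise minimum.\<close>

lemma abs_mdf_diff_le: "\<bar>mdf M Y t - mdf M Y s\<bar> \<le> (\<Sum>i\<in>UNIV. \<bar>marginal_cdf i (t $ i) - marginal_cdf i (s $ i)\<bar>)"
proof -
  define m where "m = (\<chi> i. min (s $ i) (t $ i))"
  have e: "marginal_cdf i (m $ i) = min (marginal_cdf i (s $ i)) (marginal_cdf i (t $ i))" for i
    using marginal_cdf_mono[of "s $ i" "t $ i" i] marginal_cdf_mono[of "t $ i" "s $ i" i] unfolding m_def
    by (cases "s $ i \<le> t $ i") auto
  have m: "m $ i \<le> s $ i" "m $ i \<le> t $ i" for i by (auto simp: m_def)
  have d: "mdf M Y u - mdf M Y m \<le> (\<Sum>i\<in>UNIV. \<bar>marginal_cdf i (t $ i) - marginal_cdf i (s $ i)\<bar>)"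
    if "u = s \<or> u = t" for u
  proof -
    have "mdf M Y u - mdf M Y m \<le> (\<Sum>i\<in>UNIV. marginal_cdf i (u $ i) - marginal_cdf i (m $ i))"
      by (rule mdf_diff_le) (use m that in auto)
    also have "\<dots> \<le> (\<Sum>i\<in>UNIV. \<bar>marginal_cdf i (t $ i) - marginal_cdf i (s $ i)\<bar>)"
      by (rule sum_mono) (use that in \<open>auto simp: e\<close>)
    finally show ?thesis .
  qed
  have "mdf M Y m \<le> mdf M Y s" "mdf M Y m \<le> mdf M Y t" using m by (auto intro: mdf_mono)
  then show ?thesis using d[OF disjI1[OF refl]] d[OF disjI2[OF refl]] by linarith
qed

lemma mdf_continuous: "continuous_on UNIV (mdf M Y)"
  unfolding continuous_on_def
proof
  fix t
  have *: "((\<lambda>s. marginal_cdf i (s $ i)) \<longlongrightarrow> marginal_cdf i (t $ i)) (at t within UNIV)" for i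
  proof -
    have "isCont (marginal_cdf i) (t $ i)" using marginal_cdf_continuous[of i] by (simp add: continuous_on_eq_continuous_at)
    then show ?thesis by (rule isCont_tendsto_compose) (intro tendsto_intros)
  qed
  have "((\<lambda>s. \<Sum>i\<in>UNIV. \<bar>marginal_cdf i (s $ i) - marginal_cdf i (t $ i)\<bar>) \<longlongrightarrow> (\<Sum>i\<in>UNIV. \<bar>marginal_cdf i (t $ i) - marginal_cdf i (t $ i)\<bar>)) (at t within UNIV)"
    by (intro tendsto_intros *)
  then have "((\<lambda>s. \<Sum>i\<in>UNIV. \<bar>marginal_cdf i (s $ i) - marginal_cdf i (t $ i)\<bar>) \<longlongrightarrow> 0) (at t within UNIV)" by simp
  then have "((\<lambda>s. mdf M Y s - mdf M Y t) \<longlongrightarrow> 0) (at t within UNIV)"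
    by (rule Lim_null_comparison[rotated]) (use abs_mdf_diff_le in auto)
  then show "(mdf M Y \<longlongrightarrow> mdf M Y t) (at t within UNIV)" by (simp add: LIM_zero_iff)
qed

end

section \<open>Consequences of the moment bound\<close>

lemma vle_measurable [measurable]:
  fixes t :: "ereal^'d"
  shows "{x. vle x t} \<in> sets borel"
proof -
  have "{x. vle x t} = (\<Inter>i. {x. ereal (x $ i) \<le> t $ i})" by (auto simp: vle_def)
  moreover have "closed {x :: real^'d. ereal (x $ i) \<le> t $ i}" for i :: 'd
    by (intro closed_Collect_le continuous_intros)
  ultimately have "closed {x. vle x t}" by (simp add: closed_INT)
  then show ?thesis by simp
qed

locale empirical_setting = continuous_df M "X 0" for M :: "'a measure" and X :: "nat \<Rightarrow> 'a \<Rightarrow> real^'d" +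
  fixes G :: "(real^'d \<Rightarrow> real) set" and normG :: "(real^'d \<Rightarrow> real) \<Rightarrow> real" and \<Psi> :: "real \<Rightarrow> real"
    and C r :: real and p :: nat and \<gamma> :: "nat \<Rightarrow> real" and \<Phi> :: "nat \<Rightarrow> real \<Rightarrow> real"
  assumes X_measurable [measurable]: "\<And>i. X i \<in> borel_measurable M"
    and G_measurable: "\<And>f. f \<in> G \<Longrightarrow> f \<in> borel_measurable borel"
    and G_add: "\<And>f g. f \<in> G \<Longrightarrow> g \<in> G \<Longrightarrow> (\<lambda>x. f x + g x) \<in> G"
    and G_scale: "\<And>f c. f \<in> G \<Longrightarrow> (\<lambda>x. c * f x) \<in> G"
    and G_const: "\<And>c. (\<lambda>x. c) \<in> G"
    and normG_nonneg: "\<And>f. f \<in> G \<Longrightarrow> normG f \<ge> 0"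
    and normG_scale: "\<And>f c. f \<in> G \<Longrightarrow> normG (\<lambda>x. c * f x) = \<bar>c\<bar> * normG f"
    and normG_triangle: "\<And>f g. f \<in> G \<Longrightarrow> g \<in> G \<Longrightarrow> normG (\<lambda>x. f x + g x) \<le> normG f + normG g"
    and clt: "\<And>f. f \<in> G \<Longrightarrow> (\<exists>B. \<forall>x. \<bar>f x\<bar> \<le> B) \<Longrightarrow> (LINT \<omega>|M. f (X 0 \<omega>)) = 0 \<Longrightarrow>
       \<exists>s2\<ge>0. weak_conv_m (\<lambda>n. distr M borel (\<lambda>\<omega>. (1 / sqrt n) * (\<Sum>i=1..n. f (X i \<omega>)))) (normal_law s2)"
    and control: "control_function G normG (marginal_df M (X 0)) \<Psi>"
    and C: "C > 0" and r: "r \<ge> 1" and p: "real p > r * real CARD('d)"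
    and \<gamma>: "\<And>i. i \<in> {1..p} \<Longrightarrow> 0 \<le> \<gamma> i" "\<And>i. i \<in> {1..p} \<Longrightarrow> \<gamma> i < real i / r + 2 * (real p - real i) - real CARD('d)"
    and \<Phi>_mono: "\<And>i. i \<in> {1..p} \<Longrightarrow> mono_on {0..} (\<Phi> i)"
    and \<Phi>_nonneg: "\<And>i z. i \<in> {1..p} \<Longrightarrow> 0 \<le> z \<Longrightarrow> 0 \<le> \<Phi> i z"
    and \<Phi>_bigo: "\<And>i. i \<in> {1..p} \<Longrightarrow> (\<lambda>z. \<Phi> i (2 * \<Psi> z)) \<in> O[at_top](\<lambda>z. z powr \<gamma> i)"
    and moment: "\<And>f n. f \<in> G \<Longrightarrow> (\<forall>x. \<bar>f x\<bar> \<le> 1) \<Longrightarrow> n \<ge> 1 \<Longrightarrow>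
          (LINT \<omega>|M. \<bar>\<Sum>i=1..n. f (X i \<omega>) - (LINT \<omega>|M. f (X 0 \<omega>))\<bar> ^ (2 * p))
             \<le> C * (\<Sum>i=1..p. real n ^ i
                   * ((LINT \<omega>|M. \<bar>f (X 0 \<omega>) - (LINT \<omega>|M. f (X 0 \<omega>))\<bar> powr r) powr (1 / r)) ^ i
                   * \<Phi> i (normG (\<lambda>x. f x - (LINT \<omega>|M. f (X 0 \<omega>)))))"
begin

section \<open>Normalised sums: linearity and integrability\<close>

definition mean :: "(real^'d \<Rightarrow> real) \<Rightarrow> real" where
  "mean f = (LINT \<omega>|M. f (X 0 \<omega>))"

definition normalized_sum :: "nat \<Rightarrow> (real^'d \<Rightarrow> real) \<Rightarrow> 'a \<Rightarrow> real" where
  "normalized_sum n f \<omega> = (1 / sqrt n) * (\<Sum>i=1..n. f (X i \<omega>) - mean f)"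

abbreviation "bounded_fun f \<equiv> \<exists>B. \<forall>x. \<bar>f x :: real\<bar> \<le> B"

lemma comp_measurable [measurable (raw)]:
  assumes "f \<in> borel_measurable borel" shows "(\<lambda>\<omega>. f (X i \<omega>)) \<in> borel_measurable M"
  by (rule measurable_compose[OF X_measurable assms])

lemma comp_integrable:
  assumes "f \<in> borel_measurable borel" "bounded_fun f" shows "integrable M (\<lambda>\<omega>. f (X i \<omega>))"
proof -
  obtain B where "\<And>x. \<bar>f x\<bar> \<le> B" using assms by blast
  then show ?thesis using assms(1) by (intro integrable_const_bound[of _ B]) auto
qed

lemma normalized_sum_measurable [measurable]: "f \<in> borel_measurable borel \<Longrightarrow> normalized_sum n f \<in> borel_measurable M"
  unfolding normalized_sum_def[abs_def]
  by (intro borel_measurable_times borel_measurable_const borel_measurable_sum borel_measurable_diff comp_measurable)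

lemma normalized_sum_bounded:
  assumes "\<And>x. \<bar>f x\<bar> \<le> B" shows "\<exists>K. \<forall>\<omega>. \<bar>normalized_sum n f \<omega>\<bar> \<le> K"
proof -
  have "\<bar>normalized_sum n f \<omega>\<bar> \<le> (1 / sqrt n) * (\<Sum>i=1..n. (B + \<bar>mean f\<bar>))" for \<omega>
  proof -
    have "\<bar>\<Sum>i=1..n. f (X i \<omega>) - mean f\<bar> \<le> (\<Sum>i=1..n. \<bar>f (X i \<omega>) - mean f\<bar>)" by (rule sum_abs)
    also have "\<dots> \<le> (\<Sum>i=1..n. B + \<bar>mean f\<bar>)"
      by (rule sum_mono) (meson assms abs_triangle_ineq4 add_right_mono order_trans)
    finally show ?thesis unfolding normalized_sum_def by (simp add: abs_mult divide_right_mono)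
  qed
  then show ?thesis by blast
qed

lemma normalized_sum_power_integrable:
  assumes "f \<in> borel_measurable borel" "bounded_fun f"
  shows "integrable M (\<lambda>\<omega>. normalized_sum n f \<omega> ^ k)"
proof -
  obtain K where K: "\<And>\<omega>. \<bar>normalized_sum n f \<omega>\<bar> \<le> K" using normalized_sum_bounded assms(2) by metis
  then show ?thesis using assms(1)
    by (intro integrable_const_bound[of _ "K ^ k"] AE_I2) (auto simp: power_abs intro: power_mono)
qed

lemma mean_add:
  assumes "f \<in> borel_measurable borel" "bounded_fun f" "g \<in> borel_measurable borel" "bounded_fun g"
  shows "mean (\<lambda>x. f x + g x) = mean f + mean g"
  unfolding mean_def using assms by (intro Bochner_Integration.integral_add comp_integrable)

lemma mean_scale: "mean (\<lambda>x. c * f x) = c * mean f"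
  unfolding mean_def by simp

lemma mean_const: "mean (\<lambda>x. c) = c"
  unfolding mean_def by (simp add: prob_space)

lemma mean_mono:
  assumes "f \<in> borel_measurable borel" "bounded_fun f" "g \<in> borel_measurable borel" "bounded_fun g"
    and "\<And>x. f x \<le> g x"
  shows "mean f \<le> mean g"
  unfolding mean_def using assms by (intro integral_mono comp_integrable) auto

lemma abs_mean_le: "\<bar>mean f\<bar> \<le> mean (\<lambda>x. \<bar>f x\<bar>)"
  unfolding mean_def by (rule integral_abs_bound)

lemma normalized_sum_scale: "normalized_sum n (\<lambda>x. c * f x) \<omega> = c * normalized_sum n f \<omega>"
  unfolding normalized_sum_def mean_scale by (simp add: right_diff_distrib[symmetric] sum_distrib_left[symmetric])

lemma normalized_sum_add:
  assumes "f \<in> borel_measurable borel" "bounded_fun f" "g \<in> borel_measurable borel" "bounded_fun g"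
  shows "normalized_sum n (\<lambda>x. f x + g x) \<omega> = normalized_sum n f \<omega> + normalized_sum n g \<omega>"
  unfolding normalized_sum_def mean_add[OF assms] by (simp add: sum.distrib sum_subtractf algebra_simps)

lemma normalized_sum_diff:
  assumes "f \<in> borel_measurable borel" "bounded_fun f" "g \<in> borel_measurable borel" "bounded_fun g"
  shows "normalized_sum n (\<lambda>x. f x - g x) \<omega> = normalized_sum n f \<omega> - normalized_sum n g \<omega>"
proof -
  have "bounded_fun (\<lambda>x. (-1) * g x)" using assms(4) by auto
  then have "normalized_sum n (\<lambda>x. f x + (-1) * g x) \<omega> = normalized_sum n f \<omega> + normalized_sum n (\<lambda>x. (-1) * g x) \<omega>"
    using assms by (intro normalized_sum_add) auto
  then show ?thesis unfolding normalized_sum_scale by simp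
qed

lemma p_pos: "1 \<le> p" "2 \<le> p"
proof -
  have "real CARD('d) \<le> r * real CARD('d)" using r by (simp add: mult_le_cancel_right1)
  moreover have "1 \<le> real CARD('d)" by (simp add: Suc_leI)
  ultimately have "1 < real p" using p by linarith
  then show "1 \<le> p" "2 \<le> p" by auto
qed

lemma \<Psi>_nonneg: "0 \<le> z \<Longrightarrow> 0 \<le> \<Psi> z" and \<Psi>_mono: "0 \<le> y \<Longrightarrow> y \<le> z \<Longrightarrow> \<Psi> y \<le> \<Psi> z"
  using control by (auto simp: control_function_def mono_on_def)

lemma G_diff: "f \<in> G \<Longrightarrow> g \<in> G \<Longrightarrow> (\<lambda>x. f x - g x) \<in> G"
  using G_add[of f "\<lambda>x. (-1) * g x"] G_scale[of g "-1"] by simp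

lemma normG_diff: "f \<in> G \<Longrightarrow> g \<in> G \<Longrightarrow> normG (\<lambda>x. f x - g x) \<le> normG f + normG g"
  using normG_triangle[of f "\<lambda>x. (-1) * g x"] G_scale[of g "-1"] normG_scale[of g "-1"] by simp

lemma normG_const: "normG (\<lambda>x. c) = \<bar>c\<bar> * normG (\<lambda>x. 1)"
  using normG_scale[of "\<lambda>x. 1" c] G_const by simp

lemma expectation_normalized_sum_power:
  assumes "n \<ge> 1"
  shows "(LINT \<omega>|M. normalized_sum n f \<omega> ^ (2 * p)) = (LINT \<omega>|M. \<bar>\<Sum>i=1..n. f (X i \<omega>) - mean f\<bar> ^ (2 * p)) / real n ^ p"
proof -
  have "normalized_sum n f \<omega> ^ (2 * p) = \<bar>\<Sum>i=1..n. f (X i \<omega>) - mean f\<bar> ^ (2 * p) / real n ^ p" for \<omega>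
    unfolding normalized_sum_def by (simp add: power_mult_distrib power_divide power_mult power_even_abs)
  then show ?thesis by simp
qed

section \<open>From the moment bound to geometric decay at level l\<close>

text \<open>Centring \<open>f\<close> may increase its seminorm by a multiple of \<open>normG 1\<close>. Since the growth of
  \<open>\<Phi> i\<close> is only controlled along the values of \<open>2 * \<Psi>\<close>, the excess is removed by shrinking \<open>f\<close>
  by a fixed factor \<open>\<theta>\<close>; this is impossible only if \<open>\<Psi> = 0\<close>, and then \<open>\<Phi> i\<close> enters at a single point.\<close>

lemma shrink_factor:
  assumes "0 \<le> K"
  shows "\<exists>\<theta> D z1. 0 < \<theta> \<and> \<theta> \<le> 1 \<and> 0 \<le> D \<and> 1 \<le> z1 \<and>
    (\<forall>z\<ge>z1. \<forall>i\<in>{1..p}. \<Phi> i (\<theta> * (2 * \<Psi> z + K)) \<le> D * z powr \<gamma> i)"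
proof (cases "\<exists>z0\<ge>0. 0 < \<Psi> z0")
  case True
  then obtain z0 where z0: "0 \<le> z0" "0 < \<Psi> z0" by blast
  \<comment> \<open>With this factor \<theta> (2 y + K) <= 2 y for all y >=
    \<open>\<Psi> z0\<close>, so monotonicity brings the argument of \<open>\<Phi> i\<close> back to
    \<open>2 * \<Psi> z\<close>.\<close>
  define \<theta> where "\<theta> = 2 * \<Psi> z0 / (2 * \<Psi> z0 + K)"
  have \<theta>: "0 < \<theta>" "\<theta> \<le> 1" using z0 assms by (auto simp: \<theta>_def field_simps)
  have "\<forall>i\<in>{1..p}. \<exists>c. c > 0 \<and> (\<forall>\<^sub>F z in at_top. norm (\<Phi> i (2 * \<Psi> z)) \<le> c * norm (z powr \<gamma> i))"
    using \<Phi>_bigo by (auto simp: bigo_def)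
  then obtain c where c: "\<And>i. i \<in> {1..p} \<Longrightarrow> c i > 0"
    "\<And>i. i \<in> {1..p} \<Longrightarrow> \<forall>\<^sub>F z in at_top. norm (\<Phi> i (2 * \<Psi> z)) \<le> c i * norm (z powr \<gamma> i)" by metis
  define D where "D = (\<Sum>i=1..p. c i)"
  have cD: "c i \<le> D" if "i \<in> {1..p}" for i
    unfolding D_def using that c(1) by (intro member_le_sum) (auto intro: less_imp_le)
  have "\<forall>\<^sub>F z in at_top. \<forall>i\<in>{1..p}. norm (\<Phi> i (2 * \<Psi> z)) \<le> c i * norm (z powr \<gamma> i)"
    using c(2) by (intro eventually_ball_finite) auto
  then obtain z1 where z1: "\<And>z i. z \<ge> z1 \<Longrightarrow> i \<in> {1..p} \<Longrightarrow> norm (\<Phi> i (2 * \<Psi> z)) \<le> c i * norm (z powr \<gamma> i)"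
    unfolding eventually_at_top_linorder by blast
  define z2 where "z2 = max z1 (max z0 1)"
  have "\<Phi> i (\<theta> * (2 * \<Psi> z + K)) \<le> D * z powr \<gamma> i" if z: "z \<ge> z2" and i: "i \<in> {1..p}" for z i
  proof -
    have zz: "z1 \<le> z" "z0 \<le> z" "0 \<le> z" using z z0 by (auto simp: z2_def)
    have P: "\<Psi> z0 \<le> \<Psi> z" using \<Psi>_mono[OF z0(1) zz(2)] .
    have "2 * \<Psi> z0 * (2 * \<Psi> z + K) \<le> 2 * \<Psi> z * (2 * \<Psi> z0 + K)"
      using mult_right_mono[OF P assms] by (simp add: algebra_simps)
    then have "\<theta> * (2 * \<Psi> z + K) \<le> 2 * \<Psi> z"
      using z0 assms by (simp add: \<theta>_def divide_le_eq)
    then have "\<Phi> i (\<theta> * (2 * \<Psi> z + K)) \<le> \<Phi> i (2 * \<Psi> z)"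
      using \<Phi>_mono[OF i] \<theta> assms \<Psi>_nonneg[OF zz(3)] by (intro mono_onD[OF \<Phi>_mono[OF i]]) auto
    also have "\<dots> \<le> c i * z powr \<gamma> i" using z1[OF zz(1) i] by simp
    also have "\<dots> \<le> D * z powr \<gamma> i" using cD[OF i] by (intro mult_right_mono) auto
    finally show ?thesis .
  qed
  moreover have "0 \<le> D" unfolding D_def using c(1) by (intro sum_nonneg) (auto intro: less_imp_le)
  ultimately show ?thesis using \<theta> by (intro exI[of _ \<theta>] exI[of _ D] exI[of _ z2]) (auto simp: z2_def)
next
  case False
  then have P0: "\<Psi> z = 0" if "0 \<le> z" for z using \<Psi>_nonneg[OF that] that by force
  define D where "D = (\<Sum>i=1..p. \<Phi> i K)"
  have D: "\<Phi> i K \<le> D" if "i \<in> {1..p}" for i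
    unfolding D_def using that \<Phi>_nonneg[OF _ assms] by (intro member_le_sum) auto
  have D0: "0 \<le> D" unfolding D_def using \<Phi>_nonneg[OF _ assms] by (intro sum_nonneg) auto
  \<comment> \<open>Here \<theta> = 1. As \<open>\<gamma> i\<close> is nonnegative, z powr
    \<open>\<gamma> i\<close> is at least 1 and a constant bound suffices.\<close>
  have "\<Phi> i (1 * (2 * \<Psi> z + K)) \<le> D * z powr \<gamma> i" if z: "1 \<le> z" and i: "i \<in> {1..p}" for z i
  proof -
    have "1 \<le> z powr \<gamma> i" using z \<gamma>(1)[OF i] by (rule ge_one_powr_ge_zero)
    then have "D * 1 \<le> D * z powr \<gamma> i" using D0 by (intro mult_left_mono)
    then show ?thesis using P0[of z] z D[OF i] by simp
  qed
  then show ?thesis using D0 by (intro exI[of _ 1] exI[of _ D]) auto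
qed

text \<open>|f - mean f| / 2 is at most 1, hence so is its r-th power, which is at most the first
  power. Thus the L^r norm is controlled by the (1/r)-th power of the L^1 norm, and it is the L^1
  norm that bracketing makes small.\<close>

lemma Lr_norm_le:
  assumes f: "f \<in> borel_measurable borel" "\<And>x. \<bar>f x\<bar> \<le> 1" and \<theta>: "0 < \<theta>" "\<theta> \<le> 1"
  shows "(LINT \<omega>|M. \<bar>\<theta> * f (X 0 \<omega>) - \<theta> * mean f\<bar> powr r) powr (1 / r) \<le> 2 * mean (\<lambda>x. \<bar>f x\<bar>) powr (1 / r)"
proof -
  have m1: "\<bar>mean f\<bar> \<le> 1"
  proof -
    have "mean (\<lambda>x. \<bar>f x\<bar>) \<le> mean (\<lambda>x. 1)" using f by (intro mean_mono) auto
    then show ?thesis using abs_mean_le[of f] by (simp add: mean_const)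
  qed
  have int: "integrable M (\<lambda>\<omega>. f (X 0 \<omega>))" using f by (intro comp_integrable) auto
  have inta: "integrable M (\<lambda>\<omega>. \<bar>f (X 0 \<omega>) - mean f\<bar>)" using int by auto
  have pw: "\<bar>\<theta> * y - \<theta> * mean f\<bar> powr r \<le> 2 powr r * (\<bar>y - mean f\<bar> / 2)" if "\<bar>y\<bar> \<le> 1" for y
  proof -
    have "\<bar>\<theta> * y - \<theta> * mean f\<bar> = \<theta> * \<bar>y - mean f\<bar>"
      using \<theta> by (simp add: right_diff_distrib[symmetric] abs_mult)
    also have "\<dots> \<le> 1 * \<bar>y - mean f\<bar>" using \<theta> by (intro mult_right_mono) auto
    finally have "\<bar>\<theta> * y - \<theta> * mean f\<bar> powr r \<le> \<bar>y - mean f\<bar> powr r"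
      using r by (intro powr_mono2) auto
    also have "\<dots> = (2 * (\<bar>y - mean f\<bar> / 2)) powr r" by simp
    also have "\<dots> = 2 powr r * (\<bar>y - mean f\<bar> / 2) powr r" by (rule powr_mult)
    also have "(\<bar>y - mean f\<bar> / 2) powr r \<le> (\<bar>y - mean f\<bar> / 2) powr 1"
      using that m1 r by (intro powr_mono') auto
    finally show ?thesis by simp
  qed
  have "(LINT \<omega>|M. \<bar>\<theta> * f (X 0 \<omega>) - \<theta> * mean f\<bar> powr r) \<le> (LINT \<omega>|M. 2 powr r * (\<bar>f (X 0 \<omega>) - mean f\<bar> / 2))"
  proof (rule integral_mono)
    show i2: "integrable M (\<lambda>\<omega>. 2 powr r * (\<bar>f (X 0 \<omega>) - mean f\<bar> / 2))" using inta by auto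
    show "integrable M (\<lambda>\<omega>. \<bar>\<theta> * f (X 0 \<omega>) - \<theta> * mean f\<bar> powr r)"
      by (rule Bochner_Integration.integrable_bound[OF i2]) (use f pw in auto)
  qed (use pw f in auto)
  also have "\<dots> = 2 powr r * ((LINT \<omega>|M. \<bar>f (X 0 \<omega>) - mean f\<bar>) / 2)" by simp
  also have "\<dots> \<le> 2 powr r * mean (\<lambda>x. \<bar>f x\<bar>)"
  proof -
    have "(LINT \<omega>|M. \<bar>f (X 0 \<omega>) - mean f\<bar>) \<le> (LINT \<omega>|M. \<bar>f (X 0 \<omega>)\<bar> + \<bar>mean f\<bar>)"
      using int inta by (intro integral_mono) auto
    also have "\<dots> = mean (\<lambda>x. \<bar>f x\<bar>) + \<bar>mean f\<bar>" using int by (simp add: mean_def prob_space)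
    also have "\<dots> \<le> 2 * mean (\<lambda>x. \<bar>f x\<bar>)" using abs_mean_le[of f] by simp
    finally show ?thesis by (intro mult_left_mono) auto
  qed
  finally have "(LINT \<omega>|M. \<bar>\<theta> * f (X 0 \<omega>) - \<theta> * mean f\<bar> powr r) powr (1 / r) \<le> (2 powr r * mean (\<lambda>x. \<bar>f x\<bar>)) powr (1 / r)"
    using r by (intro powr_mono2 integral_nonneg) auto
  also have "\<dots> = (2 powr r) powr (1 / r) * mean (\<lambda>x. \<bar>f x\<bar>) powr (1 / r)"
    by (rule powr_mult)
  also have "(2 powr r) powr (1 / r) = 2" using r by (simp add: powr_powr)
  finally show ?thesis .
qed

lemma abs_mean_le_1:
  assumes "f \<in> borel_measurable borel" "\<And>x. \<bar>f x\<bar> \<le> 1"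
  shows "\<bar>mean f\<bar> \<le> 1"
proof -
  have "mean (\<lambda>x. \<bar>f x\<bar>) \<le> mean (\<lambda>x. 1)" using assms by (intro mean_mono) auto
  then show ?thesis using abs_mean_le[of f] by (simp add: mean_const)
qed

text \<open>The moment bound is applied to \<theta> f, whose seminorm after centring is at most
  \<theta> times that of f plus that of 1; homogeneity returns to f at the price of \<theta>^(-2p).
  The bound \<open>b\<close> is left open because its two uses estimate \<open>\<Phi> i\<close>
  differently.\<close>

lemma normalized_sum_moment:
  assumes f: "f \<in> G" "\<And>x. \<bar>f x\<bar> \<le> 1" and n: "n \<ge> 1" and \<theta>: "0 < \<theta>" "\<theta> \<le> 1"
    and b: "\<And>i. i \<in> {1..p} \<Longrightarrow> \<Phi> i (\<theta> * (normG f + normG (\<lambda>x. 1))) \<le> b i"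
  shows "(LINT \<omega>|M. normalized_sum n f \<omega> ^ (2 * p)) \<le> C / \<theta> ^ (2 * p) *
     (\<Sum>i=1..p. real n ^ i / real n ^ p * (2 * mean (\<lambda>x. \<bar>f x\<bar>) powr (1 / r)) ^ i * b i)"
proof -
  define g where "g = (\<lambda>x. \<theta> * f x)"
  have fm: "f \<in> borel_measurable borel" by (rule G_measurable[OF f(1)])
  have g: "g \<in> G" unfolding g_def by (rule G_scale[OF f(1)])
  have g1: "\<bar>g x\<bar> \<le> 1" for x
    using \<theta> f(2)[of x] unfolding g_def by (simp add: abs_mult mult_le_one)
  have mg: "mean g = \<theta> * mean f" unfolding g_def by (rule mean_scale)
  let ?S = "\<lambda>\<omega>. \<bar>\<Sum>i=1..n. f (X i \<omega>) - mean f\<bar> ^ (2 * p)"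
  have m1: "\<bar>mean f\<bar> \<le> 1" by (rule abs_mean_le_1[OF fm f(2)])
  have "\<theta> ^ (2 * p) * (LINT \<omega>|M. ?S \<omega>) = (LINT \<omega>|M. \<bar>\<Sum>i=1..n. g (X i \<omega>) - mean g\<bar> ^ (2 * p))"
  proof -
    have "\<bar>\<Sum>i=1..n. g (X i \<omega>) - mean g\<bar> ^ (2 * p) = \<theta> ^ (2 * p) * ?S \<omega>" for \<omega>
      using \<theta> unfolding mg unfolding g_def
      by (simp add: right_diff_distrib[symmetric] sum_distrib_left[symmetric] abs_mult power_mult_distrib)
    then show ?thesis by simp
  qed
  also have "\<dots> \<le> C * (\<Sum>i=1..p. real n ^ i * ((LINT \<omega>|M. \<bar>g (X 0 \<omega>) - mean g\<bar> powr r) powr (1 / r)) ^ i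
                   * \<Phi> i (normG (\<lambda>x. g x - mean g)))"
    using moment[OF g _ n] g1 unfolding mean_def by blast
  also have "\<dots> \<le> C * (\<Sum>i=1..p. real n ^ i * (2 * mean (\<lambda>x. \<bar>f x\<bar>) powr (1 / r)) ^ i * b i)"
  proof (rule mult_left_mono[OF sum_mono])
    fix i assume i: "i \<in> {1..p}"
    have L: "(LINT \<omega>|M. \<bar>g (X 0 \<omega>) - mean g\<bar> powr r) powr (1 / r) \<le> 2 * mean (\<lambda>x. \<bar>f x\<bar>) powr (1 / r)"
      unfolding mg unfolding g_def by (rule Lr_norm_le[OF fm f(2) \<theta>])
    have gm: "(\<lambda>x. g x - mean g) = (\<lambda>x. \<theta> * (f x - mean f))"
      unfolding mg unfolding g_def by (simp add: right_diff_distrib)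
    have fmG: "(\<lambda>x. f x - mean f) \<in> G" by (rule G_diff[OF f(1) G_const])
    have "normG (\<lambda>x. g x - mean g) = \<theta> * normG (\<lambda>x. f x - mean f)"
      unfolding gm using normG_scale[OF fmG, of \<theta>] \<theta> by simp
    also have "\<dots> \<le> \<theta> * (normG f + normG (\<lambda>x. 1))"
    proof (rule mult_left_mono)
      have "\<bar>mean f\<bar> * normG (\<lambda>x. 1) \<le> normG (\<lambda>x. 1)"
        using m1 normG_nonneg[OF G_const] by (simp add: mult_left_le_one_le)
      then show "normG (\<lambda>x. f x - mean f) \<le> normG f + normG (\<lambda>x. 1)"
        using normG_diff[OF f(1) G_const, of "mean f"] normG_const[of "mean f"] by simp
    qed (use \<theta> in simp)
    finally have "\<Phi> i (normG (\<lambda>x. g x - mean g)) \<le> \<Phi> i (\<theta> * (normG f + normG (\<lambda>x. 1)))"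
      using normG_nonneg[OF G_diff[OF g G_const], of "mean g"] by (intro mono_onD[OF \<Phi>_mono[OF i]]) auto
    also have "\<dots> \<le> b i" by (rule b[OF i])
    finally have P: "\<Phi> i (normG (\<lambda>x. g x - mean g)) \<le> b i" .
    show "real n ^ i * ((LINT \<omega>|M. \<bar>g (X 0 \<omega>) - mean g\<bar> powr r) powr (1 / r)) ^ i * \<Phi> i (normG (\<lambda>x. g x - mean g))
      \<le> real n ^ i * (2 * mean (\<lambda>x. \<bar>f x\<bar>) powr (1 / r)) ^ i * b i"
      using L P \<Phi>_nonneg[OF i normG_nonneg[OF G_diff[OF g G_const], of "mean g"]]
      by (intro mult_mono power_mono) auto
  qed (use C in simp)
  finally have "(LINT \<omega>|M. ?S \<omega>) \<le> C / \<theta> ^ (2 * p) * (\<Sum>i=1..p. real n ^ i * (2 * mean (\<lambda>x. \<bar>f x\<bar>) powr (1 / r)) ^ i * b i)"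
    using \<theta> by (simp add: field_simps)
  then have "(LINT \<omega>|M. ?S \<omega>) / real n ^ p \<le> C / \<theta> ^ (2 * p) * (\<Sum>i=1..p. real n ^ i * (2 * mean (\<lambda>x. \<bar>f x\<bar>) powr (1 / r)) ^ i * b i) / real n ^ p"
    by (rule divide_right_mono) simp
  also have "\<dots> = C / \<theta> ^ (2 * p) *
     (\<Sum>i=1..p. real n ^ i / real n ^ p * (2 * mean (\<lambda>x. \<bar>f x\<bar>) powr (1 / r)) ^ i * b i)"
  proof -
    have "(\<Sum>i=1..p. real n ^ i / real n ^ p * (2 * mean (\<lambda>x. \<bar>f x\<bar>) powr (1 / r)) ^ i * b i)
      = (\<Sum>i=1..p. real n ^ i * (2 * mean (\<lambda>x. \<bar>f x\<bar>) powr (1 / r)) ^ i * b i) / real n ^ p"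
      by (simp add: sum_divide_distrib)
    then show ?thesis by (simp only: times_divide_eq_right)
  qed
  finally show ?thesis unfolding expectation_normalized_sum_power[OF n] .
qed

text \<open>In the i-th term 4^l <= c n turns n^(i-p) into 2^(-2(p-i)l), the L^1 norm gives
  2^(-il/r), and \<open>\<Phi> i\<close> grows like 2^(l \<gamma>_i). The factor 2^(ld) in front
  prepares a union bound over about that many functions. The seminorm allowance of twice
  \<open>normG\<close> of 1 leaves room for functions such as 1 - \<open>phi\<close>.\<close>

lemma key_moment:
  assumes \<kappa>: "1 \<le> \<kappa>"
  shows "\<exists>C' l0 \<beta>. 0 < C' \<and> 0 < \<beta> \<and> (\<forall>l f n c. l0 \<le> l \<longrightarrow> f \<in> G \<longrightarrow> (\<forall>x. \<bar>f x\<bar> \<le> 1) \<longrightarrow>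
     normG f \<le> 2 * \<Psi> (2 ^ l) + 2 * normG (\<lambda>x. 1) \<longrightarrow> mean (\<lambda>x. \<bar>f x\<bar>) \<le> \<kappa> / 2 ^ l \<longrightarrow> 1 \<le> n \<longrightarrow> 1 \<le> c \<longrightarrow>
     4 ^ l \<le> c * real n \<longrightarrow>
     2 ^ (l * CARD('d)) * (LINT \<omega>|M. normalized_sum n f \<omega> ^ (2 * p)) \<le> C' * c ^ p * 2 powr (- \<beta> * real l))"
proof -
  define K1 where "K1 = normG (\<lambda>x. 1)"
  have K1: "0 \<le> K1" unfolding K1_def by (rule normG_nonneg[OF G_const])
  obtain \<theta> D z1 where \<theta>: "0 < \<theta>" "\<theta> \<le> 1" and D: "0 \<le> D" and z1: "1 \<le> z1"
    and sh: "\<And>z i. z \<ge> z1 \<Longrightarrow> i \<in> {1..p} \<Longrightarrow> \<Phi> i (\<theta> * (2 * \<Psi> z + 3 * K1)) \<le> D * z powr \<gamma> i"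
    \<comment> \<open>Two units of \<open>K1\<close> come from the seminorm bound on f and one from
      centring.\<close>
    using shrink_factor[of "3 * K1"] K1 by fastforce
  obtain l0 where l0: "z1 \<le> 2 ^ l0" using real_arch_pow[of 2 z1] by (auto intro: less_imp_le)
  define d where "d = real CARD('d)"
  \<comment> \<open>The smallest slack in the inequalities for \<open>\<gamma> i\<close>, positive
    because there are finitely many.\<close>
  define \<beta> where "\<beta> = Min ((\<lambda>i. real i / r + 2 * (real p - real i) - d - \<gamma> i) ` {1..p})"
  have ne: "{1..p} \<noteq> {}" using p_pos by simp
  have \<beta>: "0 < \<beta>" unfolding \<beta>_def using \<gamma>(2) ne by (subst Min_gr_iff) (auto simp: d_def)
  have \<beta>_le: "\<beta> \<le> real i / r + 2 * (real p - real i) - d - \<gamma> i" if "i \<in> {1..p}" for i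
    unfolding \<beta>_def using that by (intro Min_le) auto
  \<comment> \<open>The summand 1 makes the constant positive even if \<open>D\<close> is 0.\<close>
  define C' where "C' = C / \<theta> ^ (2 * p) * (real p * ((2 * \<kappa>) ^ p * D)) + 1"
  have C'_0: "0 \<le> C / \<theta> ^ (2 * p) * (real p * ((2 * \<kappa>) ^ p * D))"
    using C \<theta> \<kappa> D by (intro mult_nonneg_nonneg divide_nonneg_nonneg zero_le_power) auto
  then have C': "0 < C'" by (simp add: C'_def)
  have "2 ^ (l * CARD('d)) * (LINT \<omega>|M. normalized_sum n f \<omega> ^ (2 * p)) \<le> C' * c ^ p * 2 powr (- \<beta> * real l)"
    if l: "l0 \<le> l" and f: "f \<in> G" "\<forall>x. \<bar>f x\<bar> \<le> 1" and nf: "normG f \<le> 2 * \<Psi> (2 ^ l) + 2 * normG (\<lambda>x. 1)"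
      and mf: "mean (\<lambda>x. \<bar>f x\<bar>) \<le> \<kappa> / 2 ^ l" and n: "1 \<le> n" and c: "1 \<le> c" and cn: "4 ^ l \<le> c * real n"
    for l f n c
  proof -
    have "(2::real) ^ l0 \<le> 2 ^ l" using l by simp
    then have zl: "z1 \<le> 2 ^ l" using l0 by linarith
    have mf0: "0 \<le> mean (\<lambda>x. \<bar>f x\<bar>)" unfolding mean_def by (intro Bochner_Integration.integral_nonneg) auto
    have "(LINT \<omega>|M. normalized_sum n f \<omega> ^ (2 * p)) \<le> C / \<theta> ^ (2 * p) *
      (\<Sum>i=1..p. real n ^ i / real n ^ p * (2 * mean (\<lambda>x. \<bar>f x\<bar>) powr (1 / r)) ^ i * (D * (2 ^ l) powr \<gamma> i))"
    proof (rule normalized_sum_moment[OF f(1) _ n \<theta>])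
      show "\<Phi> i (\<theta> * (normG f + normG (\<lambda>x. 1))) \<le> D * (2 ^ l) powr \<gamma> i" if i: "i \<in> {1..p}" for i
      proof -
        have "\<theta> * (normG f + normG (\<lambda>x. 1)) \<le> \<theta> * (2 * \<Psi> (2 ^ l) + 3 * K1)"
          using \<theta> nf by (intro mult_left_mono) (auto simp: K1_def)
        then have "\<Phi> i (\<theta> * (normG f + normG (\<lambda>x. 1))) \<le> \<Phi> i (\<theta> * (2 * \<Psi> (2 ^ l) + 3 * K1))"
          using \<theta> normG_nonneg[OF f(1)] normG_nonneg[OF G_const, of 1] K1 \<Psi>_nonneg[of "2 ^ l"]
          by (intro mono_onD[OF \<Phi>_mono[OF i]]) auto
        then show ?thesis using sh[OF zl i] by simp
      qed
    qed (use f(2) in auto)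
    also have "\<dots> \<le> C / \<theta> ^ (2 * p) * (\<Sum>i=1..p. c ^ p * ((2 * \<kappa>) ^ p * D) * 2 powr (- (\<beta> + d) * real l))"
    proof (rule mult_left_mono[OF sum_mono])
      fix i assume i: "i \<in> {1..p}"
      have 1: "real n ^ i / real n ^ p \<le> c ^ p * 2 powr (- 2 * (real p - real i) * real l)"
      proof -
        have "real n ^ p = real n ^ i * real n ^ (p - i)" using i by (simp add: power_add[symmetric])
        then have "real n ^ i / real n ^ p = (1 / real n) ^ (p - i)" using n by (simp add: power_divide)
        also have "\<dots> \<le> (c / 4 ^ l) ^ (p - i)"
          using cn n c by (intro power_mono) (auto simp: field_simps)
        also have "\<dots> = c ^ (p - i) * (1 / 4 ^ l) ^ (p - i)" by (simp add: power_divide)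
        also have "\<dots> \<le> c ^ p * (1 / 4 ^ l) ^ (p - i)" using c by (intro mult_right_mono power_increasing) auto
        also have "(1 / 4 ^ l) ^ (p - i) = 2 powr (- 2 * (real p - real i) * real l)"
        proof -
          have "(4::real) ^ l = 2 powr (2 * real l)"
            by (simp add: powr_realpow[symmetric] powr_powr[symmetric] powr_numeral)
          then have "(1 / 4 ^ l :: real) = 2 powr (- 2 * real l)" by (simp add: powr_minus_divide)
          then have "(1 / 4 ^ l :: real) ^ (p - i) = 2 powr (- 2 * real l * real (p - i))"
            by (simp add: powr_realpow[symmetric] powr_powr)
          then show ?thesis using i by (simp add: of_nat_diff algebra_simps)
        qed
        finally show ?thesis .
      qed
      have 2: "(2 * mean (\<lambda>x. \<bar>f x\<bar>) powr (1 / r)) ^ i \<le> (2 * \<kappa>) ^ p * 2 powr (- (real i / r) * real l)"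
      proof -
        have "mean (\<lambda>x. \<bar>f x\<bar>) powr (1 / r) \<le> (\<kappa> / 2 ^ l) powr (1 / r)"
          using mf mf0 r by (intro powr_mono2) auto
        also have "\<dots> = \<kappa> powr (1 / r) * 2 powr (- real l / r)"
        proof -
          have "\<kappa> / 2 ^ l = \<kappa> * 2 powr (- real l)" by (simp add: powr_minus_divide powr_realpow)
          then show ?thesis by (simp add: powr_mult powr_powr)
        qed
        also have "\<kappa> powr (1 / r) \<le> \<kappa> powr 1" using \<kappa> r by (intro powr_mono) auto
        finally have "mean (\<lambda>x. \<bar>f x\<bar>) powr (1 / r) \<le> \<kappa> * 2 powr (- real l / r)" using \<kappa> by simp
        then have "(2 * mean (\<lambda>x. \<bar>f x\<bar>) powr (1 / r)) ^ i \<le> (2 * \<kappa> * 2 powr (- real l / r)) ^ i"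
          by (intro power_mono) auto
        also have "\<dots> = (2 * \<kappa>) ^ i * 2 powr (- (real i / r) * real l)"
          by (simp add: power_mult_distrib powr_realpow[symmetric] powr_powr mult_ac)
        also have "\<dots> \<le> (2 * \<kappa>) ^ p * 2 powr (- (real i / r) * real l)"
          using \<kappa> i by (intro mult_right_mono power_increasing) auto
        finally show ?thesis .
      qed
      have 3: "D * (2 ^ l) powr \<gamma> i = D * 2 powr (\<gamma> i * real l)"
        by (simp add: powr_realpow[symmetric] powr_powr mult_ac)
      have "real n ^ i / real n ^ p * (2 * mean (\<lambda>x. \<bar>f x\<bar>) powr (1 / r)) ^ i * (D * (2 ^ l) powr \<gamma> i)
        \<le> (c ^ p * 2 powr (- 2 * (real p - real i) * real l)) * ((2 * \<kappa>) ^ p * 2 powr (- (real i / r) * real l)) * (D * 2 powr (\<gamma> i * real l))"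
        unfolding 3 using 1 2 D c \<kappa> by (intro mult_mono mult_nonneg_nonneg) auto
      also have "\<dots> = c ^ p * ((2 * \<kappa>) ^ p * D) * (2 powr (- 2 * (real p - real i) * real l) * 2 powr (- (real i / r) * real l) * 2 powr (\<gamma> i * real l))"
        by (simp add: mult_ac)
      also have "2 powr (- 2 * (real p - real i) * real l) * 2 powr (- (real i / r) * real l) * 2 powr (\<gamma> i * real l)
         = 2 powr (- (real i / r + 2 * (real p - real i) - \<gamma> i) * real l)"
        unfolding powr_add[symmetric] by (simp add: algebra_simps)
      also have "c ^ p * ((2 * \<kappa>) ^ p * D) * 2 powr (- (real i / r + 2 * (real p - real i) - \<gamma> i) * real l)
        \<le> c ^ p * ((2 * \<kappa>) ^ p * D) * 2 powr (- (\<beta> + d) * real l)"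
        using \<beta>_le[OF i] c \<kappa> D by (intro mult_left_mono powr_mono mult_right_mono mult_nonneg_nonneg) auto
      finally show "real n ^ i / real n ^ p * (2 * mean (\<lambda>x. \<bar>f x\<bar>) powr (1 / r)) ^ i * (D * (2 ^ l) powr \<gamma> i)
        \<le> c ^ p * ((2 * \<kappa>) ^ p * D) * 2 powr (- (\<beta> + d) * real l)" .
    qed (use C \<theta> in simp)
    also have "\<dots> = C / \<theta> ^ (2 * p) * (real p * ((2 * \<kappa>) ^ p * D)) * c ^ p * 2 powr (- (\<beta> + d) * real l)"
      by simp
    also have "\<dots> \<le> C' * c ^ p * 2 powr (- (\<beta> + d) * real l)"
      using c by (intro mult_right_mono) (auto simp: C'_def)
    finally have "2 ^ (l * CARD('d)) * (LINT \<omega>|M. normalized_sum n f \<omega> ^ (2 * p)) \<le> 2 ^ (l * CARD('d)) * (C' * c ^ p * 2 powr (- (\<beta> + d) * real l))"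
      by (rule mult_left_mono) simp
    also have "\<dots> = C' * c ^ p * (2 powr (d * real l) * 2 powr (- (\<beta> + d) * real l))"
      by (simp add: powr_realpow[symmetric] d_def mult_ac)
    also have "2 powr (d * real l) * 2 powr (- (\<beta> + d) * real l) = 2 powr (- \<beta> * real l)"
      unfolding powr_add[symmetric] by (simp add: algebra_simps)
    finally show ?thesis .
  qed
  then show ?thesis using C' \<beta> by blast
qed

text \<open>For a fixed function n^i / n^p <= 1 makes the moment bound uniform in n, and y^4 <= 1 +
  y^(2p) because p >= 2.\<close>

lemma normalized_sum_fourth_moment:
  assumes f: "f \<in> G" "bounded_fun f"
  shows "\<exists>K. \<forall>n. (LINT \<omega>|M. normalized_sum n f \<omega> ^ 4) \<le> K"
proof -
  obtain B0 where B0: "\<And>x. \<bar>f x\<bar> \<le> B0" using f by blast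
  define B where "B = max 1 B0"
  have B: "1 \<le> B" "\<And>x. \<bar>f x\<bar> \<le> B" unfolding B_def using B0 by (simp_all add: le_max_iff_disj)
  define g where "g = (\<lambda>x. (1 / B) * f x)"
  have g: "g \<in> G" unfolding g_def by (rule G_scale[OF f(1)])
  have g1: "\<bar>g x\<bar> \<le> 1" for x using B unfolding g_def by (simp add: abs_mult divide_le_eq)
  have gm: "g \<in> borel_measurable borel" by (rule G_measurable[OF g])
  have gb: "bounded_fun g" using g1 by blast
  define b where "b = (\<lambda>i. \<Phi> i (1 * (normG g + normG (\<lambda>x. 1))))"
  have b0: "0 \<le> b i" if "i \<in> {1..p}" for i
    unfolding b_def using normG_nonneg[OF g] normG_nonneg[OF G_const] by (intro \<Phi>_nonneg that) auto
  define K0 where "K0 = C / 1 ^ (2 * p) * (\<Sum>i=1..p. 1 * (2 * mean (\<lambda>x. \<bar>g x\<bar>) powr (1 / r)) ^ i * b i)"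
  have K0: "0 \<le> K0" unfolding K0_def using C b0 by (intro mult_nonneg_nonneg sum_nonneg) auto
  have "(LINT \<omega>|M. normalized_sum n f \<omega> ^ 4) \<le> B ^ 4 * (1 + K0)" for n
  proof (cases "n = 0")
    case True
    then show ?thesis using B(1) K0 by (simp add: normalized_sum_def)
  next
    case False
    then have n: "n \<ge> 1" by simp
    have "(LINT \<omega>|M. normalized_sum n g \<omega> ^ (2 * p)) \<le> C / 1 ^ (2 * p) *
      (\<Sum>i=1..p. real n ^ i / real n ^ p * (2 * mean (\<lambda>x. \<bar>g x\<bar>) powr (1 / r)) ^ i * b i)"
      by (rule normalized_sum_moment[OF g g1 n]) (auto simp: b_def)
    also have "\<dots> \<le> K0" unfolding K0_def
    proof (rule mult_left_mono[OF sum_mono])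
      fix i assume i: "i \<in> {1..p}"
      have "real n ^ i \<le> real n ^ p" using n i by (intro power_increasing) auto
      then have "real n ^ i / real n ^ p \<le> 1" using n by simp
      then show "real n ^ i / real n ^ p * (2 * mean (\<lambda>x. \<bar>g x\<bar>) powr (1 / r)) ^ i * b i \<le> 1 * (2 * mean (\<lambda>x. \<bar>g x\<bar>) powr (1 / r)) ^ i * b i"
        using b0[OF i] by (intro mult_right_mono) auto
    qed (use C in simp)
    finally have E: "(LINT \<omega>|M. normalized_sum n g \<omega> ^ (2 * p)) \<le> K0" .
    have fg: "normalized_sum n f \<omega> = B * normalized_sum n g \<omega>" for \<omega>
      unfolding g_def normalized_sum_scale using B by simp
    have "(LINT \<omega>|M. normalized_sum n g \<omega> ^ 4) \<le> (LINT \<omega>|M. 1 + normalized_sum n g \<omega> ^ (2 * p))"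
    proof (rule integral_mono)
      show "normalized_sum n g \<omega> ^ 4 \<le> 1 + normalized_sum n g \<omega> ^ (2 * p)" for \<omega>
      proof -
        have "\<bar>y\<bar> ^ 4 \<le> 1 + \<bar>y\<bar> ^ (2 * p)" for y :: real
        proof (cases "\<bar>y\<bar> \<le> 1")
          case True
          then have "\<bar>y\<bar> ^ 4 \<le> 1" by (intro power_le_one) auto
          moreover have "0 \<le> \<bar>y\<bar> ^ (2 * p)" by simp
          ultimately show ?thesis by linarith
        next
          case False
          then have "\<bar>y\<bar> ^ 4 \<le> \<bar>y\<bar> ^ (2 * p)" using p_pos by (intro power_increasing) auto
          then show ?thesis by simp
        qed
        from this[of "normalized_sum n g \<omega>"] show ?thesis by (simp add: power_even_abs)
      qed
    qed (use normalized_sum_power_integrable[OF gm gb] in auto)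
    also have "\<dots> \<le> 1 + K0" using E normalized_sum_power_integrable[OF gm gb] by (simp add: prob_space)
    finally show ?thesis using B(1) by (simp add: fg power_mult_distrib mult_left_mono)
  qed
  then show ?thesis by blast
qed

lemma normalized_sum_clt:
  assumes f: "f \<in> G" "bounded_fun f"
  shows "\<exists>s\<ge>0. weak_conv_m (\<lambda>n. distr M borel (normalized_sum n f)) (normal_law s)"
proof -
  obtain B where B: "\<And>x. \<bar>f x\<bar> \<le> B" using f by blast
  have fm: "f \<in> borel_measurable borel" by (rule G_measurable[OF f(1)])
  have "\<bar>f x - mean f\<bar> \<le> B + \<bar>mean f\<bar>" for x using B[of x] by linarith
  moreover have "(LINT \<omega>|M. f (X 0 \<omega>) - mean f) = 0"
    using comp_integrable[OF fm f(2)] by (simp add: mean_def prob_space)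
  ultimately have "\<exists>s2\<ge>0. weak_conv_m (\<lambda>n. distr M borel (\<lambda>\<omega>. (1 / sqrt n) * (\<Sum>i=1..n. f (X i \<omega>) - mean f))) (normal_law s2)"
    using clt[OF G_diff[OF f(1) G_const[of "mean f"]]] by blast
  then show ?thesis unfolding normalized_sum_def[abs_def] .
qed

lemma normalized_sum_markov:
  assumes f: "f \<in> borel_measurable borel" "bounded_fun f" and x: "0 < x"
  shows "prob {\<omega> \<in> space M. x \<le> \<bar>normalized_sum n f \<omega>\<bar>} \<le> (LINT \<omega>|M. normalized_sum n f \<omega> ^ (2 * p)) / x ^ (2 * p)"
proof -
  note [measurable] = normalized_sum_measurable[OF f(1)]
  define A where "A = {\<omega> \<in> space M. x \<le> \<bar>normalized_sum n f \<omega>\<bar>}"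
  have [measurable]: "A \<in> sets M" unfolding A_def by measurable
  have iA: "integrable M (indicator A :: 'a \<Rightarrow> real)" by (rule integrable_const_bound[of _ 1]) auto
  have "x ^ (2 * p) * prob A = (LINT \<omega>|M. x ^ (2 * p) * indicator A \<omega>)" by simp
  also have "\<dots> \<le> (LINT \<omega>|M. normalized_sum n f \<omega> ^ (2 * p))"
  proof (rule integral_mono)
    show "x ^ (2 * p) * indicator A \<omega> \<le> normalized_sum n f \<omega> ^ (2 * p)" for \<omega>
    proof (cases "\<omega> \<in> A")
      case True
      then have "x ^ (2 * p) \<le> \<bar>normalized_sum n f \<omega>\<bar> ^ (2 * p)" using x by (intro power_mono) (auto simp: A_def)
      then show ?thesis using True by (simp add: power_even_abs)
    qed simp
  qed (use iA normalized_sum_power_integrable[OF f] in auto)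
  finally show ?thesis using x by (simp add: A_def field_simps)
qed

end

section \<open>Quantile grids\<close>

context empirical_setting
begin

definition orthant :: "ereal^'d \<Rightarrow> real^'d \<Rightarrow> real" where
  "orthant t x = indicator {x. vle x t} x"

definition quantile_point :: "('d \<Rightarrow> real) \<Rightarrow> ereal^'d" where
  "quantile_point u = (\<chi> i. quantile i (u i))"

text \<open>Index \<open>j\<close> stands for the cell between the levels (j-1)/2^k and j/2^k. The
  subtraction is that of the reals, so index 0 has a negative lower level, whose quantile is
  -\<infinity>.\<close>

definition lower :: "nat \<Rightarrow> ('d \<Rightarrow> nat) \<Rightarrow> 'd \<Rightarrow> real" where
  "lower k j i = (real (j i) - 1) / 2 ^ k"

definition upper :: "nat \<Rightarrow> ('d \<Rightarrow> nat) \<Rightarrow> 'd \<Rightarrow> real" where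
  "upper k j i = real (j i) / 2 ^ k"

definition index_box :: "nat \<Rightarrow> ('d \<Rightarrow> nat) set" where
  "index_box m = {j. \<forall>i. j i \<le> m}"

lemma index_box: "finite (index_box m)" "card (index_box m) = (m + 1) ^ CARD('d)"
proof -
  have "index_box m = Pi\<^sub>E UNIV (\<lambda>_. {..m})" by (auto simp: index_box_def PiE_iff)
  then show "finite (index_box m)" "card (index_box m) = (m + 1) ^ CARD('d)"
    by (simp_all add: finite_PiE card_PiE)
qed

lemma orthant_measurable [measurable]: "orthant t \<in> borel_measurable borel"
  unfolding orthant_def[abs_def] by measurable

lemma orthant_bounds: "0 \<le> orthant t x" "orthant t x \<le> 1" "\<bar>orthant t x\<bar> \<le> 1"
  by (auto simp: orthant_def)

lemma orthant_mono: "(\<And>i. s $ i \<le> t $ i) \<Longrightarrow> orthant s x \<le> orthant t x"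
  unfolding orthant_def vle_def by (auto simp: indicator_def intro: order_trans)

lemma mean_orthant: "mean (orthant t) = mdf M (X 0) t"
proof -
  have "mean (orthant t) = (LINT \<omega>|M. indicator {\<omega> \<in> space M. vle (X 0 \<omega>) t} \<omega>)"
    unfolding mean_def orthant_def by (intro Bochner_Integration.integral_cong) (auto simp: indicator_def)
  then show ?thesis by (simp add: mdf_def)
qed

lemma empirical_process_eq: "empirical_process M X n \<omega> t = normalized_sum n (orthant t) \<omega>"
  by (simp add: empirical_process_def normalized_sum_def mean_orthant orthant_def)

lemma orthant_quantile_point_mono: "(\<And>i. u i \<le> v i) \<Longrightarrow> orthant (quantile_point u) x \<le> orthant (quantile_point v) x"
  by (rule orthant_mono) (simp add: quantile_point_def quantile_mono)

lemma mean_orthant_quantile_point_diff: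
  assumes "\<And>i. u i \<le> v i" "\<And>i. v i \<le> 1"
  shows "mean (orthant (quantile_point v)) - mean (orthant (quantile_point u)) \<le> (\<Sum>i\<in>UNIV. v i - u i)"
proof -
  have u1: "u i \<le> 1" for i using assms order_trans by blast
  have "mean (orthant (quantile_point v)) - mean (orthant (quantile_point u)) \<le> (\<Sum>i\<in>UNIV. marginal_cdf i (quantile_point v $ i) - marginal_cdf i (quantile_point u $ i))"
    unfolding mean_orthant by (rule mdf_diff_le) (simp add: quantile_point_def quantile_mono assms)
  also have "\<dots> \<le> (\<Sum>i\<in>UNIV. v i - u i)"
  proof (rule sum_mono)
    fix i show "marginal_cdf i (quantile_point v $ i) - marginal_cdf i (quantile_point u $ i) \<le> v i - u i"
      using assms[of i] u1[of i] by (simp add: quantile_point_def marginal_cdf_quantile)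
  qed
  finally show ?thesis .
qed

lemma one_minus_mean_orthant_quantile_point:
  assumes "\<And>i. u i \<le> 1"
  shows "1 - mean (orthant (quantile_point u)) \<le> (\<Sum>i\<in>UNIV. 1 - u i)"
proof -
  have "mdf M (X 0) (\<chi> i. \<infinity>) - mdf M (X 0) (quantile_point u) \<le> (\<Sum>i\<in>UNIV. marginal_cdf i ((\<chi> i. \<infinity>) $ i) - marginal_cdf i (quantile_point u $ i))"
    by (rule mdf_diff_le) simp
  also have "\<dots> \<le> (\<Sum>i\<in>UNIV. 1 - u i)"
    by (rule sum_mono) (simp add: quantile_point_def marginal_cdf_quantile assms)
  finally show ?thesis by (simp add: mean_orthant mdf_eq prob_space)
qed

text \<open>By \<open>modulus_ge\<close> the moduli across a cell are at least 2^(-k), so the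
  argument of \<open>\<Psi>\<close> is at most 2^k. A vanishing index makes both orthants empty, and
  the zero function serves.\<close>

lemma phi_exists:
  assumes j: "j \<in> index_box (2 ^ k)"
  shows "\<exists>\<phi>\<in>G. (\<forall>x. orthant (quantile_point (lower k j)) x \<le> \<phi> x \<and> \<phi> x \<le> orthant (quantile_point (upper k j)) x) \<and> normG \<phi> \<le> \<Psi> (2 ^ k)"
proof (cases "\<exists>i. j i = 0")
  case True
  then obtain i where i: "j i = 0" by blast
  have "orthant (quantile_point u) x = 0" if "u i \<le> 0" for u x
    using quantile_nonpos[OF that, of i] by (auto simp: orthant_def vle_def quantile_point_def indicator_def intro: exI[of _ i])
  then have z: "orthant (quantile_point (lower k j)) x = 0" "orthant (quantile_point (upper k j)) x = 0" for x
    using i by (auto simp: lower_def upper_def)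
  have "normG (\<lambda>x. 0) \<le> \<Psi> (2 ^ k)" using normG_const[of 0] \<Psi>_nonneg[of "2 ^ k"] by simp
  then show ?thesis using G_const[of 0] by (intro bexI[of _ "\<lambda>x. 0"]) (auto simp: z)
next
  case False
  then have j1: "1 \<le> j i" for i by (simp add: Suc_leI)
  have j2: "j i \<le> 2 ^ k" for i using j by (simp add: index_box_def)
  have u: "0 \<le> lower k j i" "lower k j i < upper k j i" "upper k j i \<le> 1" "upper k j i - lower k j i = 1 / 2 ^ k" for i
  proof -
    have "real (j i) \<le> 2 ^ k" using j2[of i] of_nat_le_iff[of "j i" "2 ^ k", where ?'a = real] by simp
    then show "0 \<le> lower k j i" "lower k j i < upper k j i" "upper k j i \<le> 1" "upper k j i - lower k j i = 1 / 2 ^ k"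
      using j1[of i] by (auto simp: lower_def upper_def divide_simps)
  qed
  have "evless (quantile_point (lower k j)) (quantile_point (upper k j))"
    unfolding evless_def quantile_point_def using quantile_strict_mono u by simp
  then obtain \<phi> where \<phi>: "\<phi> \<in> G" "\<And>x. orthant (quantile_point (lower k j)) x \<le> \<phi> x \<and> \<phi> x \<le> orthant (quantile_point (upper k j)) x"
    "normG \<phi> \<le> \<Psi> (1 / (MIN i. modulus (marginal_df M (X 0) i) (quantile_point (upper k j) $ i - quantile_point (lower k j) $ i)))"
    using control unfolding control_function_def orthant_def by blast
  have "1 / 2 ^ k \<le> (MIN i. modulus (marginal_df M (X 0) i) (quantile_point (upper k j) $ i - quantile_point (lower k j) $ i))"
  proof (subst Min_ge_iff)
    show "\<forall>a\<in>range (\<lambda>i. modulus (marginal_df M (X 0) i) (quantile_point (upper k j) $ i - quantile_point (lower k j) $ i)). 1 / 2 ^ k \<le> a"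
      using modulus_ge[OF u(1-3)] u(4) by (auto simp: quantile_point_def)
  qed auto
  then have le: "1 / (MIN i. modulus (marginal_df M (X 0) i) (quantile_point (upper k j) $ i - quantile_point (lower k j) $ i)) \<le> 2 ^ k"
    and pos: "0 \<le> 1 / (MIN i. modulus (marginal_df M (X 0) i) (quantile_point (upper k j) $ i - quantile_point (lower k j) $ i))"
    (is "0 \<le> 1 / ?m")
  proof -
    assume m: "1 / 2 ^ k \<le> ?m"
    have "0 < 1 / (2 ^ k :: real)" by simp
    then have m0: "0 < ?m" using m by linarith
    show "1 / ?m \<le> 2 ^ k" using m m0 by (simp add: divide_simps mult.commute)
    show "0 \<le> 1 / ?m" by (rule divide_nonneg_pos[OF zero_le_one m0])
  qed
  have "normG \<phi> \<le> \<Psi> (2 ^ k)" using \<phi>(3) \<Psi>_mono[OF pos le] by linarith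
  then show ?thesis using \<phi> by blast
qed

definition brackets :: "nat \<Rightarrow> ('d \<Rightarrow> nat) \<Rightarrow> (real^'d \<Rightarrow> real) \<Rightarrow> bool" where
  "brackets k j \<phi> \<longleftrightarrow> \<phi> \<in> G \<and> (\<forall>x. orthant (quantile_point (lower k j)) x \<le> \<phi> x \<and> \<phi> x \<le> orthant (quantile_point (upper k j)) x) \<and>
     normG \<phi> \<le> \<Psi> (2 ^ k)"

text \<open>Clamping the index to the grid puts every \<open>phi k j\<close> into \<open>G\<close>,
  also for indices obtained by decoding arbitrary natural numbers.\<close>

definition phi :: "nat \<Rightarrow> ('d \<Rightarrow> nat) \<Rightarrow> real^'d \<Rightarrow> real" where
  "phi k j = (SOME \<phi>. brackets k (\<lambda>i. min (j i) (2 ^ k)) \<phi>)"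

lemma brackets_phi: "brackets k (\<lambda>i. min (j i) (2 ^ k)) (phi k j)"
proof -
  have "(\<lambda>i. min (j i) (2 ^ k)) \<in> index_box (2 ^ k)" by (simp add: index_box_def)
  from phi_exists[OF this] have "\<exists>\<phi>. brackets k (\<lambda>i. min (j i) (2 ^ k)) \<phi>"
    unfolding brackets_def Bex_def .
  then show ?thesis unfolding phi_def by (rule someI_ex)
qed

lemmas phi_brackets = brackets_phi[unfolded brackets_def]

lemma phi_G: "phi k j \<in> G" and normG_phi: "normG (phi k j) \<le> \<Psi> (2 ^ k)"
  using phi_brackets by auto

lemma phi_sandwich:
  assumes "j \<in> index_box (2 ^ k)"
  shows "orthant (quantile_point (lower k j)) x \<le> phi k j x" "phi k j x \<le> orthant (quantile_point (upper k j)) x"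
proof -
  have "(\<lambda>i. min (j i) (2 ^ k)) = j" using assms by (auto simp: index_box_def min_def)
  then show "orthant (quantile_point (lower k j)) x \<le> phi k j x" "phi k j x \<le> orthant (quantile_point (upper k j)) x"
    using phi_brackets[of k j] by auto
qed

lemma phi_bounds: "0 \<le> phi k j x" "phi k j x \<le> 1"
proof -
  have "orthant (quantile_point (lower k (\<lambda>i. min (j i) (2 ^ k)))) x \<le> phi k j x"
    "phi k j x \<le> orthant (quantile_point (upper k (\<lambda>i. min (j i) (2 ^ k)))) x" using phi_brackets[of k j] by simp_all
  then show "0 \<le> phi k j x" "phi k j x \<le> 1" using orthant_bounds(1,2) order_trans by metis+
qed

lemma phi_measurable [measurable]: "phi k j \<in> borel_measurable borel"
  by (rule G_measurable[OF phi_G])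

lemma phi_bounded: "bounded_fun (phi k j)"
proof -
  have "\<bar>phi k j x\<bar> \<le> 1" for x using phi_bounds[of k j x] by linarith
  then show ?thesis by blast
qed

lemma orthant_bounded: "bounded_fun (orthant t)"
  using orthant_bounds by blast

definition grid_sum :: "nat \<Rightarrow> nat \<times> ('d \<Rightarrow> nat) \<Rightarrow> 'a \<Rightarrow> real" where
  "grid_sum n a \<omega> = normalized_sum n (phi (fst a) (snd a)) \<omega>"

lemma grid_sum_measurable [measurable]: "grid_sum n a \<in> borel_measurable M"
  unfolding grid_sum_def[abs_def] by (rule normalized_sum_measurable[OF phi_measurable])

text \<open>Both functions lie between the orthants at the smaller lower and the larger upper
  levels. In each coordinate these differ by at most 2/2^l plus one mesh, which is the 3.\<close>

lemma abs_phi_diff: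
  assumes j: "j \<in> index_box (2 ^ k)" "j' \<in> index_box (2 ^ k')"
    and near: "\<And>i. \<bar>upper k j i - upper k' j' i\<bar> \<le> 2 / 2 ^ l" and l: "l \<le> k" "l \<le> k'"
  shows "mean (\<lambda>x. \<bar>phi k j x - phi k' j' x\<bar>) \<le> 3 * real CARD('d) / 2 ^ l"
proof -
  define u where "u = (\<lambda>i. min (lower k j i) (lower k' j' i))"
  define v where "v = (\<lambda>i. max (upper k j i) (upper k' j' i))"
  have up: "upper k j i \<le> 1" if "j \<in> index_box (2 ^ k)" for k j i
  proof -
    have "real (j i) \<le> 2 ^ k" using that of_nat_le_iff[of "j i" "2 ^ k", where ?'a = real] by (simp add: index_box_def)
    then show ?thesis by (simp add: upper_def)
  qed
  have lo: "lower k j i = upper k j i - 1 / 2 ^ k" for k j i by (simp add: lower_def upper_def diff_divide_distrib)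
  have s: "1 / 2 ^ k \<le> (1 / 2 ^ l :: real)" "1 / 2 ^ k' \<le> (1 / 2 ^ l :: real)"
    using l by (simp_all add: divide_simps power_increasing)
  have pos: "0 < (1 / 2 ^ k :: real)" "0 < (1 / 2 ^ k' :: real)" by simp_all
  have vu: "v i - u i \<le> 3 / 2 ^ l" for i
  proof -
    have "\<bar>upper k j i - upper k' j' i\<bar> \<le> 2 * (1 / 2 ^ l)" using near[of i] by simp
    then have "v i - u i \<le> 3 * (1 / 2 ^ l)" using s pos unfolding u_def v_def lo by linarith
    then show ?thesis by simp
  qed
  have uv: "u i \<le> v i" for i using pos unfolding u_def v_def lo by linarith
  have v1: "v i \<le> 1" for i using up j unfolding v_def by simp
  have "\<bar>phi k j x - phi k' j' x\<bar> \<le> orthant (quantile_point v) x - orthant (quantile_point u) x" for x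
  proof -
    have "orthant (quantile_point u) x \<le> orthant (quantile_point (lower k j)) x" "orthant (quantile_point u) x \<le> orthant (quantile_point (lower k' j')) x"
      "orthant (quantile_point (upper k j)) x \<le> orthant (quantile_point v) x" "orthant (quantile_point (upper k' j')) x \<le> orthant (quantile_point v) x"
      by (rule orthant_quantile_point_mono; simp add: u_def v_def)+
    then show ?thesis using phi_sandwich[OF j(1), of x] phi_sandwich[OF j(2), of x] by linarith
  qed
  then have "mean (\<lambda>x. \<bar>phi k j x - phi k' j' x\<bar>) \<le> mean (\<lambda>x. orthant (quantile_point v) x - orthant (quantile_point u) x)"
  proof (intro mean_mono)
    show "bounded_fun (\<lambda>x. \<bar>phi k j x - phi k' j' x\<bar>)"
      using phi_bounds[of k j] phi_bounds[of k' j'] by (intro exI[of _ 1]) (auto simp: abs_le_iff; smt (verit))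
    show "bounded_fun (\<lambda>x. orthant (quantile_point v) x - orthant (quantile_point u) x)"
      using orthant_bounds by (intro exI[of _ 2]) (smt (verit))
  qed auto
  also have "\<dots> = mean (orthant (quantile_point v)) - mean (orthant (quantile_point u))"
    unfolding mean_def by (intro Bochner_Integration.integral_diff comp_integrable orthant_bounded orthant_measurable)
  also have "\<dots> \<le> (\<Sum>i\<in>UNIV. v i - u i)" by (rule mean_orthant_quantile_point_diff[OF uv v1])
  also have "\<dots> \<le> (\<Sum>i\<in>(UNIV::'d set). 3 / 2 ^ l)" by (rule sum_mono) (rule vu)
  also have "\<dots> = 3 * real CARD('d) / 2 ^ l" by simp
  finally show ?thesis .
qed

text \<open>The last cell but one. Its upper level 1 - 2^(-k) is below 1, so its \<open>phi\<close>
  vanishes once a coordinate exceeds that quantile, and 1 - \<open>phi\<close> covers the region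
  where a bracket cannot be shifted outwards any further.\<close>

definition top_index :: "nat \<Rightarrow> 'd \<Rightarrow> nat" where
  "top_index k i = 2 ^ k - 1"

lemma one_minus_phi_top: "mean (\<lambda>x. \<bar>1 - phi k (top_index k) x\<bar>) \<le> 2 * real CARD('d) / 2 ^ k"
proof -
  have b: "top_index k \<in> index_box (2 ^ k)" by (simp add: index_box_def top_index_def)
  have lo: "lower k (top_index k) i = 1 - 2 / 2 ^ k" for i
    by (simp add: lower_def top_index_def of_nat_diff diff_divide_distrib)
  have "mean (\<lambda>x. \<bar>1 - phi k (top_index k) x\<bar>) \<le> mean (\<lambda>x. 1 - orthant (quantile_point (lower k (top_index k))) x)"
  proof (rule mean_mono)
    show "bounded_fun (\<lambda>x. \<bar>1 - phi k (top_index k) x\<bar>)" using phi_bounds[of k "top_index k"] by (intro exI[of _ 1]) auto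
    show "bounded_fun (\<lambda>x. 1 - orthant (quantile_point (lower k (top_index k))) x)" using orthant_bounds by (intro exI[of _ 1]) auto
    show "\<bar>1 - phi k (top_index k) x\<bar> \<le> 1 - orthant (quantile_point (lower k (top_index k))) x" for x
      using phi_sandwich(1)[OF b, of x] phi_bounds(2)[of k "top_index k" x] by linarith
  qed auto
  also have "\<dots> = 1 - mean (orthant (quantile_point (lower k (top_index k))))"
    unfolding mean_def using comp_integrable[OF orthant_measurable orthant_bounded] by (simp add: prob_space)
  also have "\<dots> \<le> (\<Sum>i\<in>UNIV. 1 - lower k (top_index k) i)" by (rule one_minus_mean_orthant_quantile_point) (simp add: lo)
  also have "\<dots> = 2 * real CARD('d) / 2 ^ k" by (simp add: lo)
  finally show ?thesis .
qed

text \<open>The first kind joins a cell to its parent and carries the chaining. The second stays on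
  one level: \<open>e\<close> from 0 to 4 encodes an offset from -2 to 2, kept inside the grid by
  truncated subtraction and \<open>min\<close>. Offset 2 leads from a lower to an upper bracket, and
  adjacency of cells yields continuity of the limit.\<close>

definition links :: "nat \<Rightarrow> ((nat \<times> ('d \<Rightarrow> nat)) \<times> (nat \<times> ('d \<Rightarrow> nat))) set" where
  "links l = (\<lambda>j. ((l, \<lambda>i. j i div 2), (Suc l, j))) ` index_box (2 ^ Suc l) \<union>
     (\<lambda>(j, e). ((l, j), (l, \<lambda>i. min (2 ^ l) (j i + e i - 2)))) ` (index_box (2 ^ l) \<times> index_box 4)"

lemma finite_links: "finite (links l)"
  unfolding links_def using index_box by auto

text \<open>From 2^(l+1) + 1 <= 4 * 2^l and 2^l + 1 <= 2 * 2^l, with 5^d offsets per cell. What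
  counts is the growth 2^(ld), matched by the factor in \<open>key_moment\<close>.\<close>

lemma card_links: "real (card (links l)) \<le> (4 ^ CARD('d) + 10 ^ CARD('d)) * 2 ^ (l * CARD('d))"
proof -
  have "card (links l) \<le> card (index_box (2 ^ Suc l)) + card (index_box (2 ^ l) \<times> index_box 4)"
    unfolding links_def by (intro order_trans[OF card_Un_le] add_mono card_image_le) (use index_box in auto)
  also have "\<dots> = (2 ^ Suc l + 1) ^ CARD('d) + (2 ^ l + 1) ^ CARD('d) * 5 ^ CARD('d)"
    by (simp add: index_box)
  also have "\<dots> \<le> (4 * 2 ^ l) ^ CARD('d) + (2 * 2 ^ l) ^ CARD('d) * 5 ^ CARD('d)"
    by (intro add_mono mult_right_mono power_mono) auto
  also have "\<dots> = (4 ^ CARD('d) + 10 ^ CARD('d)) * 2 ^ (l * CARD('d))"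
  proof -
    have "(10::nat) ^ CARD('d) = 2 ^ CARD('d) * 5 ^ CARD('d)" by (simp flip: power_mult_distrib)
    then show ?thesis by (simp add: power_mult_distrib power_mult algebra_simps)
  qed
  finally have "card (links l) \<le> (4 ^ CARD('d) + 10 ^ CARD('d)) * 2 ^ (l * CARD('d))" .
  then have "real (card (links l)) \<le> real ((4 ^ CARD('d) + 10 ^ CARD('d)) * 2 ^ (l * CARD('d)))"
    by (rule of_nat_mono)
  then show ?thesis by simp
qed

lemma links_near:
  assumes "((k, j), (k', j')) \<in> links l"
  shows "k \<in> {l, Suc l}" "k' \<in> {l, Suc l}" "j \<in> index_box (2 ^ k)" "j' \<in> index_box (2 ^ k')"
    "\<bar>upper k j i - upper k' j' i\<bar> \<le> 2 / 2 ^ l"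
proof -
  consider "k = l" "k' = Suc l" "j = (\<lambda>i. j' i div 2)" "j' \<in> index_box (2 ^ Suc l)"
    | e where "k = l" "k' = l" "j \<in> index_box (2 ^ l)" "e \<in> index_box 4" "j' = (\<lambda>i. min (2 ^ l) (j i + e i - 2))"
    using assms unfolding links_def by auto
  then have "k \<in> {l, Suc l} \<and> k' \<in> {l, Suc l} \<and> j \<in> index_box (2 ^ k) \<and> j' \<in> index_box (2 ^ k') \<and>
     \<bar>upper k j i - upper k' j' i\<bar> \<le> 2 / 2 ^ l"
  proof cases
    case 1
    have "j \<in> index_box (2 ^ k)" using 1 by (auto simp: index_box_def intro: div_le_mono[of _ "2 * 2 ^ l" 2, simplified])
    moreover have "\<bar>upper k j i - upper k' j' i\<bar> \<le> 2 / 2 ^ l"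
    proof -
      define m where "m = j' i div 2"
      have "j' i = 2 * m \<or> j' i = 2 * m + 1" unfolding m_def by presburger
      then have "\<bar>real m - real (j' i) / 2\<bar> \<le> 2" by (auto simp: add_divide_distrib)
      then have "\<bar>real m - real (j' i) / 2\<bar> / 2 ^ l \<le> 2 / 2 ^ l" by (rule divide_right_mono) simp
      moreover have "upper k j i - upper k' j' i = (real m - real (j' i) / 2) / 2 ^ l"
        using 1 by (simp add: upper_def m_def diff_divide_distrib)
      ultimately show ?thesis by (simp add: abs_divide)
    qed
    ultimately show ?thesis using 1 by simp
  next
    case 2
    have "j i \<le> 2 ^ l" "e i \<le> 4" using 2 by (auto simp: index_box_def)
    then have "j' i \<le> j i + 2" "j i \<le> j' i + 2" using 2(5) by (auto simp: min_def)
    then have "\<bar>real (j i) - real (j' i)\<bar> \<le> 2" by linarith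
    then have "\<bar>real (j i) - real (j' i)\<bar> / 2 ^ l \<le> 2 / 2 ^ l" by (rule divide_right_mono) simp
    moreover have "upper k j i - upper k' j' i = (real (j i) - real (j' i)) / 2 ^ l"
      using 2 by (simp add: upper_def diff_divide_distrib)
    moreover have "j' \<in> index_box (2 ^ l)" using 2(5) by (auto simp: index_box_def)
    ultimately show ?thesis using 2 by (simp add: abs_divide)
  qed
  then show "k \<in> {l, Suc l}" "k' \<in> {l, Suc l}" "j \<in> index_box (2 ^ k)" "j' \<in> index_box (2 ^ k')"
    "\<bar>upper k j i - upper k' j' i\<bar> \<le> 2 / 2 ^ l" by auto
qed

lemma links_parent: "j \<in> index_box (2 ^ Suc l) \<Longrightarrow> ((l, \<lambda>i. j i div 2), (Suc l, j)) \<in> links l"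
  by (auto simp: links_def)

lemma links_neighbour:
  assumes "j \<in> index_box (2 ^ l)" "j' \<in> index_box (2 ^ l)" "\<And>i. j' i \<le> j i + 2" "\<And>i. j i \<le> j' i + 2"
  shows "((l, j), (l, j')) \<in> links l"
proof -
  define e where "e = (\<lambda>i. j' i + 2 - j i)"
  have "e \<in> index_box 4" using assms(3) by (auto simp: index_box_def e_def le_diff_conv)
  moreover have "j' = (\<lambda>i. min (2 ^ l) (j i + e i - 2))"
  proof
    fix i
    have "j i + e i - 2 = j' i" using assms(4)[of i] by (simp add: e_def)
    then show "j' i = min (2 ^ l) (j i + e i - 2)" using assms(2) by (simp add: index_box_def)
  qed
  ultimately show ?thesis using assms(1) unfolding links_def by (intro UnI2 image_eqI[of _ _ "(j, e)"]) auto
qed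

text \<open>Outside this event hold the bounds that the pathwise estimates consume: link increments
  for the chain and for the bracket, the top term for the outer region.\<close>

definition bad :: "nat \<Rightarrow> nat \<Rightarrow> real \<Rightarrow> 'a set" where
  "bad n l x = (\<Union>ab\<in>links l. {\<omega> \<in> space M. x \<le> \<bar>grid_sum n (fst ab) \<omega> - grid_sum n (snd ab) \<omega>\<bar>}) \<union>
     {\<omega> \<in> space M. x \<le> \<bar>grid_sum n (l, top_index l) \<omega>\<bar>}"

lemma bad_sets [measurable]: "bad n l x \<in> sets M"
  unfolding bad_def using finite_links by (intro sets.Un sets.finite_UN) auto

text \<open>Markov's inequality for each increment and a union bound; the number of links is
  absorbed by the factor 2^(ld) in \<open>key_moment\<close>.\<close>

lemma prob_bad:
  "\<exists>A l0 \<beta>. 0 < A \<and> 0 < \<beta> \<and> (\<forall>l n c x. l0 \<le> l \<longrightarrow> 1 \<le> n \<longrightarrow> 1 \<le> c \<longrightarrow> 4 ^ l \<le> c * real n \<longrightarrow> 0 < x \<longrightarrow>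
     prob (bad n l x) \<le> A * c ^ p * 2 powr (- \<beta> * real l) / x ^ (2 * p))"
proof -
  define d where "d = real CARD('d)"
  have d1: "1 \<le> d" by (simp add: d_def Suc_leI)
  \<comment> \<open>A link has mean increment at most 3 d / 2^l, which is 6 d / 2^(l+1).\<close>
  have "1 \<le> 6 * d" using d1 by simp
  from key_moment[OF this] obtain C' l0 \<beta> where C': "0 < C'" and \<beta>: "0 < \<beta>"
    and key: "\<forall>l f n c. l0 \<le> l \<longrightarrow> f \<in> G \<longrightarrow> (\<forall>x. \<bar>f x\<bar> \<le> 1) \<longrightarrow>
     normG f \<le> 2 * \<Psi> (2 ^ l) + 2 * normG (\<lambda>x. 1) \<longrightarrow> mean (\<lambda>x. \<bar>f x\<bar>) \<le> (6 * d) / 2 ^ l \<longrightarrow> 1 \<le> n \<longrightarrow> 1 \<le> c \<longrightarrow>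
     4 ^ l \<le> c * real n \<longrightarrow>
     2 ^ (l * CARD('d)) * (LINT \<omega>|M. normalized_sum n f \<omega> ^ (2 * p)) \<le> C' * c ^ p * 2 powr (- \<beta> * real l)"
    by (elim exE conjE) (rule that)
  \<comment> \<open>Links involve level l + 1, so \<open>key_moment\<close> is used there, where
    4^(l+1) <= (4 c) n; hence the 4^p.\<close>
  define B where "B = C' * 4 ^ p"
  have B: "0 < B" "C' \<le> B" using C' by (auto simp: B_def)
  have K1: "0 \<le> normG (\<lambda>x. 1)" by (rule normG_nonneg[OF G_const])
  have pair: "2 ^ (l * CARD('d)) * prob {\<omega> \<in> space M. x \<le> \<bar>grid_sum n a \<omega> - grid_sum n b \<omega>\<bar>} \<le> B * c ^ p * 2 powr (- \<beta> * real l) / x ^ (2 * p)"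
    if l: "l0 \<le> l" and n: "1 \<le> n" and c: "1 \<le> c" and cn: "4 ^ l \<le> c * real n" and x: "0 < x" and ab: "(a, b) \<in> links l" for l n c x a b
  proof -
    obtain k j k' j' where a: "a = (k, j)" and b: "b = (k', j')" by (cases a, cases b)
    note nr = links_near[OF ab[unfolded a b]]
    define f where "f = (\<lambda>x. phi k j x - phi k' j' x)"
    have f: "f \<in> G" unfolding f_def by (intro G_diff phi_G)
    have f1: "\<bar>f x\<bar> \<le> 1" for x
      using phi_bounds[of k j x] phi_bounds[of k' j' x] by (simp add: f_def abs_le_iff)
    have fb: "bounded_fun f" using f1 by blast
    have "\<Psi> (2 ^ k) \<le> \<Psi> (2 ^ Suc l)" "\<Psi> (2 ^ k') \<le> \<Psi> (2 ^ Suc l)" using nr(1,2) by (auto intro!: \<Psi>_mono)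
    then have nf: "normG f \<le> 2 * \<Psi> (2 ^ Suc l) + 2 * normG (\<lambda>x. 1)"
      using normG_diff[OF phi_G[of k j] phi_G[of k' j']] normG_phi[of k j] normG_phi[of k' j'] K1
      unfolding f_def by linarith
    have mf: "mean (\<lambda>x. \<bar>f x\<bar>) \<le> (6 * d) / 2 ^ Suc l"
    proof -
      have "mean (\<lambda>x. \<bar>f x\<bar>) \<le> 3 * real CARD('d) / 2 ^ l"
        unfolding f_def by (rule abs_phi_diff[OF nr(3,4,5)]) (use nr(1,2) in auto)
      then show ?thesis by (simp add: d_def)
    qed
    have Yf: "grid_sum n a \<omega> - grid_sum n b \<omega> = normalized_sum n f \<omega>" for \<omega>
      unfolding grid_sum_def a b f_def by (simp add: normalized_sum_diff phi_bounded)
    have "2 ^ (l * CARD('d)) * (LINT \<omega>|M. normalized_sum n f \<omega> ^ (2 * p)) \<le> 2 ^ (Suc l * CARD('d)) * (LINT \<omega>|M. normalized_sum n f \<omega> ^ (2 * p))"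
      by (intro mult_right_mono Bochner_Integration.integral_nonneg power_increasing) auto
    also have "\<dots> \<le> C' * (4 * c) ^ p * 2 powr (- \<beta> * real (Suc l))"
      by (rule key[rule_format]) (use l f f1 nf mf n c cn in auto)
    also have "\<dots> \<le> C' * (4 * c) ^ p * 2 powr (- \<beta> * real l)"
    proof (rule mult_left_mono)
      show "2 powr (- \<beta> * real (Suc l)) \<le> (2 powr (- \<beta> * real l) :: real)" using \<beta> by simp
    qed (use C' c in auto)
    also have "\<dots> = B * c ^ p * 2 powr (- \<beta> * real l)" by (simp add: B_def power_mult_distrib)
    finally have m: "2 ^ (l * CARD('d)) * (LINT \<omega>|M. normalized_sum n f \<omega> ^ (2 * p)) \<le> B * c ^ p * 2 powr (- \<beta> * real l)" .
    have "2 ^ (l * CARD('d)) * prob {\<omega> \<in> space M. x \<le> \<bar>grid_sum n a \<omega> - grid_sum n b \<omega>\<bar>} \<le> 2 ^ (l * CARD('d)) * ((LINT \<omega>|M. normalized_sum n f \<omega> ^ (2 * p)) / x ^ (2 * p))"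
      unfolding Yf by (intro mult_left_mono normalized_sum_markov G_measurable f fb x) auto
    also have "\<dots> \<le> B * c ^ p * 2 powr (- \<beta> * real l) / x ^ (2 * p)"
      using divide_right_mono[OF m, of "x ^ (2 * p)"] x by simp
    finally show ?thesis .
  qed
  have topp: "2 ^ (l * CARD('d)) * prob {\<omega> \<in> space M. x \<le> \<bar>grid_sum n (l, top_index l) \<omega>\<bar>} \<le> B * c ^ p * 2 powr (- \<beta> * real l) / x ^ (2 * p)"
    if l: "l0 \<le> l" and n: "1 \<le> n" and c: "1 \<le> c" and cn: "4 ^ l \<le> c * real n" and x: "0 < x" for l n c x
  proof -
    define f where "f = (\<lambda>x. 1 - phi l (top_index l) x)"
    have f: "f \<in> G" unfolding f_def by (intro G_diff phi_G G_const)
    have f1: "\<bar>f x\<bar> \<le> 1" for x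
      using phi_bounds[of l "top_index l" x] by (simp add: f_def abs_le_iff)
    have fb: "bounded_fun f" using f1 by blast
    have nf: "normG f \<le> 2 * \<Psi> (2 ^ l) + 2 * normG (\<lambda>x. 1)"
      using normG_diff[OF G_const phi_G[of l "top_index l"], of 1] normG_phi[of l "top_index l"] K1 \<Psi>_nonneg[of "2 ^ l"]
      unfolding f_def by auto
    have mf: "mean (\<lambda>x. \<bar>f x\<bar>) \<le> (6 * d) / 2 ^ l"
    proof -
      have "2 * d / 2 ^ l \<le> 6 * d / 2 ^ l" using d1 by (intro divide_right_mono) auto
      then show ?thesis using one_minus_phi_top[of l] unfolding f_def d_def by linarith
    qed
    \<comment> \<open>Constants have normalised sum 0, so up to sign the top term belongs to 1 -
      \<open>phi\<close>, a function that is small in mean.\<close>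
    have Yf: "\<bar>grid_sum n (l, top_index l) \<omega>\<bar> = \<bar>normalized_sum n f \<omega>\<bar>" for \<omega>
    proof -
      have "normalized_sum n f \<omega> = normalized_sum n (\<lambda>x. 1) \<omega> - normalized_sum n (phi l (top_index l)) \<omega>"
        unfolding f_def by (rule normalized_sum_diff) (auto simp: phi_bounded)
      moreover have "normalized_sum n (\<lambda>x. 1) \<omega> = 0" by (simp add: normalized_sum_def mean_const)
      ultimately show ?thesis by (simp add: grid_sum_def)
    qed
    have "2 ^ (l * CARD('d)) * (LINT \<omega>|M. normalized_sum n f \<omega> ^ (2 * p)) \<le> C' * c ^ p * 2 powr (- \<beta> * real l)"
      by (rule key[rule_format]) (use l f f1 nf mf n c cn in auto)
    also have "\<dots> \<le> B * c ^ p * 2 powr (- \<beta> * real l)" using B c by (intro mult_right_mono) auto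
    finally have m: "2 ^ (l * CARD('d)) * (LINT \<omega>|M. normalized_sum n f \<omega> ^ (2 * p)) \<le> B * c ^ p * 2 powr (- \<beta> * real l)" .
    have "2 ^ (l * CARD('d)) * prob {\<omega> \<in> space M. x \<le> \<bar>grid_sum n (l, top_index l) \<omega>\<bar>} \<le> 2 ^ (l * CARD('d)) * ((LINT \<omega>|M. normalized_sum n f \<omega> ^ (2 * p)) / x ^ (2 * p))"
      unfolding Yf by (intro mult_left_mono normalized_sum_markov G_measurable f fb x) auto
    also have "\<dots> \<le> B * c ^ p * 2 powr (- \<beta> * real l) / x ^ (2 * p)"
      using divide_right_mono[OF m, of "x ^ (2 * p)"] x by simp
    finally show ?thesis .
  qed
  define N where "N = (4 ^ CARD('d) + 10 ^ CARD('d) + 1 :: real)"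
  have N: "0 < N" by (simp add: N_def add_pos_pos)
  have "prob (bad n l x) \<le> (N * B) * c ^ p * 2 powr (- \<beta> * real l) / x ^ (2 * p)"
    if h: "l0 \<le> l" "1 \<le> n" "1 \<le> c" "4 ^ l \<le> c * real n" "0 < x" for l n c x
  proof -
    define q where "q = B * c ^ p * 2 powr (- \<beta> * real l) / x ^ (2 * p) / 2 ^ (l * CARD('d))"
    have q0: "0 \<le> q" using B h by (simp add: q_def)
    have q1: "prob {\<omega> \<in> space M. x \<le> \<bar>grid_sum n a \<omega> - grid_sum n b \<omega>\<bar>} \<le> q" if "(a, b) \<in> links l" for a b
    proof -
      have "prob {\<omega> \<in> space M. x \<le> \<bar>grid_sum n a \<omega> - grid_sum n b \<omega>\<bar>} * 2 ^ (l * CARD('d)) \<le> B * c ^ p * 2 powr (- \<beta> * real l) / x ^ (2 * p)"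
        using pair[OF h that] by (simp only: mult.commute)
      then show ?thesis unfolding q_def by (subst pos_le_divide_eq) simp_all
    qed
    have q2: "prob {\<omega> \<in> space M. x \<le> \<bar>grid_sum n (l, top_index l) \<omega>\<bar>} \<le> q"
    proof -
      have "prob {\<omega> \<in> space M. x \<le> \<bar>grid_sum n (l, top_index l) \<omega>\<bar>} * 2 ^ (l * CARD('d)) \<le> B * c ^ p * 2 powr (- \<beta> * real l) / x ^ (2 * p)"
        using topp[OF h] by (simp only: mult.commute)
      then show ?thesis unfolding q_def by (subst pos_le_divide_eq) simp_all
    qed
    have "prob (bad n l x) \<le> prob (\<Union>ab\<in>links l. {\<omega> \<in> space M. x \<le> \<bar>grid_sum n (fst ab) \<omega> - grid_sum n (snd ab) \<omega>\<bar>}) + prob {\<omega> \<in> space M. x \<le> \<bar>grid_sum n (l, top_index l) \<omega>\<bar>}"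
      unfolding bad_def using finite_links by (intro measure_Un_le sets.finite_UN) auto
    also have "prob (\<Union>ab\<in>links l. {\<omega> \<in> space M. x \<le> \<bar>grid_sum n (fst ab) \<omega> - grid_sum n (snd ab) \<omega>\<bar>})
      \<le> (\<Sum>ab\<in>links l. prob {\<omega> \<in> space M. x \<le> \<bar>grid_sum n (fst ab) \<omega> - grid_sum n (snd ab) \<omega>\<bar>})"
      by (rule finite_measure_subadditive_finite[OF finite_links]) auto
    also have "\<dots> \<le> real (card (links l)) * q"
      by (rule sum_bounded_above) (use q1 in auto)
    also have "\<dots> \<le> (4 ^ CARD('d) + 10 ^ CARD('d)) * 2 ^ (l * CARD('d)) * q"
      using card_links q0 by (rule mult_right_mono)
    finally have "prob (bad n l x) \<le> (4 ^ CARD('d) + 10 ^ CARD('d)) * 2 ^ (l * CARD('d)) * q + q" using q2 by linarith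
    also have "\<dots> \<le> (4 ^ CARD('d) + 10 ^ CARD('d)) * 2 ^ (l * CARD('d)) * q + 2 ^ (l * CARD('d)) * q"
      using mult_right_mono[OF one_le_power[of "2::real" "l * CARD('d)"] q0] by simp
    also have "\<dots> = N * (2 ^ (l * CARD('d)) * q)" by (simp add: N_def algebra_simps)
    also have "\<dots> = (N * B) * c ^ p * 2 powr (- \<beta> * real l) / x ^ (2 * p)" by (simp add: q_def)
    finally show ?thesis .
  qed
  then show ?thesis using N B \<beta> by (intro exI[of _ "N * B"] exI[of _ l0] exI[of _ \<beta>]) auto
qed

section \<open>Locating a point in the grids and bracketing its orthant\<close>

definition grid_index :: "nat \<Rightarrow> ereal^'d \<Rightarrow> 'd \<Rightarrow> nat" where
  "grid_index k t i = nat \<lfloor>2 ^ k * marginal_cdf i (t $ i)\<rfloor>"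

lemma grid_index_bounds: "real (grid_index k t i) \<le> 2 ^ k * marginal_cdf i (t $ i)" "2 ^ k * marginal_cdf i (t $ i) < real (grid_index k t i) + 1"
proof -
  have "0 \<le> 2 ^ k * marginal_cdf i (t $ i)" using marginal_cdf_bounds(1) by simp
  then have "real (grid_index k t i) = real_of_int \<lfloor>2 ^ k * marginal_cdf i (t $ i)\<rfloor>" by (simp add: grid_index_def)
  then show "real (grid_index k t i) \<le> 2 ^ k * marginal_cdf i (t $ i)" "2 ^ k * marginal_cdf i (t $ i) < real (grid_index k t i) + 1" by linarith+
qed

lemma grid_index_index_box: "grid_index k t \<in> index_box (2 ^ k)"
proof -
  have "grid_index k t i \<le> 2 ^ k" for i
  proof -
    have "2 ^ k * marginal_cdf i (t $ i) \<le> 2 ^ k" using marginal_cdf_bounds(2)[of i "t $ i"] by simp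
    then have "real (grid_index k t i) \<le> real (2 ^ k)" using grid_index_bounds(1)[of k t i] unfolding of_nat_power of_nat_numeral by linarith
    then show ?thesis by (simp only: of_nat_le_iff)
  qed
  then show ?thesis by (simp add: index_box_def)
qed

text \<open>Halving the floor of 2 y gives the floor of y, so the indices of a fixed point on
  successive grids are joined by parent links.\<close>

lemma grid_index_parent: "(\<lambda>i. grid_index (Suc k) t i div 2) = grid_index k t"
proof
  fix i
  let ?y = "2 ^ k * marginal_cdf i (t $ i)"
  have "real (grid_index (Suc k) t i) \<le> 2 * ?y" "2 * ?y < real (grid_index (Suc k) t i) + 1"
    using grid_index_bounds(1)[of "Suc k" t i] grid_index_bounds(2)[of "Suc k" i t] by simp_all
  moreover have "real (grid_index k t i) \<le> ?y" "?y < real (grid_index k t i) + 1" using grid_index_bounds(1)[of k t i] grid_index_bounds(2)[of k i t] by simp_all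
  ultimately have "real (grid_index (Suc k) t i) < real (2 * grid_index k t i + 2)" "real (2 * grid_index k t i) < real (grid_index (Suc k) t i + 1)"
    by simp_all
  then have "grid_index (Suc k) t i < 2 * grid_index k t i + 2" "2 * grid_index k t i < grid_index (Suc k) t i + 1" by (simp_all only: of_nat_less_iff)
  then show "grid_index (Suc k) t i div 2 = grid_index k t i" by presburger
qed

text \<open>Telescoping along parent links. \<open>Y\<close> is arbitrary because the bound serves
  both the normalised sums and their Gaussian limits.\<close>

lemma chain:
  assumes good: "\<And>l ab. k \<le> l \<Longrightarrow> l < K \<Longrightarrow> ab \<in> links l \<Longrightarrow> \<bar>Y (fst ab) - Y (snd ab)\<bar> \<le> e l" and "k \<le> K"
  shows "\<bar>Y (K, grid_index K t) - Y (k, grid_index k t)\<bar> \<le> (\<Sum>l\<in>{k..<K}. e l :: real)"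
  using \<open>k \<le> K\<close> good
proof (induction K rule: dec_induct)
  case (step K)
  have "((K, \<lambda>i. grid_index (Suc K) t i div 2), (Suc K, grid_index (Suc K) t)) \<in> links K" by (rule links_parent[OF grid_index_index_box])
  then have "\<bar>Y (K, grid_index K t) - Y (Suc K, grid_index (Suc K) t)\<bar> \<le> e K"
    using step.prems[of K] step.hyps unfolding grid_index_parent by fastforce
  moreover have "\<bar>Y (K, grid_index K t) - Y (k, grid_index k t)\<bar> \<le> (\<Sum>l\<in>{k..<K}. e l)"
    by (rule step.IH) (use step.prems in auto)
  ultimately show ?case using step.hyps by simp
qed simp

text \<open>The upper bracket is shifted by 2: a lower level lies one mesh below its index, and the
  level of t is less than one mesh above its own index. If the shift leaves the grid, the points
  that are lost have a coordinate beyond the quantile of level 1 - 2^(-k), where the top function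
  vanishes.\<close>

lemma bracket:
  assumes j': "j' = (\<lambda>i. min (2 ^ k) (grid_index k t i + 2))"
  shows "phi k (grid_index k t) x \<le> orthant t x" "orthant t x \<le> phi k j' x + (1 - phi k (top_index k) x)"
proof -
  have j'b: "j' \<in> index_box (2 ^ k)" unfolding j' by (simp add: index_box_def)
  have tb: "top_index k \<in> index_box (2 ^ k)" by (simp add: index_box_def top_index_def)
  have "orthant (quantile_point (upper k (grid_index k t))) x \<le> orthant t x"
  proof (rule orthant_mono)
    fix i
    have "upper k (grid_index k t) i \<le> marginal_cdf i (t $ i)" using grid_index_bounds(1)[of k t i] by (simp add: upper_def divide_le_eq mult.commute)
    moreover from this have "upper k (grid_index k t) i \<le> 1" using marginal_cdf_bounds(2) order_trans by blast
    ultimately show "quantile_point (upper k (grid_index k t)) $ i \<le> t $ i" by (simp add: quantile_point_def quantile_le_iff)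
  qed
  then show "phi k (grid_index k t) x \<le> orthant t x" using phi_sandwich(2)[OF grid_index_index_box, of k t x] by linarith
  show "orthant t x \<le> phi k j' x + (1 - phi k (top_index k) x)"
  proof (cases "vle x t \<and> \<not> vle x (quantile_point (lower k j'))")
    case False
    then have "orthant t x \<le> orthant (quantile_point (lower k j')) x" by (auto simp: orthant_def indicator_def)
    then show ?thesis using phi_sandwich(1)[OF j'b, of x] phi_bounds(2)[of k "top_index k" x] by linarith
  next
    case True
    then obtain i where i: "\<not> ereal (x $ i) \<le> quantile i (lower k j' i)" and xt: "ereal (x $ i) \<le> t $ i"
      by (auto simp: vle_def quantile_point_def)
    have "grid_index k t i + 2 > 2 ^ k"
    proof (rule ccontr)
      assume a: "\<not> grid_index k t i + 2 > 2 ^ k"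
      then have j'i: "j' i = grid_index k t i + 2" by (simp add: j')
      have lo: "lower k j' i = (real (grid_index k t i) + 1) / 2 ^ k" by (simp add: lower_def j'i)
      have "real (grid_index k t i + 2) \<le> real (2 ^ k)" using a by (simp only: of_nat_le_iff not_less)
      then have "lower k j' i \<le> 1" by (simp add: lo)
      moreover have "\<not> lower k j' i \<le> marginal_cdf i (t $ i)"
        using grid_index_bounds(2)[of k i t] by (simp add: lo divide_le_eq mult.commute not_le)
      ultimately have "\<not> quantile i (lower k j' i) \<le> t $ i" by (simp add: quantile_le_iff)
      then show False using i xt by (meson linear order_trans)
    qed
    then have "j' i = 2 ^ k" by (simp add: j')
    \<comment> \<open>The clamped last cell begins where the top cell ends, at level 1 -
      2^(-k).\<close>
    then have "lower k j' i = upper k (top_index k) i" by (simp add: lower_def upper_def top_index_def of_nat_diff)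
    then have "\<not> vle x (quantile_point (upper k (top_index k)))" using i by (auto simp: vle_def quantile_point_def)
    then have "orthant (quantile_point (upper k (top_index k))) x = 0" by (simp add: orthant_def)
    then have "phi k (top_index k) x \<le> 0" using phi_sandwich(2)[OF tb, of x] by simp
    then show ?thesis using phi_bounds(1)[of k j' x] orthant_bounds(2)[of t x] by linarith
  qed
qed

text \<open>A larger function also has a larger centring; over n terms, after normalisation, this
  costs sqrt n times the difference of the means.\<close>

lemma normalized_sum_mono_drift:
  assumes "\<And>x. f x \<le> g x"
  shows "normalized_sum n f \<omega> \<le> normalized_sum n g \<omega> + sqrt n * (mean g - mean f)"
proof (cases "n = 0")
  case False
  have "(\<Sum>i=1..n. f (X i \<omega>) - mean f) \<le> (\<Sum>i=1..n. (g (X i \<omega>) - mean g) + (mean g - mean f))"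
    by (rule sum_mono) (simp add: assms)
  also have "\<dots> = (\<Sum>i=1..n. g (X i \<omega>) - mean g) + real n * (mean g - mean f)"
    by (simp only: sum.distrib) simp
  finally have "normalized_sum n f \<omega> \<le> (1 / sqrt n) * ((\<Sum>i=1..n. g (X i \<omega>) - mean g) + real n * (mean g - mean f))"
    unfolding normalized_sum_def by (intro mult_left_mono) auto
  also have "\<dots> = normalized_sum n g \<omega> + real n / sqrt n * (mean g - mean f)"
    unfolding normalized_sum_def by (simp add: distrib_left)
  also have "real n / sqrt n = sqrt n" by (simp add: real_div_sqrt)
  finally show ?thesis .
qed (simp add: normalized_sum_def)

text \<open>The orthant is squeezed between combinations of \<open>phi\<close>. A neighbour link and
  the top term give the 2 e; the two brackets differ in mean by at most (3 d + 2 d) / 2^k, which the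
  drift multiplies by sqrt n.\<close>

lemma approximation_at_level:
  assumes good: "\<And>ab. ab \<in> links k \<Longrightarrow> \<bar>grid_sum n (fst ab) \<omega> - grid_sum n (snd ab) \<omega>\<bar> \<le> e" "\<bar>grid_sum n (k, top_index k) \<omega>\<bar> \<le> e"
  shows "\<bar>normalized_sum n (orthant t) \<omega> - grid_sum n (k, grid_index k t) \<omega>\<bar> \<le> 2 * e + 5 * real CARD('d) * sqrt n / 2 ^ k"
proof -
  define j' where "j' = (\<lambda>i. min (2 ^ k) (grid_index k t i + 2))"
  define g where "g = (\<lambda>x. phi k j' x + (1 - phi k (top_index k) x))"
  note br = bracket[OF j'_def]
  have j'b: "j' \<in> index_box (2 ^ k)" unfolding j'_def by (simp add: index_box_def)
  have jb: "grid_index k t i \<le> 2 ^ k" for i using grid_index_index_box[of k t] by (simp add: index_box_def)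
  have near: "\<And>i. j' i \<le> grid_index k t i + 2" "\<And>i. grid_index k t i \<le> j' i + 2"
  proof -
    fix i
    have "j' i = min (2 ^ k) (grid_index k t i + 2)" by (simp add: j'_def)
    then show "j' i \<le> grid_index k t i + 2" "grid_index k t i \<le> j' i + 2" using jb[of i] by linarith+
  qed
  have lk: "((k, grid_index k t), (k, j')) \<in> links k" by (rule links_neighbour[OF grid_index_index_box j'b near])
  have e1: "\<bar>grid_sum n (k, grid_index k t) \<omega> - grid_sum n (k, j') \<omega>\<bar> \<le> e" using good(1)[OF lk] by simp
  have tb: "bounded_fun (\<lambda>x. 1 - phi k (top_index k) x)" using phi_bounds[of k "top_index k"] by (intro exI[of _ 1]) auto
  have nr: "\<bar>upper k j' i - upper k (grid_index k t) i\<bar> \<le> 2 / 2 ^ k" for i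
    using links_near(5)[OF lk, of i] by (simp only: abs_minus_commute)
  have mg: "mean g = mean (phi k j') + mean (\<lambda>x. 1 - phi k (top_index k) x)"
    unfolding g_def by (rule mean_add[OF phi_measurable phi_bounded _ tb]) measurable
  have ng: "normalized_sum n g \<omega> = grid_sum n (k, j') \<omega> - grid_sum n (k, top_index k) \<omega>"
  proof -
    have "normalized_sum n g \<omega> = normalized_sum n (phi k j') \<omega> + normalized_sum n (\<lambda>x. 1 - phi k (top_index k) x) \<omega>"
      unfolding g_def by (rule normalized_sum_add[OF phi_measurable phi_bounded _ tb]) measurable
    also have "normalized_sum n (\<lambda>x. 1 - phi k (top_index k) x) \<omega> = normalized_sum n (\<lambda>x. 1) \<omega> - normalized_sum n (phi k (top_index k)) \<omega>"
      by (rule normalized_sum_diff) (auto simp: phi_bounded)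
    also have "normalized_sum n (\<lambda>x. 1) \<omega> = 0" by (simp add: normalized_sum_def mean_const)
    finally show ?thesis by (simp add: grid_sum_def)
  qed
  have "\<bar>g x\<bar> \<le> 2" for x
    using phi_bounds[of k j' x] phi_bounds[of k "top_index k" x] unfolding g_def by linarith
  then have gb: "bounded_fun g" by blast
  have gm: "g \<in> borel_measurable borel" unfolding g_def by measurable
  have m1: "mean (phi k (grid_index k t)) \<le> mean (orthant t)"
    by (intro mean_mono phi_measurable phi_bounded orthant_measurable orthant_bounded br(1))
  have m2: "mean (orthant t) \<le> mean g"
    by (intro mean_mono orthant_measurable orthant_bounded gm gb) (simp add: g_def br(2))
  have m3: "mean g - mean (phi k (grid_index k t)) \<le> 5 * real CARD('d) / 2 ^ k"
  proof -
    have "mean (phi k j') - mean (phi k (grid_index k t)) = mean (\<lambda>x. phi k j' x - phi k (grid_index k t) x)"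
      unfolding mean_def by (intro Bochner_Integration.integral_diff[symmetric] comp_integrable phi_bounded phi_measurable)
    moreover have "mean (\<lambda>x. \<bar>phi k j' x - phi k (grid_index k t) x\<bar>) \<le> 3 * real CARD('d) / 2 ^ k"
      by (rule abs_phi_diff[OF j'b grid_index_index_box nr order_refl order_refl])
    ultimately have a: "mean (phi k j') - mean (phi k (grid_index k t)) \<le> 3 * real CARD('d) / 2 ^ k"
      using abs_mean_le[of "\<lambda>x. phi k j' x - phi k (grid_index k t) x"] by linarith
    have "mean (\<lambda>x. 1 - phi k (top_index k) x) \<le> 2 * real CARD('d) / 2 ^ k"
      using one_minus_phi_top[of k] abs_mean_le[of "\<lambda>x. 1 - phi k (top_index k) x"] by linarith
    then show ?thesis using a mg by (simp add: add_divide_distrib[symmetric] field_simps)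
  qed
  have sq: "sqrt n * (mean g - mean (phi k (grid_index k t))) \<le> 5 * real CARD('d) * sqrt n / 2 ^ k"
    using mult_left_mono[OF m3, of "sqrt n"] by (simp add: mult_ac)
  have "sqrt n * (mean g - mean (orthant t)) \<le> sqrt n * (mean g - mean (phi k (grid_index k t)))"
    "sqrt n * (mean (orthant t) - mean (phi k (grid_index k t))) \<le> sqrt n * (mean g - mean (phi k (grid_index k t)))"
    using m1 m2 by (intro mult_left_mono; simp)+
  moreover have "normalized_sum n (orthant t) \<omega> \<le> normalized_sum n g \<omega> + sqrt n * (mean g - mean (orthant t))"
    by (rule normalized_sum_mono_drift) (simp add: g_def br(2))
  moreover have "grid_sum n (k, grid_index k t) \<omega> \<le> normalized_sum n (orthant t) \<omega> + sqrt n * (mean (orthant t) - mean (phi k (grid_index k t)))"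
    using normalized_sum_mono_drift[of "phi k (grid_index k t)" "orthant t" n \<omega>, OF br(1)] by (simp add: grid_sum_def)
  ultimately show ?thesis using e1 good(2) sq ng by linarith
qed

end

section \<open>The Skorokhod space\<close>

lemma to_unit_bounds: "0 \<le> to_unit t" "to_unit t \<le> 1"
proof -
  have "0 \<le> 1 / 2 + arctan r / pi \<and> 1 / 2 + arctan r / pi \<le> 1" for r
  proof -
    have "- (1 / 2) \<le> arctan r / pi" "arctan r / pi \<le> 1 / 2"
      using arctan_bounded[of r] by (simp_all add: divide_le_eq le_divide_eq)
    then show ?thesis by linarith
  qed
  then show "0 \<le> to_unit t" "to_unit t \<le> 1" by (cases t; simp add: to_unit_def del: add_divide_distrib)+
qed

lemma to_unit_lipschitz: "\<bar>to_unit (ereal s) - to_unit (ereal t)\<bar> \<le> \<bar>s - t\<bar>"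
proof -
  have *: "arctan t - arctan s \<le> t - s" if "s < t" for s t
  proof -
    have "\<exists>z>s. z < t \<and> arctan t - arctan s = (t - s) * inverse (1 + z\<^sup>2)"
      by (rule MVT2[OF that]) (rule DERIV_arctan)
    then obtain z where z: "arctan t - arctan s = (t - s) * inverse (1 + z\<^sup>2)" by blast
    have "inverse (1 + z\<^sup>2) \<le> 1" by (rule inverse_le_imp_le) (simp_all add: add_nonneg_pos add_pos_nonneg)
    then have "(t - s) * inverse (1 + z\<^sup>2) \<le> (t - s) * 1"
      using that by (intro mult_left_mono) auto
    then show ?thesis using z by simp
  qed
  have "\<bar>arctan s - arctan t\<bar> \<le> \<bar>s - t\<bar>"
  proof (cases s t rule: linorder_cases)
    case less
    then show ?thesis using *[of s t] arctan_less_iff[of s t] by simp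
  next
    case greater
    then show ?thesis using *[of t s] arctan_less_iff[of t s] by simp
  qed simp
  moreover have "\<bar>arctan s / pi - arctan t / pi\<bar> = \<bar>arctan s - arctan t\<bar> / pi"
    by (simp add: diff_divide_distrib[symmetric])
  moreover have "\<bar>arctan s - arctan t\<bar> / pi \<le> \<bar>arctan s - arctan t\<bar> / 1"
    using pi_ge_two by (intro divide_left_mono) auto
  ultimately show ?thesis by (simp add: to_unit_def)
qed

text \<open>One candidate bounds the infimum once the family is known to be bounded below. The
  second supremum alone provides this, since \<open>to_unit\<close> has values in [0, 1]; the first
  may range over an unbounded set.\<close>

lemma skorokhod_dist_le:
  fixes x y :: "ereal^'d \<Rightarrow> real"
  assumes l: "\<And>i. l i \<in> time_changes"
    and 1: "\<And>t. \<bar>x t - y (\<chi> i. l i (t $ i))\<bar> \<le> e"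
    and 2: "\<And>i s. \<bar>to_unit (l i s) - to_unit s\<bar> \<le> e"
  shows "skorokhod_dist x y \<le> e"
  unfolding skorokhod_dist_def
proof (rule cINF_lower2)
  let ?F = "\<lambda>l. max (SUP t. \<bar>x t - y (\<chi> i. l i (t $ i))\<bar>)
            (SUP p. \<bar>to_unit (l (fst p) (snd p)) - to_unit (snd p)\<bar>)"
  show "bdd_below (?F ` {l :: 'd \<Rightarrow> ereal \<Rightarrow> ereal. \<forall>i. l i \<in> time_changes})"
  proof (rule bdd_belowI2)
    fix l :: "'d \<Rightarrow> ereal \<Rightarrow> ereal"
    have "\<bar>to_unit (l (fst p) (snd p)) - to_unit (snd p)\<bar> \<le> 1" for p
      using to_unit_bounds[of "l (fst p) (snd p)"] to_unit_bounds[of "snd p"] by linarith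
    then have bdd: "bdd_above (range (\<lambda>p. \<bar>to_unit (l (fst p) (snd p)) - to_unit (snd p)\<bar>))"
      by (intro bdd_aboveI2)
    have "\<bar>to_unit (l (fst p) (snd p)) - to_unit (snd p)\<bar> \<le> (SUP p. \<bar>to_unit (l (fst p) (snd p)) - to_unit (snd p)\<bar>)" for p
      by (rule cSUP_upper[OF UNIV_I bdd])
    then have "0 \<le> (SUP p. \<bar>to_unit (l (fst p) (snd p)) - to_unit (snd p)\<bar>)"
      using abs_ge_zero order_trans by blast
    then show "0 \<le> ?F l" by (rule max.coboundedI2)
  qed
  show "l \<in> {l. \<forall>i. l i \<in> time_changes}" using l by simp
  show "?F l \<le> e" using 1 2 by (intro max.boundedI cSUP_least) auto
qed

lemma id_time_change: "(\<lambda>s. s) \<in> time_changes"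
  by (simp add: time_changes_def strict_mono_def bij_def surj_def)

text \<open>The identity is a time change. Hence Skorokhod continuity implies continuity for the
  uniform distance, the form used for the envelopes.\<close>

lemma skorokhod_dist_le_uniform:
  assumes "\<And>t. \<bar>x t - y t\<bar> \<le> e"
  shows "skorokhod_dist x y \<le> e"
proof -
  have "0 \<le> e" using assms[of undefined] by linarith
  then show ?thesis using assms id_time_change by (intro skorokhod_dist_le[of "\<lambda>_ s. s"]) auto
qed

section \<open>Membership in the cadlag space\<close>

lemma Dspace_continuous:
  assumes "continuous_on UNIV x" shows "x \<in> Dspace"
proof -
  have "(x \<longlongrightarrow> x t) (at t within A)" for t A
    using assms by (auto simp: continuous_on_def intro: tendsto_within_subset)
  then show ?thesis unfolding Dspace_def cadlag_multi_def by blast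
qed

lemma Dspace_add:
  assumes "x \<in> Dspace" "y \<in> Dspace" shows "(\<lambda>t. x t + y t) \<in> Dspace"
proof -
  have 1: "(x \<longlongrightarrow> x t) (at t within quadrant {} t)" "(y \<longlongrightarrow> y t) (at t within quadrant {} t)"
    "\<exists>l. (x \<longlongrightarrow> l) (at t within quadrant S t)" "\<exists>l. (y \<longlongrightarrow> l) (at t within quadrant S t)" for t S
    using assms by (auto simp: Dspace_def cadlag_multi_def)
  have "\<exists>l. ((\<lambda>t. x t + y t) \<longlongrightarrow> l) (at t within quadrant S t)" for t S
    using 1(3)[of t S] 1(4)[of t S] by (auto intro: tendsto_add)
  then show ?thesis using 1(1,2) by (auto simp: Dspace_def cadlag_multi_def intro: tendsto_add)
qed

lemma Dspace_scale:
  assumes "x \<in> Dspace" shows "(\<lambda>t. c * x t) \<in> Dspace"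
proof -
  have 1: "(x \<longlongrightarrow> x t) (at t within quadrant {} t)" "\<exists>l. (x \<longlongrightarrow> l) (at t within quadrant S t)" for t S
    using assms by (auto simp: Dspace_def cadlag_multi_def)
  have "\<exists>l. ((\<lambda>t. c * x t) \<longlongrightarrow> l) (at t within quadrant S t)" for t S
    using 1(2)[of t S] by (auto intro: tendsto_mult_left)
  then show ?thesis using 1(1) by (auto simp: Dspace_def cadlag_multi_def intro: tendsto_mult_left)
qed

lemma Dspace_sum:
  assumes "finite I" "\<And>i. i \<in> I \<Longrightarrow> x i \<in> Dspace" shows "(\<lambda>t. \<Sum>i\<in>I. x i t) \<in> Dspace"
  using assms
proof (induction rule: finite_induct)
  case empty
  show ?case by (simp add: Dspace_continuous)
qed (simp add: Dspace_add)

text \<open>Inside a quadrant each coordinate approaches t_i either strictly from below or from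
  above, so the comparison is settled even in the critical case y_i = t_i.\<close>

lemma indicator_vle_quadrant:
  fixes t :: "ereal^'d"
  shows "\<forall>\<^sub>F s in at t within quadrant S t. (vle y s \<longleftrightarrow> (\<forall>i. if i \<in> S then ereal (y $ i) < t $ i else ereal (y $ i) \<le> t $ i))"
proof -
  have "\<forall>\<^sub>F s in at t within quadrant S t. \<forall>i. (ereal (y $ i) \<le> s $ i) = (if i \<in> S then ereal (y $ i) < t $ i else ereal (y $ i) \<le> t $ i)"
  proof (rule eventually_all_finite)
    fix i
    have lim: "((\<lambda>s. s $ i) \<longlongrightarrow> t $ i) (at t within quadrant S t)" by (intro tendsto_intros)
    have q: "\<forall>\<^sub>F s in at t within quadrant S t. s \<in> quadrant S t" by (simp add: eventually_at_filter)
    show "\<forall>\<^sub>F s in at t within quadrant S t. (ereal (y $ i) \<le> s $ i) = (if i \<in> S then ereal (y $ i) < t $ i else ereal (y $ i) \<le> t $ i)"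
    proof (cases "ereal (y $ i)" "t $ i" rule: linorder_cases)
      case less
      have "\<forall>\<^sub>F s in at t within quadrant S t. ereal (y $ i) < s $ i" by (rule order_tendstoD(1)[OF lim less])
      then show ?thesis by eventually_elim (use less in auto)
    next
      case greater
      have "\<forall>\<^sub>F s in at t within quadrant S t. s $ i < ereal (y $ i)" by (rule order_tendstoD(2)[OF lim greater])
      then show ?thesis by eventually_elim (use greater in auto)
    next
      case equal
      from q show ?thesis by eventually_elim (use equal in \<open>auto simp: quadrant_def not_le\<close>)
    qed
  qed
  then show ?thesis by eventually_elim (simp add: vle_def)
qed

lemma Dspace_indicator: "(\<lambda>t. indicator {x. vle x t} y) \<in> Dspace"
proof -
  define c where "c = (\<lambda>S t. if (\<forall>i. if i \<in> S then ereal (y $ i) < t $ i else ereal (y $ i) \<le> t $ i) then 1 else 0 :: real)"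
  have lim: "((\<lambda>s. indicator {x. vle x s} y) \<longlongrightarrow> c S t) (at t within quadrant S t)" for S t
  proof (rule tendsto_eventually)
    show "\<forall>\<^sub>F s in at t within quadrant S t. indicator {x. vle x s} y = c S t"
      using indicator_vle_quadrant[where y = y and t = t and S = S] by eventually_elim (simp add: c_def indicator_def)
  qed
  have "c {} t = indicator {x. vle x t} y" for t by (simp add: c_def indicator_def vle_def)
  then show ?thesis using lim[of "{}"] lim unfolding Dspace_def cadlag_multi_def by fastforce
qed

text \<open>The displacement \<open>e\<close> on the finite set is extended to the line by McShane's
  formula with slope 1/2. The identity plus a bounded 1/2-Lipschitz function is strictly increasing
  and, by the intermediate value theorem, onto.\<close>

lemma time_change_exists:
  fixes e :: "real \<Rightarrow> real"
  assumes "finite A" "0 \<le> \<delta>" and e: "\<And>a. a \<in> A \<Longrightarrow> \<bar>e a\<bar> \<le> \<delta>"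
    and lip: "\<And>a b. a \<in> A \<Longrightarrow> b \<in> A \<Longrightarrow> e a - e b \<le> \<bar>a - b\<bar> / 2"
  obtains l where "l \<in> time_changes" "\<And>a. a \<in> A \<Longrightarrow> l (ereal a) = ereal (a + e a)"
    "\<And>s. \<exists>s'. l (ereal s) = ereal s' \<and> \<bar>s' - s\<bar> \<le> \<delta>" "l \<infinity> = \<infinity>" "l (-\<infinity>) = -\<infinity>"
proof -
  \<comment> \<open>The entry -\<delta> bounds the extension from below far away from
    \<open>A\<close> and keeps the set nonempty.\<close>
  define S where "S = (\<lambda>t. insert (- \<delta>) ((\<lambda>a. e a - \<bar>t - a\<bar> / 2) ` A))"
  define E where "E = (\<lambda>t. Max (S t))"
  have fin: "finite (S t)" "S t \<noteq> {}" for t using \<open>finite A\<close> by (auto simp: S_def)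
  have E_le: "E t \<le> c \<longleftrightarrow> - \<delta> \<le> c \<and> (\<forall>a\<in>A. e a - \<bar>t - a\<bar> / 2 \<le> c)" for t c
    unfolding E_def by (subst Max_le_iff[OF fin]) (auto simp: S_def)
  have E_ge: "- \<delta> \<le> E t" "a \<in> A \<Longrightarrow> e a - \<bar>t - a\<bar> / 2 \<le> E t" for t a
    using E_le[of t "E t"] by auto
  have E_bd: "\<bar>E t\<bar> \<le> \<delta>" for t
  proof -
    have "E t \<le> \<delta>" unfolding E_le
    proof (intro conjI ballI)
      show "e a - \<bar>t - a\<bar> / 2 \<le> \<delta>" if "a \<in> A" for a
      proof -
        have "e a \<le> \<delta>" using e[OF that] by simp
        moreover have "0 \<le> \<bar>t - a\<bar> / 2" by simp
        ultimately show ?thesis by linarith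
      qed
    qed (use \<open>0 \<le> \<delta>\<close> in simp)
    then show ?thesis using E_ge(1)[of t] by linarith
  qed
  have E_A: "E a = e a" if a: "a \<in> A" for a
  proof (rule antisym)
    show "E a \<le> e a" unfolding E_le
    proof (intro conjI ballI)
      show "- \<delta> \<le> e a" using e[OF a] by linarith
      show "e b - \<bar>a - b\<bar> / 2 \<le> e a" if "b \<in> A" for b
        using lip[OF that a] by (simp add: abs_minus_commute)
    qed
    show "e a \<le> E a" using E_ge(2)[OF a, of a] by simp
  qed
  have E_lip: "E t \<le> E t' + \<bar>t - t'\<bar> / 2" for t t'
    unfolding E_le
  proof (intro conjI ballI)
    have "0 \<le> \<bar>t - t'\<bar> / 2" by simp
    then show "- \<delta> \<le> E t' + \<bar>t - t'\<bar> / 2" using E_ge(1)[of t'] by linarith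
    show "e a - \<bar>t - a\<bar> / 2 \<le> E t' + \<bar>t - t'\<bar> / 2" if "a \<in> A" for a
    proof -
      have "\<bar>t' - a\<bar> \<le> \<bar>t - t'\<bar> + \<bar>t - a\<bar>" by linarith
      then have "\<bar>t' - a\<bar> / 2 \<le> \<bar>t - t'\<bar> / 2 + \<bar>t - a\<bar> / 2" by (simp add: add_divide_distrib[symmetric])
      moreover have "e a - \<bar>t' - a\<bar> / 2 \<le> E t'" by (rule E_ge(2)[OF that])
      ultimately show ?thesis by (simp add: algebra_simps)
    qed
  qed
  define L where "L = (\<lambda>t. t + E t)"
  have L_mono: "L s < L t" if "s < t" for s t
  proof -
    have "E s \<le> E t + (t - s) / 2" using E_lip[of s t] that by simp
    then show ?thesis using that unfolding L_def by (simp add: field_simps)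
  qed
  have L_surj: "\<exists>x. L x = y" for y
  proof -
    have "continuous_on {y - \<delta>..y + \<delta>} E"
    proof (rule continuous_on_subset[OF lipschitz_on_continuous_on[of "1/2" UNIV]])
      show "(1 / 2)-lipschitz_on UNIV E"
      proof (rule lipschitz_onI)
        show "dist (E x) (E y) \<le> 1 / 2 * dist x y" for x y
          unfolding dist_real_def
        proof (rule abs_leI)
          show "E x - E y \<le> 1 / 2 * \<bar>x - y\<bar>" using E_lip[of x y] by simp
          show "- (E x - E y) \<le> 1 / 2 * \<bar>x - y\<bar>" using E_lip[of y x] by (simp add: abs_minus_commute)
        qed
      qed simp
    qed simp
    then have c: "continuous_on {y - \<delta>..y + \<delta>} L" unfolding L_def by (intro continuous_intros)
    have "L (y - \<delta>) \<le> y" "y \<le> L (y + \<delta>)"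
      using E_bd[of "y - \<delta>"] E_bd[of "y + \<delta>"] unfolding L_def by linarith+
    then show ?thesis using IVT'[of L "y - \<delta>" y "y + \<delta>"] c \<open>0 \<le> \<delta>\<close> by auto
  qed
  define l where "l = (\<lambda>t. case t of ereal r \<Rightarrow> ereal (L r) | PInfty \<Rightarrow> PInfty | MInfty \<Rightarrow> MInfty)"
  have l_simps: "l (ereal r) = ereal (L r)" "l \<infinity> = \<infinity>" "l (-\<infinity>) = -\<infinity>" for r
    by (simp_all add: l_def)
  have sm: "strict_mono l"
  proof (rule strict_monoI)
    fix s t :: ereal assume "s < t"
    then show "l s < l t" by (cases s; cases t) (auto simp: l_simps L_mono)
  qed
  have "surj l" unfolding surj_def
  proof
    fix y show "\<exists>x. y = l x"
    proof (cases y)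
      case (real r)
      obtain x where "L x = r" using L_surj by blast
      then show ?thesis using real l_simps(1)[of x] by (intro exI[of _ "ereal x"]) simp
    next
      case PInf
      then show ?thesis using l_simps(2) by (intro exI[of _ \<infinity>]) simp
    next
      case MInf
      then show ?thesis using l_simps(3) by (intro exI[of _ "-\<infinity>"]) simp
    qed
  qed
  then have "bij l" using strict_mono_imp_inj_on[OF sm] by (simp add: bij_def)
  then have "l \<in> time_changes" using sm by (simp add: time_changes_def)
  moreover have "l (ereal a) = ereal (a + e a)" if "a \<in> A" for a using E_A[OF that] by (simp add: l_simps L_def)
  moreover have "\<exists>s'. l (ereal s) = ereal s' \<and> \<bar>s' - s\<bar> \<le> \<delta>" for s
    using E_bd[of s] by (intro exI[of _ "L s"]) (simp add: l_simps L_def)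
  ultimately show ?thesis using that l_simps(2,3) by blast
qed

context continuous_df
begin

text \<open>A shift tending to 0 is invisible on the compact extended line, even for points that
  escape to infinity: along a subsequence both points have the same limit, and the marginal is
  continuous there.\<close>

lemma marginal_cdf_uniformly_continuous:
  assumes "0 < e"
  shows "\<forall>\<^sub>F m in sequentially. \<forall>s t. \<bar>s - t\<bar> \<le> 1 / real (Suc m) \<longrightarrow> \<bar>marginal_cdf i (ereal s) - marginal_cdf i (ereal t)\<bar> < e"
proof (rule ccontr)
  assume "\<not> ?thesis"
  then have "\<exists>m\<ge>N. \<exists>s t. \<bar>s - t\<bar> \<le> 1 / real (Suc m) \<and> e \<le> \<bar>marginal_cdf i (ereal s) - marginal_cdf i (ereal t)\<bar>" for N
    unfolding eventually_sequentially by (metis not_less)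
  then have "\<exists>s t. \<bar>s - t\<bar> \<le> 1 / real (Suc N) \<and> e \<le> \<bar>marginal_cdf i (ereal s) - marginal_cdf i (ereal t)\<bar>" for N
  proof -
    assume "\<And>N. \<exists>m\<ge>N. \<exists>s t. \<bar>s - t\<bar> \<le> 1 / real (Suc m) \<and> e \<le> \<bar>marginal_cdf i (ereal s) - marginal_cdf i (ereal t)\<bar>"
    then obtain m s t where m: "N \<le> m" "\<bar>s - t\<bar> \<le> 1 / real (Suc m)" "e \<le> \<bar>marginal_cdf i (ereal s) - marginal_cdf i (ereal t)\<bar>" by blast
    have "1 / real (Suc m) \<le> 1 / real (Suc N)" using m(1) by (intro divide_left_mono) auto
    then show ?thesis using m by (intro exI[of _ s] exI[of _ t]) simp
  qed
  then obtain s t where st: "\<And>N. \<bar>s N - t N\<bar> \<le> 1 / real (Suc N)" "\<And>N. e \<le> \<bar>marginal_cdf i (ereal (s N)) - marginal_cdf i (ereal (t N))\<bar>"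
    by metis
  obtain a r where r: "strict_mono r" "((\<lambda>N. ereal (s N)) \<circ> r) \<longlonglongrightarrow> a"
    using compact_complete_linorder[of "\<lambda>N. ereal (s N)"] by blast
  have "(\<lambda>N. t N - s N) \<longlonglongrightarrow> 0"
  proof (rule Lim_null_comparison)
    show "\<forall>\<^sub>F N in sequentially. norm (t N - s N) \<le> 1 / real (Suc N)"
      using st(1) by (intro always_eventually allI) (simp add: abs_minus_commute)
    show "(\<lambda>N. 1 / real (Suc N)) \<longlonglongrightarrow> 0" by (rule LIMSEQ_Suc[OF lim_1_over_n])
  qed
  then have "(\<lambda>N. t (r N) - s (r N)) \<longlonglongrightarrow> 0"
    using LIMSEQ_subseq_LIMSEQ[OF _ r(1), of "\<lambda>N. t N - s N" 0] by (simp add: comp_def)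
  then have "(\<lambda>N. ereal (t (r N) - s (r N))) \<longlonglongrightarrow> 0" by (simp add: zero_ereal_def)
  then have "(\<lambda>N. ereal (s (r N)) + ereal (t (r N) - s (r N))) \<longlonglongrightarrow> a + 0"
    using r(2) by (intro tendsto_add_ereal_general1) (auto simp: comp_def)
  then have ta: "(\<lambda>N. ereal (t (r N))) \<longlonglongrightarrow> a" by simp
  have cont: "(\<lambda>N. marginal_cdf i (u N)) \<longlonglongrightarrow> marginal_cdf i a" if "u \<longlonglongrightarrow> a" for u
    using marginal_cdf_continuous[of i] that by (intro continuous_on_tendsto_compose[of UNIV "marginal_cdf i"]) auto
  have "(\<lambda>N. \<bar>marginal_cdf i (ereal (s (r N))) - marginal_cdf i (ereal (t (r N)))\<bar>) \<longlonglongrightarrow> \<bar>marginal_cdf i a - marginal_cdf i a\<bar>"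
    using r(2) ta by (intro tendsto_intros cont) (simp_all add: comp_def)
  then have "e \<le> \<bar>marginal_cdf i a - marginal_cdf i a\<bar>" by (rule LIMSEQ_le_const) (use st(2) in auto)
  then show False using \<open>0 < e\<close> by simp
qed

end

section \<open>Measurability of Skorokhod continuous functionals of the empirical process\<close>

context empirical_setting
begin

text \<open>The process as a function of a deterministic sample, so that the sample can be rounded
  while the centring stays the same.\<close>

definition empirical_fun :: "nat \<Rightarrow> (nat \<Rightarrow> real^'d) \<Rightarrow> ereal^'d \<Rightarrow> real" where
  "empirical_fun n xs t = (1 / sqrt n) * (\<Sum>i=1..n. indicator {x. vle x t} (xs i) - mdf M (X 0) t)"

lemma empirical_process_empirical_fun: "empirical_process M X n \<omega> = empirical_fun n (\<lambda>i. X i \<omega>)"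
  by (simp add: fun_eq_iff empirical_process_def empirical_fun_def)

lemma empirical_fun_Dspace: "empirical_fun n xs \<in> Dspace"
proof -
  have "(\<lambda>t. (1 / sqrt n) * (\<Sum>i=1..n. indicator {x. vle x t} (xs i) + (-1) * mdf M (X 0) t)) \<in> Dspace"
    by (intro Dspace_scale Dspace_sum Dspace_add Dspace_indicator Dspace_continuous mdf_continuous) simp
  then show ?thesis by (simp add: empirical_fun_def[abs_def])
qed

definition grid_round :: "nat \<Rightarrow> real \<Rightarrow> real" where
  "grid_round m a = real_of_int \<lfloor>real (Suc m) * a\<rfloor> / real (Suc m)"

lemma grid_round_bounds: "grid_round m a \<le> a" "a - 1 / real (Suc m) \<le> grid_round m a"
proof -
  have 1: "real_of_int \<lfloor>real (Suc m) * a\<rfloor> \<le> real (Suc m) * a" "real (Suc m) * a - 1 \<le> real_of_int \<lfloor>real (Suc m) * a\<rfloor>"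
    by linarith+
  show "grid_round m a \<le> a" unfolding grid_round_def using 1(1) by (subst pos_divide_le_eq) (simp_all add: mult.commute)
  have "(a - 1 / real (Suc m)) * real (Suc m) = real (Suc m) * a - 1" by (simp add: field_simps)
  then show "a - 1 / real (Suc m) \<le> grid_round m a"
    unfolding grid_round_def using 1(2) by (subst pos_le_divide_eq) simp_all
qed

definition round_vec :: "nat \<Rightarrow> real^'d \<Rightarrow> real^'d" where
  "round_vec m x = (\<chi> i. grid_round m (x $ i))"

text \<open>For fine grids, rounding preserves the order of the sample coordinates, hence it is realised by
  a time change close to the identity.\<close>

lemma empirical_fun_round_close:
  assumes "0 < \<delta>"
  shows "\<forall>\<^sub>F m in sequentially. skorokhod_dist (empirical_fun n xs) (empirical_fun n (\<lambda>i. round_vec m (xs i))) < \<delta>"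
proof -
  define A where "A = (\<lambda>i. (\<lambda>k. xs k $ i) ` {1..n})"
  define D where "D = (\<Union>i. (\<lambda>(a, b). \<bar>a - b\<bar>) ` {(a, b). a \<in> A i \<and> b \<in> A i \<and> a \<noteq> b})"
  have finA: "finite (A i)" for i by (simp add: A_def)
  have "finite {(a, b). a \<in> A i \<and> b \<in> A i \<and> a \<noteq> b}" for i
    by (rule finite_subset[of _ "A i \<times> A i"]) (use finA in auto)
  then have finD: "finite D" unfolding D_def by auto
  \<comment> \<open>Smallest gap between distinct values of one coordinate in the sample; the 1
    covers the case that there is no such pair.\<close>
  define g where "g = Min (insert 1 D)"
  have g: "0 < g" unfolding g_def by (subst Min_gr_iff) (use finD in \<open>auto simp: D_def\<close>)
  have gap: "g \<le> \<bar>a - b\<bar>" if "a \<in> A i" "b \<in> A i" "a \<noteq> b" for a b i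
    unfolding g_def using finD that by (intro Min_le) (auto simp: D_def intro!: image_eqI[of _ _ "(a, b)"])
  \<comment> \<open>The time change moves the centring by at most sqrt n times d times e, which this
    choice keeps within \<delta>/2.\<close>
  define e where "e = \<delta> / (2 * (1 + sqrt n * real CARD('d)))"
  have den: "0 < 1 + sqrt n * real CARD('d)" by (simp add: add_pos_nonneg)
  have e: "0 < e" using \<open>0 < \<delta>\<close> den by (simp add: e_def)
  have ed: "sqrt n * real CARD('d) * e \<le> \<delta> / 2"
  proof -
    have "sqrt n * real CARD('d) * e \<le> (1 + sqrt n * real CARD('d)) * e" using e by simp
    also have "\<dots> = \<delta> / 2"
    proof -
      have "w * (\<delta> / (2 * w)) = \<delta> / 2" if "0 < w" for w using that by simp
      from this[OF den] show ?thesis unfolding e_def .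
    qed
    finally show ?thesis .
  qed
  have small: "\<forall>\<^sub>F m in sequentially. 1 / real (Suc m) < c" if "0 < c" for c
    using order_tendstoD(2)[OF LIMSEQ_Suc[OF lim_1_over_n] that] by simp
  have "\<forall>\<^sub>F m in sequentially. \<forall>i. \<forall>s t. \<bar>s - t\<bar> \<le> 1 / real (Suc m) \<longrightarrow> \<bar>marginal_cdf i (ereal s) - marginal_cdf i (ereal t)\<bar> < e"
    by (rule eventually_all_finite) (rule marginal_cdf_uniformly_continuous[OF e])
  moreover have "\<forall>\<^sub>F m in sequentially. 1 / real (Suc m) < g / 2" by (rule small) (use g in simp)
  moreover have "\<forall>\<^sub>F m in sequentially. 1 / real (Suc m) < \<delta> / 2" by (rule small) (use \<open>0 < \<delta>\<close> in simp)
  ultimately show ?thesis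
  proof eventually_elim
    case (elim m)
    have "\<exists>l. l \<in> time_changes \<and> (\<forall>a\<in>A i. l (ereal a) = ereal (grid_round m a)) \<and>
      (\<forall>s. \<exists>s'. l (ereal s) = ereal s' \<and> \<bar>s' - s\<bar> \<le> 1 / real (Suc m)) \<and> l \<infinity> = \<infinity> \<and> l (-\<infinity>) = -\<infinity>" for i
    proof (rule time_change_exists[of "A i" "1 / real (Suc m)" "\<lambda>a. grid_round m a - a"])
      show "\<bar>grid_round m a - a\<bar> \<le> 1 / real (Suc m)" for a
        using grid_round_bounds[where m = m and a = a] by (intro abs_leI) simp_all
      show "grid_round m a - a - (grid_round m b - b) \<le> \<bar>a - b\<bar> / 2" if "a \<in> A i" "b \<in> A i" for a b
      proof (cases "a = b")
        case False
        \<comment> \<open>Two roundings differ in displacement by at most 1/(m+1) < g/2, which gives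
          the slope 1/2 that the time change requires.\<close>
        have "g / 2 \<le> \<bar>a - b\<bar> / 2" using gap[OF that False] by simp
        then show ?thesis using elim(2) grid_round_bounds(1)[of m a] grid_round_bounds(2)[of b m] by linarith
      qed simp
    qed (use finA in auto)
    then obtain l where l: "\<And>i. l i \<in> time_changes" "\<And>i a. a \<in> A i \<Longrightarrow> l i (ereal a) = ereal (grid_round m a)"
      "\<And>i s. \<exists>s'. l i (ereal s) = ereal s' \<and> \<bar>s' - s\<bar> \<le> 1 / real (Suc m)" "\<And>i. l i \<infinity> = \<infinity>" "\<And>i. l i (-\<infinity>) = -\<infinity>"
      by metis
    have vle: "vle (round_vec m (xs k)) (\<chi> i. l i (t $ i)) \<longleftrightarrow> vle (xs k) t" if k: "k \<in> {1..n}" for k t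
    proof -
      have "ereal (grid_round m (xs k $ i)) \<le> l i (t $ i) \<longleftrightarrow> ereal (xs k $ i) \<le> t $ i" for i
      proof -
        have "xs k $ i \<in> A i" using k by (auto simp: A_def)
        then have "ereal (grid_round m (xs k $ i)) = l i (ereal (xs k $ i))" using l(2) by simp
        moreover have "strict_mono (l i)" using l(1)[of i] by (simp add: time_changes_def)
        ultimately show ?thesis by (simp add: strict_mono_less_eq)
      qed
      then show ?thesis by (simp add: vle_def round_vec_def)
    qed
    have near: "\<bar>marginal_cdf i s - marginal_cdf i (l i s)\<bar> \<le> e" for i s
    proof (cases s)
      case (real r)
      obtain s' where s': "l i (ereal r) = ereal s'" "\<bar>s' - r\<bar> \<le> 1 / real (Suc m)" using l(3) by blast
      then have "\<bar>r - s'\<bar> \<le> 1 / real (Suc m)" by (simp add: abs_minus_commute)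
      then have "\<bar>marginal_cdf i (ereal r) - marginal_cdf i (ereal s')\<bar> < e" using elim(1) by blast
      then show ?thesis using real s'(1) by simp
    qed (use l e in auto)
    have "skorokhod_dist (empirical_fun n xs) (empirical_fun n (\<lambda>i. round_vec m (xs i))) \<le> \<delta> / 2"
    proof (rule skorokhod_dist_le[OF l(1)])
      fix t :: "ereal^'d"
      let ?lt = "\<chi> i. l i (t $ i)"
      \<comment> \<open>The time change matches each sample point with its rounding, so the
        indicators cancel and only distribution functions remain.\<close>
      have "(\<Sum>i=1..n. indicator {x. vle x t} (xs i) - mdf M (X 0) t) - (\<Sum>i=1..n. indicator {x. vle x ?lt} (round_vec m (xs i)) - mdf M (X 0) ?lt)
        = (\<Sum>i=1..n. mdf M (X 0) ?lt - mdf M (X 0) t)"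
        unfolding sum_subtractf[symmetric] by (intro sum.cong refl) (simp add: indicator_def vle)
      then have "empirical_fun n xs t - empirical_fun n (\<lambda>i. round_vec m (xs i)) ?lt = (1 / sqrt n) * (real n * (mdf M (X 0) ?lt - mdf M (X 0) t))"
        unfolding empirical_fun_def right_diff_distrib[symmetric] by simp
      also have "\<dots> = sqrt n * (mdf M (X 0) ?lt - mdf M (X 0) t)"
      proof -
        have "(1 / sqrt n) * (real n * y) = (real n / sqrt n) * y" for y by simp
        also have "real n / sqrt n = sqrt n" by (simp add: real_div_sqrt)
        finally show ?thesis .
      qed
      finally have "\<bar>empirical_fun n xs t - empirical_fun n (\<lambda>i. round_vec m (xs i)) ?lt\<bar> = sqrt n * \<bar>mdf M (X 0) ?lt - mdf M (X 0) t\<bar>"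
        by (simp add: abs_mult)
      also have "\<dots> \<le> sqrt n * (\<Sum>i\<in>UNIV. \<bar>marginal_cdf i (?lt $ i) - marginal_cdf i (t $ i)\<bar>)"
        by (intro mult_left_mono abs_mdf_diff_le) simp
      also have "\<dots> \<le> sqrt n * (\<Sum>i\<in>(UNIV::'d set). e)"
      proof (rule mult_left_mono[OF sum_mono])
        fix i show "\<bar>marginal_cdf i (?lt $ i) - marginal_cdf i (t $ i)\<bar> \<le> e"
          using near[of i "t $ i"] by (subst abs_minus_commute) simp
      qed simp
      also have "\<dots> = sqrt n * real CARD('d) * e" by simp
      finally show "\<bar>empirical_fun n xs t - empirical_fun n (\<lambda>i. round_vec m (xs i)) ?lt\<bar> \<le> \<delta> / 2" using ed by linarith
    next
      fix i s
      show "\<bar>to_unit (l i s) - to_unit s\<bar> \<le> \<delta> / 2"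
      proof (cases s)
        case (real r)
        obtain s' where s': "l i (ereal r) = ereal s'" "\<bar>s' - r\<bar> \<le> 1 / real (Suc m)" using l(3) by blast
        then show ?thesis using to_unit_lipschitz[of s' r] elim(3) real by simp
      qed (use l \<open>0 < \<delta>\<close> in auto)
    qed
    then show ?case using \<open>0 < \<delta>\<close> by simp
  qed
qed

text \<open>Up to scaling, a rounded sample is a list of integer vectors. There are countably many,
  so every function of it is measurable.\<close>

lemma empirical_fun_round_measurable: "(\<lambda>\<omega>. h (empirical_fun n (\<lambda>i. round_vec m (X i \<omega>)))) \<in> borel_measurable M"
proof -
  define g :: "'a \<Rightarrow> (int^'d) list" where "g = (\<lambda>\<omega>. map (\<lambda>i. \<chi> j. \<lfloor>real (Suc m) * X i \<omega> $ j\<rfloor>) [1..<Suc n])"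
  define dec where "dec = (\<lambda>L::(int^'d) list. h (empirical_fun n (\<lambda>i. \<chi> j. real_of_int (L ! (i - 1) $ j) / real (Suc m))))"
  have [measurable]: "(\<lambda>\<omega>. X i \<omega> $ j) \<in> borel_measurable M" for i j
  proof -
    have "(\<lambda>x::real^'d. x $ j) \<in> borel_measurable borel"
      by (intro borel_measurable_continuous_onI continuous_on_component continuous_on_id)
    then show ?thesis by (rule measurable_compose[OF X_measurable])
  qed
  have len: "length (g \<omega>) = n" for \<omega> by (simp add: g_def del: upt_Suc)
  have nth: "g \<omega> ! i = (\<chi> j. \<lfloor>real (Suc m) * X (Suc i) \<omega> $ j\<rfloor>)" if "i < n" for \<omega> i
    using that by (simp add: g_def del: upt_Suc of_nat_Suc)
  have "g \<in> measurable M (count_space UNIV)"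
  proof (subst measurable_count_space_eq_countable)
    show "countable (UNIV :: (int^'d) list set)" by simp
    have "g -` {L} \<inter> space M \<in> sets M" for L
    proof (cases "length L = n")
      case True
      have "g -` {L} \<inter> space M = {\<omega> \<in> space M. \<forall>i\<in>{0..<n}. \<forall>j. \<lfloor>real (Suc m) * X (Suc i) \<omega> $ j\<rfloor> = L ! i $ j}"
      proof -
        have "g \<omega> = L \<longleftrightarrow> (\<forall>i\<in>{0..<n}. \<forall>j. \<lfloor>real (Suc m) * X (Suc i) \<omega> $ j\<rfloor> = L ! i $ j)" for \<omega>
          unfolding list_eq_iff_nth_eq len True vec_eq_iff using nth by (simp del: of_nat_Suc add: Ball_def)
        then show ?thesis by blast
      qed
      also have "\<dots> \<in> sets M" by measurable
      finally show ?thesis .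
    next
      case False
      then have "g -` {L} \<inter> space M = {}" using len by auto
      then show ?thesis by simp
    qed
    then show "g \<in> space M \<rightarrow> UNIV \<and> (\<forall>a\<in>UNIV. g -` {a} \<inter> space M \<in> sets M)" by simp
  qed
  then have "(\<lambda>\<omega>. dec (g \<omega>)) \<in> borel_measurable M" by (rule measurable_compose) simp
  moreover have "dec (g \<omega>) = h (empirical_fun n (\<lambda>i. round_vec m (X i \<omega>)))" for \<omega>
  proof -
    have "(\<chi> j. real_of_int (g \<omega> ! (i - 1) $ j) / real (Suc m)) = round_vec m (X i \<omega>)" if "i \<in> {1..n}" for i
    proof -
      have "g \<omega> ! (i - 1) = (\<chi> j. \<lfloor>real (Suc m) * X i \<omega> $ j\<rfloor>)"
      proof -
        have i: "i - 1 < n" "Suc (i - 1) = i" using that by auto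
        show ?thesis using nth[OF i(1), of \<omega>] unfolding i(2) .
      qed
      then show ?thesis by (simp add: round_vec_def grid_round_def del: of_nat_Suc)
    qed
    then have "empirical_fun n (\<lambda>i. \<chi> j. real_of_int (g \<omega> ! (i - 1) $ j) / real (Suc m)) = empirical_fun n (\<lambda>i. round_vec m (X i \<omega>))"
      unfolding empirical_fun_def fun_eq_iff by (intro allI arg_cong2[where f = "(*)"] refl sum.cong) simp
    then show ?thesis by (simp add: dec_def)
  qed
  ultimately show ?thesis by simp
qed

text \<open>A pointwise limit of functionals of rounded samples. Rounding displaces jumps, which may
  be a large change in the uniform distance but is a small one in the Skorokhod distance.\<close>

lemma empirical_process_measurable:
  assumes "D_continuous h"
  shows "(\<lambda>\<omega>. h (empirical_process M X n \<omega>)) \<in> borel_measurable M"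
proof (rule borel_measurable_LIMSEQ_metric)
  show "(\<lambda>\<omega>. h (empirical_fun n (\<lambda>i. round_vec m (X i \<omega>)))) \<in> borel_measurable M" for m by (rule empirical_fun_round_measurable)
  fix \<omega>
  show "(\<lambda>m. h (empirical_fun n (\<lambda>i. round_vec m (X i \<omega>)))) \<longlonglongrightarrow> h (empirical_process M X n \<omega>)"
  proof (rule tendstoI)
    fix e :: real assume "0 < e"
    then obtain \<delta> where \<delta>: "0 < \<delta>" "\<And>y. y \<in> Dspace \<Longrightarrow> skorokhod_dist (empirical_fun n (\<lambda>i. X i \<omega>)) y < \<delta> \<Longrightarrow> \<bar>h y - h (empirical_fun n (\<lambda>i. X i \<omega>))\<bar> < e"
      using assms empirical_fun_Dspace unfolding D_continuous_def by meson
    from empirical_fun_round_close[OF \<delta>(1), of n "\<lambda>i. X i \<omega>"]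
    show "\<forall>\<^sub>F m in sequentially. dist (h (empirical_fun n (\<lambda>i. round_vec m (X i \<omega>)))) (h (empirical_process M X n \<omega>)) < e"
      by eventually_elim (simp add: dist_real_def empirical_process_empirical_fun \<delta>(2) empirical_fun_Dspace)
  qed
qed

end

section \<open>Chaining\<close>

lemma geometric_tail:
  assumes "0 \<le> x" "x < 1"
  shows "(\<Sum>l\<in>{k..<K}. x ^ l) \<le> x ^ k / (1 - x :: real)"
proof (cases "k \<le> K")
  case True
  have "(1 - x) * (\<Sum>l\<in>{k..<K}. x ^ l) = x ^ k - x ^ K"
    using True
  proof (induction K rule: dec_induct)
    case (step n)
    have "(1 - x) * (\<Sum>l\<in>{k..<Suc n}. x ^ l) = (1 - x) * (\<Sum>l\<in>{k..<n}. x ^ l) + (1 - x) * x ^ n"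
      using step.hyps by (simp add: distrib_left)
    then show ?case unfolding step.IH by (simp add: left_diff_distrib)
  qed simp
  also have "\<dots> \<le> x ^ k" using assms by simp
  finally show ?thesis using assms by (simp add: pos_le_divide_eq mult.commute)
next
  case False
  then show ?thesis using assms by simp
qed

context empirical_setting
begin

text \<open>The thresholds use up half of the decay: the 2p-th power of \<rho>^l is 2^(-\<beta>
  l/2). The other half remains as \<sigma>^l, so that both the thresholds and the probabilities are
  summable.\<close>

lemma prob_bad_geometric:
  "\<exists>A l0 \<rho> \<sigma>. 0 < A \<and> 0 < \<rho> \<and> \<rho> < 1 \<and> 0 < \<sigma> \<and> \<sigma> < 1 \<and>
    (\<forall>l n c. l0 \<le> l \<longrightarrow> 1 \<le> n \<longrightarrow> 1 \<le> c \<longrightarrow> 4 ^ l \<le> c * real n \<longrightarrow> prob (bad n l (\<rho> ^ l)) \<le> A * c ^ p * \<sigma> ^ l)"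
proof -
  obtain A l0 \<beta> where A: "0 < A" and \<beta>: "0 < \<beta>" and b: "\<forall>l n c x. l0 \<le> l \<longrightarrow> 1 \<le> n \<longrightarrow> 1 \<le> c \<longrightarrow> 4 ^ l \<le> c * real n \<longrightarrow> 0 < x \<longrightarrow>
     prob (bad n l x) \<le> A * c ^ p * 2 powr (- \<beta> * real l) / x ^ (2 * p)"
    using prob_bad by (elim exE conjE) (rule that)
  define \<rho> where "\<rho> = 2 powr (- \<beta> / (4 * real p))"
  define \<sigma> where "\<sigma> = 2 powr (- \<beta> / 2)"
  have \<rho>: "0 < \<rho>" "\<rho> < 1" and \<sigma>: "0 < \<sigma>" "\<sigma> < 1"
    using \<beta> p_pos powr_less_cancel_iff[of 2 "- \<beta> / (4 * real p)" 0] powr_less_cancel_iff[of 2 "- \<beta> / 2" 0]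
    by (auto simp: \<rho>_def \<sigma>_def divide_neg_pos)
  have "prob (bad n l (\<rho> ^ l)) \<le> A * c ^ p * \<sigma> ^ l" if h: "l0 \<le> l" "1 \<le> n" "1 \<le> c" "4 ^ l \<le> c * real n" for l n c
  proof -
    have "(\<rho> ^ l) ^ (2 * p) = 2 powr (- \<beta> / 2 * real l)"
      unfolding \<rho>_def using p_pos by (simp add: powr_realpow[symmetric] powr_powr power_mult[symmetric])
    moreover have "\<sigma> ^ l = 2 powr (- \<beta> / 2 * real l)"
      unfolding \<sigma>_def by (simp add: powr_realpow[symmetric] powr_powr)
    moreover have "2 powr (- \<beta> * real l) / 2 powr (- \<beta> / 2 * real l) = (2 powr (- \<beta> / 2 * real l) :: real)"
      unfolding powr_diff[symmetric] by simp
    ultimately have e: "2 powr (- \<beta> * real l) / (\<rho> ^ l) ^ (2 * p) = \<sigma> ^ l" by simp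
    have "0 < \<rho> ^ l" using \<rho> by simp
    then have "prob (bad n l (\<rho> ^ l)) \<le> A * c ^ p * 2 powr (- \<beta> * real l) / (\<rho> ^ l) ^ (2 * p)"
      using b h by blast
    also have "\<dots> = A * c ^ p * (2 powr (- \<beta> * real l) / (\<rho> ^ l) ^ (2 * p))" by simp
    finally show ?thesis unfolding e .
  qed
  then show ?thesis using A \<rho> \<sigma> by blast
qed

lemma normalized_sum_sum:
  assumes "finite A" and g: "\<And>a. g a \<in> G" "\<And>a. bounded_fun (g a)"
  shows "(\<lambda>x. \<Sum>a\<in>A. c a * g a x) \<in> G \<and> bounded_fun (\<lambda>x. \<Sum>a\<in>A. c a * g a x) \<and>
    (\<forall>n \<omega>. normalized_sum n (\<lambda>x. \<Sum>a\<in>A. c a * g a x) \<omega> = (\<Sum>a\<in>A. c a * normalized_sum n (g a) \<omega>))"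
  using \<open>finite A\<close>
proof (induction rule: finite_induct)
  case empty
  have "normalized_sum n (\<lambda>x. 0) \<omega> = 0" for n \<omega> by (simp add: normalized_sum_def mean_const)
  then show ?case using G_const[of 0] by (auto intro: exI[of _ 0])
next
  case (insert a A)
  let ?F = "\<lambda>x. \<Sum>a\<in>A. c a * g a x"
  have F: "?F \<in> G" "bounded_fun ?F" using insert.IH by auto
  have ca: "(\<lambda>x. c a * g a x) \<in> G" by (rule G_scale[OF g(1)])
  obtain B where B: "\<And>x. \<bar>g a x\<bar> \<le> B" using g(2)[of a] by blast
  have "\<bar>c a * g a x\<bar> \<le> \<bar>c a\<bar> * B" for x using B[of x] by (simp add: abs_mult mult_left_mono)
  then have cb: "bounded_fun (\<lambda>x. c a * g a x)" by blast
  obtain B' where B': "\<And>x. \<bar>?F x\<bar> \<le> B'" using F(2) by blast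
  obtain B'' where B'': "\<And>x. \<bar>c a * g a x\<bar> \<le> B''" using cb by blast
  have "\<bar>c a * g a x + ?F x\<bar> \<le> B'' + B'" for x using B'[of x] B''[of x] by linarith
  then have bd: "bounded_fun (\<lambda>x. c a * g a x + ?F x)" by blast
  have "normalized_sum n (\<lambda>x. c a * g a x + ?F x) \<omega> = c a * normalized_sum n (g a) \<omega> + (\<Sum>a\<in>A. c a * normalized_sum n (g a) \<omega>)" for n \<omega>
    using normalized_sum_add[OF G_measurable[OF ca] cb G_measurable[OF F(1)] F(2), of n \<omega>] insert.IH by (simp add: normalized_sum_scale)
  then show ?case using G_add[OF ca F(1)] bd insert.hyps by simp
qed

text \<open>The grid indices are coded as natural numbers because the elimination that realises the
  kernel runs along an enumeration.\<close>

lemma limit_kernel: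
  "\<exists>K. psd_kernel K \<and> (\<forall>A c t. finite A \<longrightarrow>
     (\<lambda>n. char (distr M borel (\<lambda>\<omega>. \<Sum>m\<in>A. c m * grid_sum n (from_nat m) \<omega>)) t)
        \<longlonglongrightarrow> exp (- (t\<^sup>2 * (\<Sum>a\<in>A. \<Sum>b\<in>A. c a * c b * K a b)) / 2))"
proof (rule gaussian_limit_kernel)
  let ?g = "\<lambda>m::nat. phi (fst (from_nat m :: nat \<times> ('d \<Rightarrow> nat))) (snd (from_nat m :: nat \<times> ('d \<Rightarrow> nat)))"
  fix A :: "nat set" and c assume A: "finite A"
  let ?F = "\<lambda>x. \<Sum>m\<in>A. c m * ?g m x"
  have F: "?F \<in> G" "bounded_fun ?F" "\<And>n \<omega>. normalized_sum n ?F \<omega> = (\<Sum>m\<in>A. c m * grid_sum n (from_nat m) \<omega>)"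
    using normalized_sum_sum[OF A, of ?g c] phi_G phi_bounded by (auto simp: grid_sum_def)
  have eq: "(\<lambda>\<omega>. \<Sum>m\<in>A. c m * grid_sum n (from_nat m) \<omega>) = normalized_sum n ?F" for n using F(3) by (simp add: fun_eq_iff)
  show "\<exists>s\<ge>0. weak_conv_m (\<lambda>n. distr M borel (\<lambda>\<omega>. \<Sum>m\<in>A. c m * grid_sum n (from_nat m) \<omega>)) (normal_law s)"
    unfolding eq by (rule normalized_sum_clt[OF F(1,2)])
  obtain K where "\<And>n. (LINT \<omega>|M. normalized_sum n ?F \<omega> ^ 4) \<le> K" using normalized_sum_fourth_moment[OF F(1,2)] by blast
  then show "\<exists>K. \<forall>n. integrable M (\<lambda>\<omega>. (\<Sum>m\<in>A. c m * grid_sum n (from_nat m) \<omega>) ^ 4) \<and>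
       expectation (\<lambda>\<omega>. (\<Sum>m\<in>A. c m * grid_sum n (from_nat m) \<omega>) ^ 4) \<le> K"
    unfolding F(3)[symmetric] using normalized_sum_power_integrable[OF G_measurable[OF F(1)] F(2)] by blast
qed measurable

lemma grid_sum_tight:
  assumes "0 < e" shows "\<exists>K. \<forall>n. prob {\<omega> \<in> space M. K < \<bar>grid_sum n a \<omega>\<bar>} \<le> e"
proof -
  let ?f = "phi (fst a) (snd a)"
  obtain K0 where K0: "\<And>n. (LINT \<omega>|M. normalized_sum n ?f \<omega> ^ 4) \<le> K0"
    using normalized_sum_fourth_moment[OF phi_G phi_bounded] by blast
  define K where "K = max 1 (K0 / e)"
  have K: "1 \<le> K" "K0 / e \<le> K" by (auto simp: K_def)
  have K4: "K0 \<le> K ^ 4 * e"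
  proof -
    have "K0 \<le> K * e" using K(2) \<open>0 < e\<close> by (simp add: pos_divide_le_eq)
    also have "K * e \<le> K ^ 4 * e" using K(1) \<open>0 < e\<close> power_increasing[of 1 4 K] by (intro mult_right_mono) auto
    finally show ?thesis .
  qed
  have "prob {\<omega> \<in> space M. K < \<bar>grid_sum n a \<omega>\<bar>} \<le> e" for n
  proof -
    define E where "E = {\<omega> \<in> space M. K < \<bar>grid_sum n a \<omega>\<bar>}"
    have [measurable]: "E \<in> sets M" unfolding E_def by measurable
    have iE: "integrable M (indicator E :: 'a \<Rightarrow> real)" by (rule integrable_const_bound[of _ 1]) auto
    have "K ^ 4 * prob E = (LINT \<omega>|M. K ^ 4 * indicator E \<omega>)" by simp
    also have "\<dots> \<le> (LINT \<omega>|M. grid_sum n a \<omega> ^ 4)"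
    proof (rule integral_mono)
      show "integrable M (\<lambda>\<omega>. grid_sum n a \<omega> ^ 4)"
        unfolding grid_sum_def by (rule normalized_sum_power_integrable[OF phi_measurable phi_bounded])
      show "K ^ 4 * indicator E \<omega> \<le> grid_sum n a \<omega> ^ 4" for \<omega>
      proof (cases "\<omega> \<in> E")
        case True
        then have "K ^ 4 \<le> \<bar>grid_sum n a \<omega>\<bar> ^ 4" using K(1) by (intro power_mono) (auto simp: E_def)
        then show ?thesis using True by (simp add: power_even_abs)
      qed simp
    qed (use iE in auto)
    also have "\<dots> \<le> K0" using K0[of n] by (simp add: grid_sum_def)
    also have "\<dots> \<le> K ^ 4 * e" by (rule K4)
    finally have "prob E \<le> e" using K(1) by (simp add: mult_le_cancel_left)
    then show ?thesis by (simp add: E_def)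
  qed
  then show ?thesis by blast
qed

end

text \<open>Fixes the constants and the kernel whose existence has just been shown, so that the
  limit process can be defined from them.\<close>

locale empirical_chain = empirical_setting M X G normG \<Psi> C r p \<gamma> \<Phi>
  for M :: "'a measure" and X :: "nat \<Rightarrow> 'a \<Rightarrow> real^'d" and G normG \<Psi> C r p \<gamma> \<Phi> +
  fixes A :: real and l0 :: nat and \<rho> \<sigma> :: real and K :: "nat \<Rightarrow> nat \<Rightarrow> real"
  assumes A: "0 < A" and \<rho>: "0 < \<rho>" "\<rho> < 1" and \<sigma>: "0 < \<sigma>" "\<sigma> < 1"
    and bad_le: "\<And>l n c. l0 \<le> l \<Longrightarrow> 1 \<le> n \<Longrightarrow> 1 \<le> c \<Longrightarrow> 4 ^ l \<le> c * real n \<Longrightarrow> prob (bad n l (\<rho> ^ l)) \<le> A * c ^ p * \<sigma> ^ l"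
    and K_psd: "psd_kernel K"
    and K_char: "\<And>A c t. finite A \<Longrightarrow>
     (\<lambda>n. char (distr M borel (\<lambda>\<omega>. \<Sum>m\<in>A. c m * grid_sum n (from_nat m) \<omega>)) t)
        \<longlonglongrightarrow> exp (- (t\<^sup>2 * (\<Sum>a\<in>A. \<Sum>b\<in>A. c a * c b * K a b)) / 2)"
begin

lemma geometric_small:
  assumes "0 \<le> x" "x < 1" "0 < e" "0 \<le> c" shows "\<forall>\<^sub>F k in sequentially. c * (x ^ k / (1 - x)) < (e :: real)"
proof -
  have "(\<lambda>k. c * (x ^ k / (1 - x))) \<longlonglongrightarrow> c * (0 / (1 - x))"
    using assms by (intro tendsto_intros LIMSEQ_power_zero) auto
  from order_tendstoD(2)[OF this, of e] show ?thesis using assms(3) by simp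
qed

lemma level_exists:
  assumes "1 \<le> s" shows "\<exists>L. s \<le> 2 ^ L \<and> 2 ^ L \<le> 2 * (s :: real)"
proof -
  define L where "L = (LEAST L. s \<le> 2 ^ L)"
  have ex: "\<exists>L. s \<le> 2 ^ L" using real_arch_pow[of 2 s] by (auto intro: less_imp_le)
  then have 1: "s \<le> 2 ^ L" unfolding L_def by (rule LeastI_ex)
  have "2 ^ L \<le> 2 * s"
  proof (cases L)
    case 0
    then show ?thesis using assms by simp
  next
    case (Suc L')
    then have "\<not> s \<le> 2 ^ L'" using not_less_Least[of L' "\<lambda>L. s \<le> 2 ^ L"] by (simp add: L_def)
    then show ?thesis using Suc by simp
  qed
  then show ?thesis using 1 by blast
qed

text \<open>The chain runs from \<open>k\<close> to a level \<open>L\<close> with 2^L between s and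
  2 s for s = 15 d sqrt n / e: high enough for the bias 5 d sqrt n / 2^L to be at most e/3, low
  enough for the bound on \<open>bad\<close> to hold with one constant \<open>c\<close> throughout.
  The budget is e/3 for the bias, e/3 for two terms \<rho>^L and e/6 for the chain.\<close>

lemma tight:
  assumes e: "0 < e" and \<eta>: "0 < \<eta>"
  shows "\<forall>\<^sub>F k in sequentially. \<forall>\<^sub>F n in sequentially. \<exists>B\<in>sets M. prob B \<le> \<eta> \<and>
     (\<forall>\<omega>\<in>space M - B. \<forall>t. \<bar>empirical_process M X n \<omega> t - grid_sum n (k, grid_index k t) \<omega>\<bar> \<le> e)"
proof -
  define d where "d = real CARD('d)"
  have d: "1 \<le> d" by (simp add: d_def Suc_leI)
  \<comment> \<open>From 4^L <= (2 s)^2 = 900 d^2 n / e^2; the maximum secures c >= 1.\<close>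
  define c where "c = max 1 (900 * d\<^sup>2 / e\<^sup>2)"
  have c: "1 \<le> c" "900 * d\<^sup>2 / e\<^sup>2 \<le> c" by (auto simp: c_def)
  have "\<forall>\<^sub>F k in sequentially. 1 * (\<rho> ^ k / (1 - \<rho>)) < e / 6" by (rule geometric_small) (use \<rho> e in auto)
  moreover have "\<forall>\<^sub>F k in sequentially. (A * c ^ p) * (\<sigma> ^ k / (1 - \<sigma>)) < \<eta>"
    by (rule geometric_small) (use \<sigma> \<eta> A c in auto)
  ultimately show ?thesis using eventually_ge_at_top[of l0]
  proof eventually_elim
    case (elim k)
    have \<rho>k: "\<rho> ^ k \<le> \<rho> ^ k / (1 - \<rho>)" using \<rho> by (simp add: pos_le_divide_eq mult_left_le)
    have "(\<lambda>n. 15 * d * sqrt (real n) / e) = (\<lambda>n. (15 * d / e) * sqrt (real n))" by simp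
    moreover have "filterlim (\<lambda>n. (15 * d / e) * sqrt (real n)) at_top sequentially"
      using d e by (intro filterlim_tendsto_pos_mult_at_top[OF tendsto_const] filterlim_compose[OF sqrt_at_top filterlim_real_sequentially]) auto
    ultimately have "\<forall>\<^sub>F n in sequentially. 2 ^ k \<le> 15 * d * sqrt (real n) / e"
      by (simp add: filterlim_at_top)
    then show ?case using eventually_ge_at_top[of 1]
    proof eventually_elim
      case nn: (elim n)
      define s where "s = 15 * d * sqrt (real n) / e"
      have "(1::real) \<le> 2 ^ k" by simp
      then have s1: "1 \<le> s" using nn(1) unfolding s_def by linarith
      obtain L where L: "s \<le> 2 ^ L" "2 ^ L \<le> 2 * s" using level_exists[OF s1] by blast
      have kL: "k \<le> L"
      proof -
        have "(2::real) ^ k \<le> 2 ^ L" using nn(1) L(1) unfolding s_def by linarith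
        then show ?thesis by simp
      qed
      have 4: "4 ^ l \<le> c * real n" if "l \<le> L" for l
      proof -
        have "(4::real) ^ l \<le> 4 ^ L" using that by simp
        also have "\<dots> = (2 ^ L)\<^sup>2" by (simp add: power_mult[symmetric] power2_eq_square power_mult_distrib[symmetric])
        also have "\<dots> \<le> (2 * s)\<^sup>2" using L(2) by (intro power_mono) auto
        also have "\<dots> = 900 * d\<^sup>2 / e\<^sup>2 * real n" unfolding s_def by (simp add: power_mult_distrib power_divide)
        also have "\<dots> \<le> c * real n" using c by (intro mult_right_mono) auto
        finally show ?thesis .
      qed
      define B where "B = (\<Union>l\<in>{k..<Suc L}. bad n l (\<rho> ^ l))"
      have B: "B \<in> sets M" unfolding B_def by auto
      have "prob B \<le> (\<Sum>l\<in>{k..<Suc L}. prob (bad n l (\<rho> ^ l)))"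
        unfolding B_def by (rule finite_measure_subadditive_finite) auto
      also have "\<dots> \<le> (\<Sum>l\<in>{k..<Suc L}. A * c ^ p * \<sigma> ^ l)"
        by (rule sum_mono, rule bad_le) (use elim nn c 4 in auto)
      also have "\<dots> = A * c ^ p * (\<Sum>l\<in>{k..<Suc L}. \<sigma> ^ l)" by (simp only: sum_distrib_left)
      also have "\<dots> \<le> A * c ^ p * (\<sigma> ^ k / (1 - \<sigma>))"
        using A c \<sigma> by (intro mult_left_mono geometric_tail) auto
      finally have pB: "prob B \<le> \<eta>" using elim(2) by linarith
      have main: "\<bar>empirical_process M X n \<omega> t - grid_sum n (k, grid_index k t) \<omega>\<bar> \<le> e" if \<omega>: "\<omega> \<in> space M - B" for \<omega> t
      proof -
        have nb: "\<omega> \<notin> bad n l (\<rho> ^ l)" if "k \<le> l" "l \<le> L" for l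
          using \<omega> that by (auto simp: B_def less_Suc_eq_le)
        have lk: "\<bar>grid_sum n (fst ab) \<omega> - grid_sum n (snd ab) \<omega>\<bar> \<le> \<rho> ^ l" if "k \<le> l" "l \<le> L" "ab \<in> links l" for l ab
        proof -
          have "\<not> \<rho> ^ l \<le> \<bar>grid_sum n (fst ab) \<omega> - grid_sum n (snd ab) \<omega>\<bar>" using nb[OF that(1,2)] that(3) \<omega> unfolding bad_def by blast
          then show ?thesis by linarith
        qed
        have tp: "\<bar>grid_sum n (L, top_index L) \<omega>\<bar> \<le> \<rho> ^ L"
        proof -
          have "\<not> \<rho> ^ L \<le> \<bar>grid_sum n (L, top_index L) \<omega>\<bar>" using nb[OF kL order_refl] \<omega> unfolding bad_def by blast
          then show ?thesis by linarith
        qed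
        have "\<bar>grid_sum n (L, grid_index L t) \<omega> - grid_sum n (k, grid_index k t) \<omega>\<bar> \<le> (\<Sum>l\<in>{k..<L}. \<rho> ^ l)"
          by (rule chain[where Y = "\<lambda>a. grid_sum n a \<omega>", OF _ kL]) (use lk in auto)
        also have "\<dots> \<le> \<rho> ^ k / (1 - \<rho>)" using \<rho> by (intro geometric_tail) auto
        finally have 1: "\<bar>grid_sum n (L, grid_index L t) \<omega> - grid_sum n (k, grid_index k t) \<omega>\<bar> \<le> e / 6" using elim(1) by linarith
        have "\<rho> ^ L \<le> \<rho> ^ k" using \<rho> kL by (intro power_decreasing) auto
        then have \<rho>L: "\<rho> ^ L \<le> e / 6" using \<rho>k elim(1) by linarith
        have "\<bar>normalized_sum n (orthant t) \<omega> - grid_sum n (L, grid_index L t) \<omega>\<bar> \<le> 2 * \<rho> ^ L + 5 * real CARD('d) * sqrt n / 2 ^ L"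
          by (rule approximation_at_level[OF lk tp]) (use kL in auto)
        moreover have "5 * real CARD('d) * sqrt n / 2 ^ L \<le> e / 3"
        proof -
          have "15 * d * sqrt n \<le> 2 ^ L * e" using L(1) e unfolding s_def by (simp add: pos_divide_le_eq)
          then show ?thesis by (simp add: d_def pos_divide_le_eq field_simps)
        qed
        ultimately have "\<bar>normalized_sum n (orthant t) \<omega> - grid_sum n (L, grid_index L t) \<omega>\<bar> \<le> e / 3 + e / 3" using \<rho>L by linarith
        then show ?thesis using 1 e unfolding empirical_process_eq by linarith
      qed
      show ?case using B pB main by blast
    qed
  qed
qed

definition Z :: "nat \<times> ('d \<Rightarrow> nat) \<Rightarrow> (nat \<Rightarrow> real) \<Rightarrow> real" where
  "Z a = gaussian_family K (to_nat a)"

lemma Z_measurable [measurable]: "Z a \<in> borel_measurable gauss_seq"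
  unfolding Z_def by measurable

lemma limit_expectation:
  fixes H :: "(nat \<Rightarrow> real) \<Rightarrow> real"
  assumes cont: "continuous_on UNIV H" and B: "\<And>x. \<bar>H x\<bar> \<le> B" and fin: "finite I"
    and dep: "\<And>x. H x = H (\<lambda>a. if a \<in> I then x a else 0)"
  shows "(\<lambda>n. LINT \<omega>|M. H (\<lambda>m. grid_sum n (from_nat m) \<omega>)) \<longlonglongrightarrow> (LINT w|gauss_seq. H (\<lambda>m. gaussian_family K m w))"
proof (rule integral_convergence_of_char[of M gauss_seq "\<lambda>n m. grid_sum n (from_nat m)" "gaussian_family K" H B I])
  show "prob_space M" "prob_space gauss_seq" by (rule prob_space_axioms) (rule gauss_seq.P.prob_space_axioms)
  show "(\<lambda>n. char (distr M borel (\<lambda>\<omega>. \<Sum>m\<in>A. c m * grid_sum n (from_nat m) \<omega>)) 1)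
      \<longlonglongrightarrow> char (distr gauss_seq borel (\<lambda>w. \<Sum>m\<in>A. c m * gaussian_family K m w)) 1" if "finite A" for A c
    unfolding char_gaussian_family[OF K_psd that] by (rule K_char[OF that])
  show "\<exists>K. \<forall>n. prob {\<omega> \<in> space M. K < \<bar>grid_sum n (from_nat a) \<omega>\<bar>} \<le> e" if "0 < e" for a e
    by (rule grid_sum_tight[OF that])
  show "H x = H (\<lambda>a. if a \<in> I then x a else 0)" for x by (rule dep)
qed (use cont B fin in simp_all)

text \<open>Twice the threshold of \<open>bad\<close>, which leaves room for a continuous function
  between the two indicators.\<close>

definition limit_bad :: "nat \<Rightarrow> (nat \<Rightarrow> real) set" where
  "limit_bad l = (\<Union>ab\<in>links l. {w \<in> space gauss_seq. 2 * \<rho> ^ l \<le> \<bar>Z (fst ab) w - Z (snd ab) w\<bar>})"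

lemma limit_bad_sets [measurable]: "limit_bad l \<in> sets gauss_seq"
  unfolding limit_bad_def using finite_links by (intro sets.finite_UN) auto

lemma prob_limit_bad:
  assumes l: "l0 \<le> l" shows "gauss_seq.P.prob (limit_bad l) \<le> A * \<sigma> ^ l"
proof -
  define x where "x = \<rho> ^ l"
  have x: "0 < x" using \<rho> by (simp add: x_def)
  \<comment> \<open>Continuous, equal to 1 once some increment reaches 2 x, and 0 when all are at
    most x; its expectation carries the bound on \<open>bad\<close> to the limit.\<close>
  define H where "H = (\<lambda>y::nat \<Rightarrow> real. min 1 (\<Sum>ab\<in>links l. max 0 (\<bar>y (to_nat (fst ab)) - y (to_nat (snd ab))\<bar> / x - 1)))"
  have H01: "0 \<le> H y" "H y \<le> 1" for y unfolding H_def by (auto intro: sum_nonneg)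
  define I where "I = (\<lambda>ab. to_nat (fst ab)) ` links l \<union> (\<lambda>ab. to_nat (snd ab)) ` links l"
  have cont: "continuous_on UNIV H"
    unfolding H_def by (intro continuous_intros continuous_on_product_coordinates) (use x in auto)
  have lim: "(\<lambda>n. LINT \<omega>|M. H (\<lambda>m. grid_sum n (from_nat m) \<omega>)) \<longlonglongrightarrow> (LINT w|gauss_seq. H (\<lambda>m. gaussian_family K m w))"
  proof (rule limit_expectation[OF cont, of 1 I])
    show "\<bar>H y\<bar> \<le> 1" for y using H01[of y] by simp
    show "finite I" using finite_links by (simp add: I_def)
    show "H y = H (\<lambda>a. if a \<in> I then y a else 0)" for y
      unfolding H_def by (intro arg_cong2[where f = min] refl sum.cong) (auto simp: I_def)
  qed
  have "gauss_seq.P.prob (limit_bad l) = (LINT w|gauss_seq. indicator (limit_bad l) w)" by simp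
  also have "\<dots> \<le> (LINT w|gauss_seq. H (\<lambda>m. gaussian_family K m w))"
  proof (rule integral_mono)
    show "integrable gauss_seq (\<lambda>w. H (\<lambda>m. gaussian_family K m w))"
    proof (rule gauss_seq.P.integrable_const_bound[of _ 1])
      show "(\<lambda>w. H (\<lambda>m. gaussian_family K m w)) \<in> borel_measurable gauss_seq" unfolding H_def by measurable
    qed (use H01 in auto)
    show "integrable gauss_seq (indicator (limit_bad l) :: _ \<Rightarrow> real)"
      by (rule gauss_seq.P.integrable_const_bound[of _ 1]) auto
    show "indicator (limit_bad l) w \<le> H (\<lambda>m. gaussian_family K m w)" for w
    proof (cases "w \<in> limit_bad l")
      case True
      then obtain ab where ab: "ab \<in> links l" "2 * x \<le> \<bar>Z (fst ab) w - Z (snd ab) w\<bar>"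
        unfolding limit_bad_def x_def by blast
      have "2 \<le> \<bar>Z (fst ab) w - Z (snd ab) w\<bar> / x" using ab(2) x by (simp add: pos_le_divide_eq)
      then have "1 \<le> max 0 (\<bar>Z (fst ab) w - Z (snd ab) w\<bar> / x - 1)" by simp
      also have "\<dots> \<le> (\<Sum>ab\<in>links l. max 0 (\<bar>Z (fst ab) w - Z (snd ab) w\<bar> / x - 1))"
        by (rule member_le_sum[OF ab(1)]) (use finite_links in auto)
      finally show ?thesis using True by (simp add: H_def Z_def)
    qed (use H01 in simp)
  qed
  also have "\<dots> \<le> A * \<sigma> ^ l"
  \<comment> \<open>As \<open>l\<close> is fixed, n >= 4^l eventually, and the bound holds with c =
    1.\<close>
  proof (rule LIMSEQ_le_const2[OF lim], intro exI[of _ "4 ^ l"] allI impI)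
    fix n :: nat assume n: "4 ^ l \<le> n"
    then have "real (4 ^ l) \<le> real n" by (rule of_nat_mono)
    then have n1: "4 ^ l \<le> 1 * real n" by simp
    have n2: "1 \<le> n" using n by (meson one_le_numeral one_le_power order_trans)
    have "(LINT \<omega>|M. H (\<lambda>m. grid_sum n (from_nat m) \<omega>)) \<le> (LINT \<omega>|M. indicator (bad n l x) \<omega>)"
    proof (rule integral_mono)
      show "integrable M (\<lambda>\<omega>. H (\<lambda>m. grid_sum n (from_nat m) \<omega>))"
      proof (rule integrable_const_bound[of _ 1])
        show "(\<lambda>\<omega>. H (\<lambda>m. grid_sum n (from_nat m) \<omega>)) \<in> borel_measurable M" unfolding H_def by measurable
      qed (use H01 in auto)
      show "integrable M (indicator (bad n l x) :: _ \<Rightarrow> real)" by (rule integrable_const_bound[of _ 1]) auto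
      fix \<omega> assume \<omega>: "\<omega> \<in> space M"
      show "H (\<lambda>m. grid_sum n (from_nat m) \<omega>) \<le> indicator (bad n l x) \<omega>"
      proof (cases "\<omega> \<in> bad n l x")
        case False
        then have "\<bar>grid_sum n (fst ab) \<omega> - grid_sum n (snd ab) \<omega>\<bar> < x" if "ab \<in> links l" for ab
          using that \<omega> unfolding bad_def by (auto simp: not_le)
        then have "\<bar>grid_sum n (fst ab) \<omega> - grid_sum n (snd ab) \<omega>\<bar> / x \<le> 1" if "ab \<in> links l" for ab
          using that x by (simp add: pos_divide_le_eq less_imp_le)
        then have "(\<Sum>ab\<in>links l. max 0 (\<bar>grid_sum n (fst ab) \<omega> - grid_sum n (snd ab) \<omega>\<bar> / x - 1)) = 0"
          by (intro sum.neutral) auto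
        then show ?thesis using False by (simp add: H_def)
      qed (use H01 in simp)
    qed
    also have "\<dots> = prob (bad n l (\<rho> ^ l))" by (simp add: x_def)
    also have "\<dots> \<le> A * 1 ^ p * \<sigma> ^ l" by (rule bad_le[OF l n2 _ n1]) simp
    finally show "(LINT \<omega>|M. H (\<lambda>m. grid_sum n (from_nat m) \<omega>)) \<le> A * \<sigma> ^ l" by simp
  qed
  finally show ?thesis .
qed

end

section \<open>The limit process\<close>

text \<open>\<open>e\<close> is any bound for the uniform distance instead of a supremum, which
  might not exist; \<open>x\<close> itself may lie outside \<open>Dspace\<close>.\<close>

definition majorants :: "((ereal^'d \<Rightarrow> real) \<Rightarrow> real) \<Rightarrow> real \<Rightarrow> (ereal^'d \<Rightarrow> real) \<Rightarrow> real set" where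
  "majorants h m x = {h y + m * e | y e. y \<in> Dspace \<and> 0 \<le> e \<and> (\<forall>t. \<bar>x t - y t\<bar> \<le> e)}"

text \<open>The largest minorant of \<open>h\<close> that is \<open>m\<close>-Lipschitz for the uniform distance.\<close>

definition envelope :: "real \<Rightarrow> ((ereal^'d \<Rightarrow> real) \<Rightarrow> real) \<Rightarrow> real \<Rightarrow> (ereal^'d \<Rightarrow> real) \<Rightarrow> real" where
  "envelope B h m x = min B (Inf (majorants h m x))"

lemma majorants_memI: "y \<in> Dspace \<Longrightarrow> 0 \<le> e \<Longrightarrow> (\<And>t. \<bar>x t - y t\<bar> \<le> e) \<Longrightarrow> h y + m * e \<in> majorants h m x"
  unfolding majorants_def by blast

lemma majorants_memE:
  assumes "a \<in> majorants h m x"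
  obtains y e where "a = h y + m * e" "y \<in> Dspace" "0 \<le> e" "\<And>t. \<bar>x t - y t\<bar> \<le> e"
  using assms unfolding majorants_def by blast

lemma majorants_nonempty_D:
  assumes "x \<in> Dspace" shows "majorants h m x \<noteq> {}"
proof -
  have "h x + m * 0 \<in> majorants h m x" using assms by (intro majorants_memI) auto
  then show ?thesis by (rule ex_in_conv[THEN iffD1, OF exI])
qed

text \<open>The zero function is a competitor for every bounded function. This lets the envelope act
  on grid step functions without any check that they are cadlag.\<close>

lemma majorants_nonempty_bounded:
  assumes "\<And>t. \<bar>x t\<bar> \<le> c" shows "majorants h m x \<noteq> {}"
proof -
  have "0 \<le> c" using assms[of undefined] by linarith
  moreover have "(\<lambda>_. 0) \<in> Dspace" by (rule Dspace_continuous) simp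
  ultimately have "h (\<lambda>_. 0) + m * c \<in> majorants h m x" using assms by (intro majorants_memI) auto
  then show ?thesis by (rule ex_in_conv[THEN iffD1, OF exI])
qed

context
  fixes h :: "(ereal^'d \<Rightarrow> real) \<Rightarrow> real" and B :: real
  assumes hB: "\<And>y. y \<in> Dspace \<Longrightarrow> \<bar>h y\<bar> \<le> B"
begin

lemma majorants_ge: "0 \<le> m \<Longrightarrow> a \<in> majorants h m x \<Longrightarrow> - B \<le> a"
proof (elim majorants_memE)
  fix y e assume "0 \<le> m" "a = h y + m * e" "y \<in> Dspace" "0 \<le> e"
  moreover from this have "0 \<le> m * e" by simp
  ultimately show "- B \<le> a" using hB[of y] by linarith
qed

lemma bdd_below_majorants: "0 \<le> m \<Longrightarrow> bdd_below (majorants h m x)"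
  by (rule bdd_belowI[of _ "- B"]) (rule majorants_ge)

lemma envelope_bounds:
  assumes "0 \<le> m" "majorants h m x \<noteq> {}" shows "\<bar>envelope B h m x\<bar> \<le> B"
proof -
  have "- B \<le> Inf (majorants h m x)" using assms by (intro cInf_greatest majorants_ge)
  moreover have "0 \<le> B" using hB[OF Dspace_continuous[of "\<lambda>_. 0"]] by (auto intro: order_trans[OF abs_ge_zero])
  ultimately show ?thesis unfolding envelope_def by (intro abs_leI) auto
qed

lemma envelope_le:
  assumes "0 \<le> m" "x \<in> Dspace" shows "envelope B h m x \<le> h x"
proof -
  have "h x + m * 0 \<in> majorants h m x" using assms by (intro majorants_memI) auto
  then have "Inf (majorants h m x) \<le> h x + m * 0" by (rule cInf_lower[OF _ bdd_below_majorants[OF assms(1)]])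
  then show ?thesis by (simp add: envelope_def)
qed

text \<open>A competitor at distance e from x' is one at distance e + \<delta> from x, by the
  triangle inequality.\<close>

lemma envelope_lipschitz:
  assumes m: "0 \<le> m" and ne: "majorants h m x' \<noteq> {}" and d: "\<And>t. \<bar>x t - x' t\<bar> \<le> \<delta>"
  shows "envelope B h m x \<le> envelope B h m x' + m * \<delta>"
proof -
  have \<delta>: "0 \<le> \<delta>" using d[of undefined] by linarith
  have "Inf (majorants h m x) - m * \<delta> \<le> a" if a: "a \<in> majorants h m x'" for a
  proof -
    obtain y e where y: "a = h y + m * e" "y \<in> Dspace" "0 \<le> e" "\<And>t. \<bar>x' t - y t\<bar> \<le> e" using a by (rule majorants_memE) blast
    have "\<bar>x t - y t\<bar> \<le> e + \<delta>" for t using y(4)[of t] d[of t] by linarith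
    then have "h y + m * (e + \<delta>) \<in> majorants h m x" using y \<delta> by (intro majorants_memI) auto
    then have "Inf (majorants h m x) \<le> h y + m * (e + \<delta>)" by (rule cInf_lower[OF _ bdd_below_majorants[OF m]])
    then show ?thesis using y(1) by (simp add: algebra_simps)
  qed
  then have "Inf (majorants h m x) - m * \<delta> \<le> Inf (majorants h m x')" by (intro cInf_greatest ne)
  moreover have "0 \<le> m * \<delta>" using m \<delta> by simp
  ultimately show ?thesis unfolding envelope_def by linarith
qed

text \<open>Competitors within \<delta> of x have nearly the value h x by continuity; those farther
  away pay a penalty of at least m \<delta> >= 4 B, which compensates for any drop of
  \<open>h\<close>.\<close>

lemma envelope_convergence:
  assumes h: "D_continuous h" and x: "x \<in> Dspace"
  shows "(\<lambda>m. envelope B h (real m) x) \<longlonglongrightarrow> h x"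
proof (rule LIMSEQ_I)
  fix e :: real assume e: "0 < e"
  obtain \<delta> where \<delta>: "0 < \<delta>" "\<And>y. y \<in> Dspace \<Longrightarrow> skorokhod_dist x y < \<delta> \<Longrightarrow> \<bar>h y - h x\<bar> < e / 2"
    using h x e unfolding D_continuous_def by (meson half_gt_zero)
  have B0: "0 \<le> B" using hB[OF x] by linarith
  obtain N :: nat where N: "4 * B / \<delta> \<le> real N" using real_arch_simple by blast
  have "norm (envelope B h (real m) x - h x) < e" if m: "N \<le> m" for m
  proof -
    have m4: "4 * B / \<delta> \<le> real m" using N m by (meson of_nat_mono order_trans)
    have "h x - e / 2 \<le> a" if a: "a \<in> majorants h (real m) x" for a
    proof -
      obtain y c where y: "a = h y + real m * c" "y \<in> Dspace" "0 \<le> c" "\<And>t. \<bar>x t - y t\<bar> \<le> c" using a by (rule majorants_memE) blast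
      show ?thesis
      proof (cases "c < \<delta>")
        case True
        have "skorokhod_dist x y \<le> c" by (rule skorokhod_dist_le_uniform[OF y(4)])
        then have "\<bar>h y - h x\<bar> < e / 2" using True y(2) by (intro \<delta>(2)) auto
        moreover have "0 \<le> real m * c" using y(3) by simp
        ultimately show ?thesis using y(1) by linarith
      next
        case False
        have "4 * B \<le> real m * \<delta>" using m4 \<delta>(1) by (simp add: pos_divide_le_eq)
        also have "\<dots> \<le> real m * c" using False by (intro mult_left_mono) auto
        finally show ?thesis using y(1) hB[OF y(2)] hB[OF x] e B0 by linarith
      qed
    qed
    then have "h x - e / 2 \<le> Inf (majorants h (real m) x)" by (intro cInf_greatest majorants_nonempty_D[OF x])
    then have "h x - e / 2 \<le> envelope B h (real m) x" unfolding envelope_def using hB[OF x] e by auto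
    moreover have "envelope B h (real m) x \<le> h x" by (rule envelope_le[OF _ x]) simp
    ultimately show ?thesis using e by simp
  qed
  then show "\<exists>N. \<forall>m\<ge>N. norm (envelope B h (real m) x - h x) < e" by blast
qed

end

section \<open>Paths of the limit process\<close>

context empirical_chain
begin

definition good :: "(nat \<Rightarrow> real) set" where
  "good = {w \<in> space gauss_seq. \<exists>L. \<forall>l. L \<le> l \<longrightarrow> w \<notin> limit_bad l}"

text \<open>Set to 0 off the almost sure event, so that every path is continuous and no null set has
  to be carried along.\<close>

definition W :: "(nat \<Rightarrow> real) \<Rightarrow> ereal^'d \<Rightarrow> real" where
  "W w t = (if w \<in> good then lim (\<lambda>k. Z (k, grid_index k t) w) else 0)"

lemma good_sets [measurable]: "good \<in> sets gauss_seq"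
proof -
  have "good = (\<Union>L. \<Inter>l\<in>{L..}. space gauss_seq - limit_bad l)" by (auto simp: good_def)
  also have "\<dots> \<in> sets gauss_seq" by (intro sets.countable_UN sets.countable_INT) auto
  finally show ?thesis .
qed

text \<open>Borel-Cantelli, from the geometric bound in \<open>prob_limit_bad\<close>.\<close>

lemma AE_good: "AE w in gauss_seq. w \<in> good"
proof -
  have "AE w in gauss_seq. \<forall>\<^sub>F n in sequentially. w \<in> space gauss_seq - limit_bad (l0 + n)"
  proof (rule borel_cantelli_AE1)
    show "summable (\<lambda>n. gauss_seq.P.prob (limit_bad (l0 + n)))"
    proof (rule summable_comparison_test')
      show "summable (\<lambda>n. A * \<sigma> ^ l0 * \<sigma> ^ n)" using \<sigma> by (intro summable_mult summable_geometric) auto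
      show "norm (gauss_seq.P.prob (limit_bad (l0 + n))) \<le> A * \<sigma> ^ l0 * \<sigma> ^ n" if "0 \<le> n" for n
        using prob_limit_bad[of "l0 + n"] by (simp add: power_add mult_ac)
    qed
  qed (auto simp: gauss_seq.P.emeasure_finite less_top[symmetric])
  then show ?thesis
  proof (rule AE_mp, intro AE_I2 impI)
    fix w assume w: "w \<in> space gauss_seq" "\<forall>\<^sub>F n in sequentially. w \<in> space gauss_seq - limit_bad (l0 + n)"
    then obtain N where N: "\<And>n. N \<le> n \<Longrightarrow> w \<notin> limit_bad (l0 + n)" by (auto simp: eventually_sequentially)
    have "w \<notin> limit_bad l" if "l0 + N \<le> l" for l using N[of "l - l0"] that by auto
    then show "w \<in> good" using w(1) by (auto simp: good_def)
  qed
qed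

lemma good_links:
  assumes "w \<in> good"
  shows "\<exists>L. \<forall>l ab. L \<le> l \<longrightarrow> ab \<in> links l \<longrightarrow> \<bar>Z (fst ab) w - Z (snd ab) w\<bar> \<le> 2 * \<rho> ^ l"
proof -
  obtain L where L: "\<And>l. L \<le> l \<Longrightarrow> w \<notin> limit_bad l" and w: "w \<in> space gauss_seq" using assms by (auto simp: good_def)
  have "\<bar>Z (fst ab) w - Z (snd ab) w\<bar> \<le> 2 * \<rho> ^ l" if "L \<le> l" "ab \<in> links l" for l ab
  proof -
    have "\<not> 2 * \<rho> ^ l \<le> \<bar>Z (fst ab) w - Z (snd ab) w\<bar>" using L[OF that(1)] that(2) w unfolding limit_bad_def by blast
    then show ?thesis by linarith
  qed
  then show ?thesis by (intro exI[of _ L] allI impI)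
qed

text \<open>The chain bounds increments uniformly in t, so the step functions are uniformly Cauchy;
  only the starting level depends on \<open>w\<close>.\<close>

lemma W_approximation:
  assumes w: "w \<in> good"
  shows "\<exists>L. \<forall>k t. L \<le> k \<longrightarrow> \<bar>W w t - Z (k, grid_index k t) w\<bar> \<le> 2 * (\<rho> ^ k / (1 - \<rho>))"
    and "(\<lambda>k. Z (k, grid_index k t) w) \<longlonglongrightarrow> W w t"
proof -
  obtain L where "\<forall>l ab. L \<le> l \<longrightarrow> ab \<in> links l \<longrightarrow> \<bar>Z (fst ab) w - Z (snd ab) w\<bar> \<le> 2 * \<rho> ^ l"
    using good_links[OF w] by (rule exE)
  note L = this[rule_format]
  have ch: "\<bar>Z (k', grid_index k' t) w - Z (k, grid_index k t) w\<bar> \<le> 2 * (\<rho> ^ k / (1 - \<rho>))" if k: "L \<le> k" "k \<le> k'" for k k' t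
  proof -
    have "\<bar>Z (k', grid_index k' t) w - Z (k, grid_index k t) w\<bar> \<le> (\<Sum>l\<in>{k..<k'}. 2 * \<rho> ^ l)"
      by (rule chain[where Y = "\<lambda>a. Z a w", OF _ k(2)]) (use L k in auto)
    also have "\<dots> = 2 * (\<Sum>l\<in>{k..<k'}. \<rho> ^ l)" by (simp only: sum_distrib_left)
    also have "\<dots> \<le> 2 * (\<rho> ^ k / (1 - \<rho>))" using \<rho> by (intro mult_left_mono geometric_tail) auto
    finally show ?thesis .
  qed
  have conv: "(\<lambda>k. Z (k, grid_index k t) w) \<longlonglongrightarrow> W w t" for t
  proof -
    have "Cauchy (\<lambda>k. Z (k, grid_index k t) w)"
    proof (rule metric_CauchyI)
      fix e :: real assume "0 < e"
      then have "\<forall>\<^sub>F k in sequentially. 2 * (\<rho> ^ k / (1 - \<rho>)) < e / 2"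
        by (intro geometric_small) (use \<rho> in auto)
      then have "\<forall>\<^sub>F k in sequentially. L \<le> k \<and> 2 * (\<rho> ^ k / (1 - \<rho>)) < e / 2"
        using eventually_ge_at_top[of L] by eventually_elim auto
      then obtain k where k: "L \<le> k" "2 * (\<rho> ^ k / (1 - \<rho>)) < e / 2" by (auto simp: eventually_sequentially)
      have "dist (Z (m, grid_index m t) w) (Z (n, grid_index n t) w) < e" if "k \<le> m" "k \<le> n" for m n
        using ch[OF k(1) that(1), of t] ch[OF k(1) that(2), of t] k(2) unfolding dist_real_def by linarith
      then show "\<exists>k. \<forall>m\<ge>k. \<forall>n\<ge>k. dist (Z (m, grid_index m t) w) (Z (n, grid_index n t) w) < e" by blast
    qed
    then have "convergent (\<lambda>k. Z (k, grid_index k t) w)" by (rule Cauchy_convergent)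
    then show ?thesis using w by (simp add: W_def convergent_LIMSEQ_iff)
  qed
  have "\<bar>W w t - Z (k, grid_index k t) w\<bar> \<le> 2 * (\<rho> ^ k / (1 - \<rho>))" if "L \<le> k" for k t
  proof (rule LIMSEQ_le_const2)
    show "(\<lambda>k'. \<bar>Z (k', grid_index k' t) w - Z (k, grid_index k t) w\<bar>) \<longlonglongrightarrow> \<bar>W w t - Z (k, grid_index k t) w\<bar>" by (intro tendsto_intros conv)
    show "\<exists>N. \<forall>n\<ge>N. \<bar>Z (n, grid_index n t) w - Z (k, grid_index k t) w\<bar> \<le> 2 * (\<rho> ^ k / (1 - \<rho>))" using ch[OF that] by blast
  qed
  then show "\<exists>L. \<forall>k t. L \<le> k \<longrightarrow> \<bar>W w t - Z (k, grid_index k t) w\<bar> \<le> 2 * (\<rho> ^ k / (1 - \<rho>))"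
    by (intro exI[of _ L] allI impI)
  show "(\<lambda>k. Z (k, grid_index k t) w) \<longlonglongrightarrow> W w t" by (rule conv)
qed

lemma W_measurable [measurable]: "(\<lambda>w. W w t) \<in> borel_measurable gauss_seq"
  unfolding W_def by (intro measurable_If borel_measurable_lim_metric) (auto intro: pred_sets2)

text \<open>Points whose marginal values differ by less than 2^(-k) have grid indices joined by a
  neighbour link. Locally the step function of level k varies by at most 2 \<rho>^k, and it is
  uniformly close to the path.\<close>

lemma W_continuous: "continuous_on UNIV (W w)"
proof (cases "w \<in> good")
  case False
  then have "W w = (\<lambda>t. 0)" by (simp add: W_def fun_eq_iff)
  then show ?thesis by simp
next
  case True
  obtain L1 where "\<forall>l ab. L1 \<le> l \<longrightarrow> ab \<in> links l \<longrightarrow> \<bar>Z (fst ab) w - Z (snd ab) w\<bar> \<le> 2 * \<rho> ^ l"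
    using good_links[OF True] by (rule exE)
  note L1 = this[rule_format]
  obtain L2 where "\<forall>k t. L2 \<le> k \<longrightarrow> \<bar>W w t - Z (k, grid_index k t) w\<bar> \<le> 2 * (\<rho> ^ k / (1 - \<rho>))"
    using W_approximation(1)[OF True] by (rule exE)
  note L2 = this[rule_format]
  show ?thesis unfolding continuous_on_def
  proof (intro ballI tendstoI)
    fix t :: "ereal^'d" and e :: real assume e: "0 < e"
    have "\<forall>\<^sub>F k in sequentially. 2 * (\<rho> ^ k / (1 - \<rho>)) < e / 3" by (intro geometric_small) (use \<rho> e in auto)
    then have "\<forall>\<^sub>F k in sequentially. L1 \<le> k \<and> L2 \<le> k \<and> 2 * (\<rho> ^ k / (1 - \<rho>)) < e / 3"
      using eventually_ge_at_top[of L1] eventually_ge_at_top[of L2] by eventually_elim auto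
    then obtain k where k: "L1 \<le> k" "L2 \<le> k" "2 * (\<rho> ^ k / (1 - \<rho>)) < e / 3" by (auto simp: eventually_sequentially)
    have \<rho>k: "2 * \<rho> ^ k \<le> 2 * (\<rho> ^ k / (1 - \<rho>))" using \<rho> by (simp add: pos_le_divide_eq mult_left_le)
    have "\<forall>\<^sub>F s in at t within UNIV. \<forall>i. \<bar>marginal_cdf i (s $ i) - marginal_cdf i (t $ i)\<bar> < 1 / 2 ^ k"
    proof (rule eventually_all_finite)
      fix i
      have "isCont (marginal_cdf i) (t $ i)" using marginal_cdf_continuous[of i] by (simp add: continuous_on_eq_continuous_at)
      then have "((\<lambda>s. marginal_cdf i (s $ i)) \<longlongrightarrow> marginal_cdf i (t $ i)) (at t within UNIV)"
        by (rule isCont_tendsto_compose) (intro tendsto_intros)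
      from tendstoD[OF this, of "1 / 2 ^ k"]
      show "\<forall>\<^sub>F s in at t within UNIV. \<bar>marginal_cdf i (s $ i) - marginal_cdf i (t $ i)\<bar> < 1 / 2 ^ k" by (simp add: dist_real_def)
    qed
    then show "\<forall>\<^sub>F s in at t within UNIV. dist (W w s) (W w t) < e"
    proof eventually_elim
      case (elim s)
      have nb: "grid_index k s i \<le> grid_index k t i + 2" "grid_index k t i \<le> grid_index k s i + 2" for i
      proof -
        have "\<bar>marginal_cdf i (s $ i) - marginal_cdf i (t $ i)\<bar> * 2 ^ k < 1" using elim[rule_format, of i] by (simp add: pos_less_divide_eq)
        then have "\<bar>2 ^ k * marginal_cdf i (s $ i) - 2 ^ k * marginal_cdf i (t $ i)\<bar> < 1"
          by (simp add: right_diff_distrib[symmetric] abs_mult mult.commute)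
        then have "real (grid_index k s i) < real (grid_index k t i + 2)" "real (grid_index k t i) < real (grid_index k s i + 2)"
          using grid_index_bounds(1)[of k s i] grid_index_bounds(2)[of k i s] grid_index_bounds(1)[of k t i] grid_index_bounds(2)[of k i t]
          unfolding of_nat_add of_nat_numeral by linarith+
        then show "grid_index k s i \<le> grid_index k t i + 2" "grid_index k t i \<le> grid_index k s i + 2" by linarith+
      qed
      have "((k, grid_index k s), (k, grid_index k t)) \<in> links k" by (rule links_neighbour[OF grid_index_index_box grid_index_index_box]) (rule nb)+
      then have "\<bar>Z (k, grid_index k s) w - Z (k, grid_index k t) w\<bar> \<le> 2 * \<rho> ^ k" using L1[OF k(1)] by fastforce
      then show ?case using L2[OF k(2), of s] L2[OF k(2), of t] k(3) \<rho>k unfolding dist_real_def by linarith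
    qed
  qed
qed

section \<open>The law of the limit process\<close>

definition continuous_funs :: "(ereal^'d \<Rightarrow> real) set" where
  "continuous_funs = {x. continuous_on UNIV x}"

text \<open>The law of \<open>W\<close> lives on the continuous functions and carries the largest \<open>\<sigma>\<close>-algebra for which
  \<open>W\<close> is measurable, so functionals are measurable as soon as their composition with \<open>W\<close> is.\<close>

definition W_sets :: "(ereal^'d \<Rightarrow> real) set set" where
  "W_sets = {S. S \<subseteq> continuous_funs \<and> W -` S \<inter> space gauss_seq \<in> sets gauss_seq}"

definition law :: "(ereal^'d \<Rightarrow> real) measure" where
  "law = distr gauss_seq (sigma continuous_funs W_sets) W"

lemma W_sets_Pow: "W_sets \<subseteq> Pow continuous_funs" by (auto simp: W_sets_def)

lemma W_in_sigma [measurable]: "W \<in> measurable gauss_seq (sigma continuous_funs W_sets)"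
  by (rule measurable_measure_of[OF W_sets_Pow]) (auto simp: W_sets_def continuous_funs_def W_continuous)

lemma space_law: "space law = continuous_funs"
  by (simp add: law_def space_measure_of[OF W_sets_Pow])

lemma law_measurableI:
  fixes h :: "(ereal^'d \<Rightarrow> real) \<Rightarrow> real"
  assumes "(\<lambda>w. h (W w)) \<in> borel_measurable gauss_seq"
  shows "h \<in> borel_measurable (sigma continuous_funs W_sets)"
proof (rule measurableI)
  fix S :: "real set" assume S: "S \<in> sets borel"
  have "W -` (h -` S \<inter> continuous_funs) \<inter> space gauss_seq = (\<lambda>w. h (W w)) -` S \<inter> space gauss_seq"
    by (auto simp: continuous_funs_def W_continuous)
  also have "\<dots> \<in> sets gauss_seq" by (rule measurable_sets[OF assms S])
  finally have "h -` S \<inter> continuous_funs \<in> W_sets" by (simp add: W_sets_def)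
  then show "h -` S \<inter> space (sigma continuous_funs W_sets) \<in> sets (sigma continuous_funs W_sets)"
    by (simp add: space_measure_of[OF W_sets_Pow] sets_measure_of[OF W_sets_Pow])
qed simp

lemma law_integral:
  fixes h :: "(ereal^'d \<Rightarrow> real) \<Rightarrow> real"
  assumes "(\<lambda>w. h (W w)) \<in> borel_measurable gauss_seq"
  shows "h \<in> borel_measurable law" "(LINT x|law. h x) = (LINT w|gauss_seq. h (W w))"
  using law_measurableI[OF assms] unfolding law_def by (simp_all add: integral_distr)

text \<open>A linear combination of path values is an almost sure limit of linear combinations of
  the Gaussian family, so \<open>gaussian_limit\<close> applies.\<close>

lemma law_gaussian: "centered_gaussian_law law"
  unfolding centered_gaussian_law_def Let_def
proof (intro conjI allI impI)
  show "prob_space law" unfolding law_def by (rule gauss_seq.P.prob_space_distr) measurable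
  fix T :: "(ereal^'d) set" and c :: "ereal^'d \<Rightarrow> real" assume T: "finite T"
  define Y where "Y = (\<lambda>x::ereal^'d \<Rightarrow> real. \<Sum>t\<in>T. c t * x t)"
  have YW[measurable]: "(\<lambda>w. Y (W w)) \<in> borel_measurable gauss_seq" unfolding Y_def by measurable
  note [measurable] = law_measurableI[OF YW]
  show "(\<lambda>w. \<Sum>t\<in>T. c t * w t) \<in> borel_measurable law" using law_integral(1)[OF YW] by (simp add: Y_def)
  define g where "g = (\<lambda>k t. to_nat (k, grid_index k t))"
  \<comment> \<open>Distinct points may fall into the same cell, so coefficients are collected per
    index before \<open>char_gaussian_family\<close> is used.\<close>
  define c' where "c' = (\<lambda>k i. \<Sum>t\<in>{t \<in> T. g k t = i}. c t)"
  define V where "V = (\<lambda>k w. \<Sum>t\<in>T. c t * Z (k, grid_index k t) w)"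
  have V: "V k w = (\<Sum>i\<in>g k ` T. c' k i * gaussian_family K i w)" for k w
  proof -
    have "V k w = (\<Sum>i\<in>g k ` T. \<Sum>t\<in>{t \<in> T. g k t = i}. c t * Z (k, grid_index k t) w)"
      unfolding V_def by (rule sum.image_gen[OF T])
    also have "\<dots> = (\<Sum>i\<in>g k ` T. c' k i * gaussian_family K i w)"
      unfolding c'_def sum_distrib_right by (intro sum.cong refl) (auto simp: Z_def g_def)
    finally show ?thesis .
  qed
  define s where "s = (\<lambda>k. \<Sum>a\<in>g k ` T. \<Sum>b\<in>g k ` T. c' k a * c' k b * K a b)"
  have "(AE w in gauss_seq. Y (W w) = 0) \<or> (\<exists>\<sigma>>0. distributed gauss_seq lborel (\<lambda>w. Y (W w)) (\<lambda>x. ennreal (normal_density 0 \<sigma> x)))"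
  proof (rule gauss_seq.P.gaussian_limit[where V = V and s = s])
    show "V k \<in> borel_measurable gauss_seq" for k unfolding V_def by measurable
    show "char (distr gauss_seq borel (V k)) t = exp (- (t\<^sup>2 * s k) / 2)" for k t
    proof -
      have "V k = (\<lambda>w. \<Sum>i\<in>g k ` T. c' k i * gaussian_family K i w)" using V by (simp add: fun_eq_iff)
      then show ?thesis using char_gaussian_family[OF K_psd finite_imageI[OF T], of "c' k" "g k" t] by (simp add: s_def)
    qed
    show "0 \<le> s k" for k unfolding s_def by (rule psd_kernel_sum_nonneg[OF K_psd finite_imageI[OF T]])
    show "AE w in gauss_seq. (\<lambda>k. V k w) \<longlonglongrightarrow> Y (W w)"
      using AE_good
    proof eventually_elim
      case (elim w)
      show ?case unfolding V_def Y_def by (intro tendsto_intros W_approximation(2) elim)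
    qed
  qed (rule YW)
  then show "(AE w in law. (\<Sum>t\<in>T. c t * w t) = 0) \<or>
    (\<exists>\<sigma>>0. distributed law lborel (\<lambda>w. \<Sum>t\<in>T. c t * w t) (\<lambda>x. ennreal (normal_density 0 \<sigma> x)))"
  proof
    assume a: "AE w in gauss_seq. Y (W w) = 0"
    have "AE x in law. Y x = 0" unfolding law_def by (subst AE_distr_iff) (use a in auto)
    then show ?thesis by (simp add: Y_def)
  next
    assume "\<exists>\<sigma>>0. distributed gauss_seq lborel (\<lambda>w. Y (W w)) (\<lambda>x. ennreal (normal_density 0 \<sigma> x))"
    then obtain \<sigma> where \<sigma>: "0 < \<sigma>" "distributed gauss_seq lborel (\<lambda>w. Y (W w)) (\<lambda>x. ennreal (normal_density 0 \<sigma> x))" by blast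
    have "distr law lborel Y = distr gauss_seq lborel (\<lambda>w. Y (W w))"
      unfolding law_def by (subst distr_distr) (simp_all add: comp_def)
    then have "distributed law lborel Y (\<lambda>x. ennreal (normal_density 0 \<sigma> x))"
      using \<sigma>(2) law_integral(1)[OF YW] by (simp add: distributed_def)
    then show ?thesis using \<sigma>(1) unfolding Y_def by blast
  qed
qed

end

section \<open>Convergence in distribution\<close>

context empirical_chain
begin

lemma W_Dspace: "W w \<in> Dspace"
  by (rule Dspace_continuous[OF W_continuous])

text \<open>From h(W) to h(U_n): the envelope with m large, a step function of level k, the limit in
  n for finitely many sums, and \<open>tight\<close> through the Lipschitz property. The last
  passage uses that the envelope lies below \<open>h\<close>, which makes the estimate
  one-sided.\<close>

lemma law_lower_bound:
  assumes hB: "\<And>y. y \<in> Dspace \<Longrightarrow> \<bar>h y\<bar> \<le> B" and hc: "D_continuous h"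
  shows "(\<lambda>w. h (W w)) \<in> borel_measurable gauss_seq"
    and "0 < e \<Longrightarrow> \<forall>\<^sub>F n in sequentially.
      (LINT w|gauss_seq. h (W w)) - e \<le> (LINT \<omega>|M. h (empirical_process M X n \<omega>))"
proof -
  define stp where "stp = (\<lambda>k (y :: nat \<Rightarrow> real) (t :: ereal^'d). y (to_nat (k, grid_index k t)))"
  define H where "H = (\<lambda>m k y. envelope B h (real m) (stp k y))"
  define GZ where "GZ = (\<lambda>w i. gaussian_family K i w)"
  have stp_GZ: "stp k (GZ w) t = Z (k, grid_index k t) w" for k w t by (simp add: stp_def GZ_def Z_def)
  have dist_stp: "\<bar>stp k y t - stp k y' t\<bar> \<le> (\<Sum>j\<in>index_box (2 ^ k). \<bar>y (to_nat (k, j)) - y' (to_nat (k, j))\<bar>)" for k y y' t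
    unfolding stp_def by (rule member_le_sum[OF grid_index_index_box]) (use index_box in auto)
  have ne: "majorants h m (stp k y) \<noteq> {}" for m k y
  proof (rule majorants_nonempty_bounded)
    show "\<bar>stp k y t\<bar> \<le> (\<Sum>j\<in>index_box (2 ^ k). \<bar>y (to_nat (k, j)) - 0\<bar>)" for t
      using dist_stp[of k y t "\<lambda>_. 0"] by (simp add: stp_def)
  qed
  have H_bd: "\<bar>H m k y\<bar> \<le> B" for m k y
    unfolding H_def by (rule envelope_bounds[OF hB _ ne]) auto
  have neW: "majorants h m (W w) \<noteq> {}" for m w by (rule majorants_nonempty_D[OF W_Dspace])
  have W_bd: "\<bar>envelope B h (real m) (W w)\<bar> \<le> B" for m w
    by (rule envelope_bounds[OF hB _ neW]) auto
  have H_lip: "\<bar>H m k y - H m k y'\<bar> \<le> real m * (\<Sum>j\<in>index_box (2 ^ k). \<bar>y (to_nat (k, j)) - y' (to_nat (k, j))\<bar>)" for m k y y'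
  proof (rule abs_leI)
    show "H m k y - H m k y' \<le> real m * (\<Sum>j\<in>index_box (2 ^ k). \<bar>y (to_nat (k, j)) - y' (to_nat (k, j))\<bar>)"
      using envelope_lipschitz[OF hB of_nat_0_le_iff ne dist_stp, of m k y y'] unfolding H_def by simp
    show "- (H m k y - H m k y') \<le> real m * (\<Sum>j\<in>index_box (2 ^ k). \<bar>y (to_nat (k, j)) - y' (to_nat (k, j))\<bar>)"
      using envelope_lipschitz[OF hB of_nat_0_le_iff ne dist_stp, of m k y' y] unfolding H_def by (simp add: abs_minus_commute)
  qed
  have H_cont: "continuous_on UNIV (H m k)" for m k
    unfolding continuous_on_def
  proof
    fix y0 :: "nat \<Rightarrow> real"
    have c: "((\<lambda>y. y i) \<longlongrightarrow> y0 i) (at y0 within UNIV)" for i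
      using continuous_on_product_coordinates[of i] unfolding continuous_on_def by blast
    have "((\<lambda>y. real m * (\<Sum>j\<in>index_box (2 ^ k). \<bar>y (to_nat (k, j)) - y0 (to_nat (k, j))\<bar>))
        \<longlongrightarrow> real m * (\<Sum>j\<in>index_box (2 ^ k). \<bar>y0 (to_nat (k, j)) - y0 (to_nat (k, j))\<bar>)) (at y0 within UNIV)"
      by (intro tendsto_intros c)
    then have z: "((\<lambda>y. real m * (\<Sum>j\<in>index_box (2 ^ k). \<bar>y (to_nat (k, j)) - y0 (to_nat (k, j))\<bar>)) \<longlongrightarrow> 0) (at y0 within UNIV)" by simp
    have "((\<lambda>y. H m k y - H m k y0) \<longlongrightarrow> 0) (at y0 within UNIV)"
      by (rule Lim_null_comparison[OF always_eventually z]) (use H_lip in simp)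
    then show "(H m k \<longlongrightarrow> H m k y0) (at y0 within UNIV)" by (rule LIM_zero_cancel)
  qed
  have H_borel: "H m k \<in> borel_measurable borel" for m k
    by (rule borel_measurable_continuous_onI[OF H_cont])
  have GZ: "GZ \<in> borel_measurable gauss_seq"
    unfolding GZ_def by (rule measurable_coordinatewise_then_product) measurable
  have HZ[measurable]: "(\<lambda>w. H m k (GZ w)) \<in> borel_measurable gauss_seq" for m k
    by (rule measurable_compose[OF GZ H_borel])
  have Yv: "(\<lambda>\<omega> i. grid_sum n (from_nat i) \<omega>) \<in> borel_measurable M" for n
    by (rule measurable_coordinatewise_then_product) measurable
  have HY[measurable]: "(\<lambda>\<omega>. H m k (\<lambda>i. grid_sum n (from_nat i) \<omega>)) \<in> borel_measurable M" for m k n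
    by (rule measurable_compose[OF Yv H_borel])
  have lim_k: "(\<lambda>k. H m k (GZ w)) \<longlonglongrightarrow> envelope B h (real m) (W w)" if w: "w \<in> good" for m w
  proof -
    obtain L where "\<forall>k t. L \<le> k \<longrightarrow> \<bar>W w t - Z (k, grid_index k t) w\<bar> \<le> 2 * (\<rho> ^ k / (1 - \<rho>))"
      using W_approximation(1)[OF w] by (rule exE)
    note L = this[rule_format]
    have "\<bar>H m k (GZ w) - envelope B h (real m) (W w)\<bar> \<le> real m * (2 * (\<rho> ^ k / (1 - \<rho>)))" if k: "L \<le> k" for k
    proof (rule abs_leI)
      have d: "\<bar>W w t - stp k (GZ w) t\<bar> \<le> 2 * (\<rho> ^ k / (1 - \<rho>))" for t unfolding stp_GZ by (rule L[OF k])
      have d': "\<bar>stp k (GZ w) t - W w t\<bar> \<le> 2 * (\<rho> ^ k / (1 - \<rho>))" for t using d[of t] by (simp add: abs_minus_commute)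
      show "H m k (GZ w) - envelope B h (real m) (W w) \<le> real m * (2 * (\<rho> ^ k / (1 - \<rho>)))"
        using envelope_lipschitz[OF hB of_nat_0_le_iff neW d', of m] unfolding H_def by simp
      show "- (H m k (GZ w) - envelope B h (real m) (W w)) \<le> real m * (2 * (\<rho> ^ k / (1 - \<rho>)))"
        using envelope_lipschitz[OF hB of_nat_0_le_iff ne d, of m] unfolding H_def by simp
    qed
    then have ev: "\<forall>\<^sub>F k in sequentially. norm (H m k (GZ w) - envelope B h (real m) (W w)) \<le> real m * (2 * (\<rho> ^ k / (1 - \<rho>)))"
      unfolding eventually_sequentially real_norm_def by blast
    have "(\<lambda>k. real m * (2 * (\<rho> ^ k / (1 - \<rho>)))) \<longlonglongrightarrow> real m * (2 * (0 / (1 - \<rho>)))"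
      using \<rho> by (intro tendsto_intros LIMSEQ_power_zero) auto
    then have z: "(\<lambda>k. real m * (2 * (\<rho> ^ k / (1 - \<rho>)))) \<longlonglongrightarrow> 0" by (simp only: div_0 mult_zero_right)
    have "(\<lambda>k. H m k (GZ w) - envelope B h (real m) (W w)) \<longlonglongrightarrow> 0"
      by (rule Lim_null_comparison[OF ev z])
    then show ?thesis by (rule LIM_zero_cancel)
  qed
  have env_meas[measurable]: "(\<lambda>w. envelope B h (real m) (W w)) \<in> borel_measurable gauss_seq" for m
  proof (rule borel_measurable_LIMSEQ_metric)
    \<comment> \<open>Off \<open>good\<close> the path is 0; giving the approximants the matching
      constant there makes the limit hold everywhere.\<close>
    show "(\<lambda>w. if w \<in> good then H m k (GZ w) else envelope B h (real m) (\<lambda>t. 0)) \<in> borel_measurable gauss_seq" for k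
      by (intro measurable_If HZ borel_measurable_const) simp
    show "(\<lambda>k. if w \<in> good then H m k (GZ w) else envelope B h (real m) (\<lambda>t. 0)) \<longlonglongrightarrow> envelope B h (real m) (W w)" for w
    proof (cases "w \<in> good")
      case False
      then have "W w = (\<lambda>t. 0)" by (simp add: W_def fun_eq_iff)
      then show ?thesis using False by simp
    qed (simp add: lim_k)
  qed
  have lim_m: "(\<lambda>m. envelope B h (real m) (W w)) \<longlonglongrightarrow> h (W w)" for w
    by (rule envelope_convergence[OF hB hc W_Dspace])
  show hW[measurable]: "(\<lambda>w. h (W w)) \<in> borel_measurable gauss_seq"
    by (rule borel_measurable_LIMSEQ_metric[OF env_meas lim_m])
  have E1: "(\<lambda>m. LINT w|gauss_seq. envelope B h (real m) (W w)) \<longlonglongrightarrow> (LINT w|gauss_seq. h (W w))"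
    by (rule integral_dominated_convergence[where w = "\<lambda>_. B"]) (use lim_m W_bd in auto)
  have E2: "(\<lambda>k. LINT w|gauss_seq. H m k (GZ w)) \<longlonglongrightarrow> (LINT w|gauss_seq. envelope B h (real m) (W w))" for m
  proof (rule integral_dominated_convergence[where w = "\<lambda>_. B"])
    show "AE w in gauss_seq. (\<lambda>k. H m k (GZ w)) \<longlonglongrightarrow> envelope B h (real m) (W w)"
      using AE_good by eventually_elim (rule lim_k)
  qed (use H_bd in auto)
  have E3: "(\<lambda>n. LINT \<omega>|M. H m k (\<lambda>i. grid_sum n (from_nat i) \<omega>)) \<longlonglongrightarrow> (LINT w|gauss_seq. H m k (GZ w))" for m k
    unfolding GZ_def
  proof (rule limit_expectation[OF H_cont H_bd])
    show "finite ((\<lambda>j. to_nat (k, j)) ` index_box (2 ^ k))" using index_box by simp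
    show "H m k y = H m k (\<lambda>a. if a \<in> (\<lambda>j. to_nat (k, j)) ` index_box (2 ^ k) then y a else 0)" for y
    proof -
      have "stp k y = stp k (\<lambda>a. if a \<in> (\<lambda>j. to_nat (k, j)) ` index_box (2 ^ k) then y a else 0)"
        unfolding stp_def using grid_index_index_box by (auto simp: fun_eq_iff)
      then show ?thesis by (simp add: H_def)
    qed
  qed
  assume e: "0 < e"
  have B0: "0 \<le> B" using hB[OF W_Dspace[of undefined]] by linarith
  \<comment> \<open>Five errors of e/5: the envelope, the step function, the limit in n, the
    Lipschitz error m \<epsilon>, and the exceptional event with weight 2 B.\<close>
  have e5: "0 < e / 5" using e by simp
  obtain m where m: "(LINT w|gauss_seq. h (W w)) - e / 5 < (LINT w|gauss_seq. envelope B h (real m) (W w))"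
    using order_tendstoD(1)[OF E1, of "(LINT w|gauss_seq. h (W w)) - e / 5"] e5 by (auto simp: eventually_sequentially)
  have canc: "c * (e / 5 / c) = e / 5" if "0 < c" for c :: real using that by simp
  define \<epsilon> where "\<epsilon> = e / 5 / (real m + 1)"
  define \<eta> where "\<eta> = e / 5 / (2 * B + 1)"
  have \<epsilon>: "0 < \<epsilon>" "real m * \<epsilon> \<le> e / 5"
  proof -
    show 0: "0 < \<epsilon>" using e5 by (simp add: \<epsilon>_def)
    have "real m * \<epsilon> \<le> (real m + 1) * \<epsilon>" using 0 by (intro mult_right_mono) auto
    also have "\<dots> = e / 5" unfolding \<epsilon>_def by (rule canc) simp
    finally show "real m * \<epsilon> \<le> e / 5" .
  qed
  have \<eta>: "0 < \<eta>" "2 * B * \<eta> \<le> e / 5"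
  proof -
    show 0: "0 < \<eta>" using e5 B0 by (simp add: \<eta>_def)
    have "2 * B * \<eta> \<le> (2 * B + 1) * \<eta>" using 0 by (intro mult_right_mono) auto
    also have "\<dots> = e / 5" unfolding \<eta>_def by (rule canc) (use B0 in simp)
    finally show "2 * B * \<eta> \<le> e / 5" .
  qed
  have "\<forall>\<^sub>F k in sequentially. (LINT w|gauss_seq. envelope B h (real m) (W w)) - e / 5 < (LINT w|gauss_seq. H m k (GZ w))"
    by (rule order_tendstoD(1)[OF E2]) (use e5 in simp)
  with tight[OF \<epsilon>(1) \<eta>(1)]
  have "\<forall>\<^sub>F k in sequentially. (\<forall>\<^sub>F n in sequentially. \<exists>S\<in>sets M. prob S \<le> \<eta> \<and>
     (\<forall>\<omega>\<in>space M - S. \<forall>t. \<bar>empirical_process M X n \<omega> t - grid_sum n (k, grid_index k t) \<omega>\<bar> \<le> \<epsilon>)) \<and>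
     (LINT w|gauss_seq. envelope B h (real m) (W w)) - e / 5 < (LINT w|gauss_seq. H m k (GZ w))"
    by (rule eventually_conj)
  then obtain k where k1: "\<forall>\<^sub>F n in sequentially. \<exists>S\<in>sets M. prob S \<le> \<eta> \<and>
     (\<forall>\<omega>\<in>space M - S. \<forall>t. \<bar>empirical_process M X n \<omega> t - grid_sum n (k, grid_index k t) \<omega>\<bar> \<le> \<epsilon>)"
    and k2: "(LINT w|gauss_seq. envelope B h (real m) (W w)) - e / 5 < (LINT w|gauss_seq. H m k (GZ w))"
    unfolding eventually_sequentially by blast
  have "\<forall>\<^sub>F n in sequentially. (LINT w|gauss_seq. H m k (GZ w)) - e / 5 < (LINT \<omega>|M. H m k (\<lambda>i. grid_sum n (from_nat i) \<omega>))"
    by (rule order_tendstoD(1)[OF E3]) (use e5 in simp)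
  with k1 show "\<forall>\<^sub>F n in sequentially. (LINT w|gauss_seq. h (W w)) - e \<le> (LINT \<omega>|M. h (empirical_process M X n \<omega>))"
  proof eventually_elim
    case (elim n)
    obtain S where S: "S \<in> sets M" "prob S \<le> \<eta>"
      "\<And>\<omega> t. \<omega> \<in> space M - S \<Longrightarrow> \<bar>empirical_process M X n \<omega> t - grid_sum n (k, grid_index k t) \<omega>\<bar> \<le> \<epsilon>"
      using elim(1) by (elim bexE conjE) blast
    define HY where "HY = (\<lambda>\<omega>. H m k (\<lambda>i. grid_sum n (from_nat i) \<omega>))"
    have UD: "empirical_process M X n \<omega> \<in> Dspace" for \<omega> unfolding empirical_process_empirical_fun by (rule empirical_fun_Dspace)
    have pw: "HY \<omega> - real m * \<epsilon> - 2 * B * indicator S \<omega> \<le> h (empirical_process M X n \<omega>)" if "\<omega> \<in> space M" for \<omega>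
    proof (cases "\<omega> \<in> S")
      case True
      have "\<bar>HY \<omega>\<bar> \<le> B" unfolding HY_def by (rule H_bd)
      moreover have "0 \<le> real m * \<epsilon>" using \<epsilon> by simp
      ultimately show ?thesis using True hB[OF UD, of \<omega>] by simp
    next
      case False
      have d: "\<bar>stp k (\<lambda>i. grid_sum n (from_nat i) \<omega>) t - empirical_process M X n \<omega> t\<bar> \<le> \<epsilon>" for t
        using S(3)[of \<omega> t] that False by (simp add: stp_def abs_minus_commute)
      have "envelope B h (real m) (stp k (\<lambda>i. grid_sum n (from_nat i) \<omega>)) \<le> envelope B h (real m) (empirical_process M X n \<omega>) + real m * \<epsilon>"
        by (rule envelope_lipschitz[OF hB of_nat_0_le_iff majorants_nonempty_D[OF UD] d])
      then have "HY \<omega> \<le> envelope B h (real m) (empirical_process M X n \<omega>) + real m * \<epsilon>"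
        unfolding HY_def H_def by simp
      moreover have "envelope B h (real m) (empirical_process M X n \<omega>) \<le> h (empirical_process M X n \<omega>)"
        by (rule envelope_le[OF hB of_nat_0_le_iff UD])
      ultimately show ?thesis using False by simp
    qed
    have iHY: "integrable M HY"
      by (rule integrable_const_bound[of _ B]) (use H_bd in \<open>auto simp: HY_def\<close>)
    have iS: "integrable M (indicator S :: 'a \<Rightarrow> real)" by (rule integrable_const_bound[of _ 1]) (use S in auto)
    have iL: "integrable M (\<lambda>\<omega>. HY \<omega> - real m * \<epsilon> - 2 * B * indicator S \<omega>)"
      by (intro Bochner_Integration.integrable_diff iHY integrable_const integrable_mult_right iS)
    have ih: "integrable M (\<lambda>\<omega>. h (empirical_process M X n \<omega>))"
      by (rule integrable_const_bound[of _ B]) (use hB UD empirical_process_measurable[OF hc] in auto)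
    have "(LINT \<omega>|M. HY \<omega> - real m * \<epsilon> - 2 * B * indicator S \<omega>) = (LINT \<omega>|M. HY \<omega>) - real m * \<epsilon> - 2 * B * prob S"
    proof -
      have i1: "integrable M (\<lambda>\<omega>. HY \<omega> - real m * \<epsilon>)"
        by (intro Bochner_Integration.integrable_diff iHY integrable_const)
      have i2: "integrable M (\<lambda>\<omega>. 2 * B * indicator S \<omega>)" by (intro integrable_mult_right iS)
      show ?thesis
        unfolding Bochner_Integration.integral_diff[OF i1 i2] Bochner_Integration.integral_diff[OF iHY integrable_const]
        using S(1) by (simp add: prob_space)
    qed
    moreover have "(LINT \<omega>|M. HY \<omega> - real m * \<epsilon> - 2 * B * indicator S \<omega>) \<le> (LINT \<omega>|M. h (empirical_process M X n \<omega>))"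
      by (rule integral_mono[OF iL ih pw])
    moreover have "2 * B * prob S \<le> 2 * B * \<eta>" using S(2) B0 by (intro mult_left_mono) auto
    moreover have "(LINT w|gauss_seq. H m k (GZ w)) - e / 5 < (LINT \<omega>|M. HY \<omega>)" using elim(2) by (simp add: HY_def)
    ultimately show ?case using m k2 \<epsilon>(2) \<eta>(2) by linarith
  qed
qed

lemma law_convergence: "converges_in_distribution_D M (empirical_process M X) law"
  unfolding converges_in_distribution_D_def
proof (intro conjI allI impI ballI)
  show "empirical_process M X n \<omega> \<in> Dspace" for n \<omega> unfolding empirical_process_empirical_fun by (rule empirical_fun_Dspace)
  show "AE x in law. x \<in> Dspace"
    by (rule AE_I2) (simp add: space_law continuous_funs_def Dspace_continuous)
  fix h :: "(ereal^'d \<Rightarrow> real) \<Rightarrow> real" assume "D_bounded h \<and> D_continuous h"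
  then obtain B where hB: "\<And>y. y \<in> Dspace \<Longrightarrow> \<bar>h y\<bar> \<le> B" and hc: "D_continuous h" unfolding D_bounded_def by blast
  \<comment> \<open>The lower bound for -h is the missing upper bound for h.\<close>
  have hB': "\<And>y. y \<in> Dspace \<Longrightarrow> \<bar>- h y\<bar> \<le> B" using hB by simp
  have hc': "D_continuous (\<lambda>x. - h x)"
    using hc unfolding D_continuous_def by (simp add: abs_minus_commute)
  have hW: "(\<lambda>w. h (W w)) \<in> borel_measurable gauss_seq" by (rule law_lower_bound(1)[OF hB hc])
  show "h \<in> borel_measurable law" by (rule law_integral(1)[OF hW])
  show "(\<lambda>n. LINT \<omega>|M. h (empirical_process M X n \<omega>)) \<longlonglongrightarrow> (LINT x|law. h x)"
    unfolding law_integral(2)[OF hW]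
  proof (rule tendstoI)
    fix e :: real assume "0 < e"
    then have e2: "0 < e / 2" by simp
    have "\<forall>\<^sub>F n in sequentially. (LINT w|gauss_seq. h (W w)) - e / 2 \<le> (LINT \<omega>|M. h (empirical_process M X n \<omega>))"
      by (rule law_lower_bound(2)[OF hB hc e2])
    moreover have "\<forall>\<^sub>F n in sequentially. (LINT w|gauss_seq. - h (W w)) - e / 2 \<le> (LINT \<omega>|M. - h (empirical_process M X n \<omega>))"
      by (rule law_lower_bound(2)[OF hB' hc' e2])
    ultimately show "\<forall>\<^sub>F n in sequentially. dist (LINT \<omega>|M. h (empirical_process M X n \<omega>)) (LINT w|gauss_seq. h (W w)) < e"
    proof eventually_elim
      case (elim n)
      have "(LINT \<omega>|M. h (empirical_process M X n \<omega>)) \<le> (LINT w|gauss_seq. h (W w)) + e / 2"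
        using elim(2) by simp
      then show ?case using elim(1) \<open>0 < e\<close> unfolding dist_real_def by linarith
    qed
  qed
qed

end

context empirical_setting
begin

theorem empirical_clt:
  "\<exists>N :: (ereal^'d \<Rightarrow> real) measure. centered_gaussian_law N \<and> (AE w in N. continuous_on UNIV w) \<and>
     converges_in_distribution_D M (empirical_process M X) N"
proof -
  obtain A l0 \<rho> \<sigma> where 1: "0 < A" "0 < \<rho>" "\<rho> < 1" "0 < \<sigma>" "\<sigma> < 1"
    "\<forall>l n c. l0 \<le> l \<longrightarrow> 1 \<le> n \<longrightarrow> 1 \<le> c \<longrightarrow> 4 ^ l \<le> c * real n \<longrightarrow> prob (bad n l (\<rho> ^ l)) \<le> A * c ^ p * \<sigma> ^ l"
    using prob_bad_geometric by (elim exE conjE) (rule that)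
  obtain K where 2: "psd_kernel K" "\<forall>A c t. finite A \<longrightarrow>
     (\<lambda>n. char (distr M borel (\<lambda>\<omega>. \<Sum>m\<in>A. c m * grid_sum n (from_nat m) \<omega>)) t)
        \<longlonglongrightarrow> exp (- (t\<^sup>2 * (\<Sum>a\<in>A. \<Sum>b\<in>A. c a * c b * K a b)) / 2)"
    using limit_kernel by (elim exE conjE) (rule that)
  interpret empirical_chain M X G normG \<Psi> C r p \<gamma> \<Phi> A l0 \<rho> \<sigma> K
    by unfold_locales (use 1 2 in auto)
  have "AE w in law. continuous_on UNIV w" by (rule AE_I2) (simp add: space_law continuous_funs_def)
  then show ?thesis using law_gaussian law_convergence by blast
qed

end

theorem theorem1:
  fixes M :: "'a measure" and X :: "nat \<Rightarrow> 'a \<Rightarrow> real^'d"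
    and G :: "(real^'d \<Rightarrow> real) set" and normG :: "(real^'d \<Rightarrow> real) \<Rightarrow> real"
    and \<Psi> :: "real \<Rightarrow> real"
  assumes M: "prob_space M"
    and X_meas: "\<And>i. X i \<in> borel_measurable M"
    and stat: "stationary M X"
    and F_cont: "continuous_on UNIV (\<lambda>t::real^'d. measure M {\<omega> \<in> space M. \<forall>j. X 0 \<omega> $ j \<le> t $ j})"
    and G_meas: "G \<subseteq> borel_measurable borel"
    and G_add: "\<And>f g. f \<in> G \<Longrightarrow> g \<in> G \<Longrightarrow> (\<lambda>x. f x + g x) \<in> G"
    and G_scale: "\<And>f c. f \<in> G \<Longrightarrow> (\<lambda>x. c * f x) \<in> G"
    and G_const: "\<And>c. (\<lambda>x. c) \<in> G"
    and normG_nonneg: "\<And>f. f \<in> G \<Longrightarrow> normG f \<ge> 0"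
    and normG_scale: "\<And>f c. f \<in> G \<Longrightarrow> normG (\<lambda>x. c * f x) = \<bar>c\<bar> * normG f"
    and normG_triangle: "\<And>f g. f \<in> G \<Longrightarrow> g \<in> G \<Longrightarrow> normG (\<lambda>x. f x + g x) \<le> normG f + normG g"
    and clt: "\<And>f. f \<in> G \<Longrightarrow> (\<exists>B. \<forall>x. \<bar>f x\<bar> \<le> B) \<Longrightarrow> (LINT \<omega>|M. f (X 0 \<omega>)) = 0 \<Longrightarrow>
       \<exists>s2\<ge>0. weak_conv_m (\<lambda>n. distr M borel (\<lambda>\<omega>. (1 / sqrt n) * (\<Sum>i=1..n. f (X i \<omega>))))
                            (normal_law s2)"
    and approx: "control_function G normG (marginal_df M (X 0)) \<Psi>"
    and moment: "\<exists>(C::real) (r::real) (p::nat) (\<gamma>::nat \<Rightarrow> real) (\<Phi>::nat \<Rightarrow> real \<Rightarrow> real).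
       C > 0 \<and> r \<ge> 1 \<and> real p > r * real CARD('d) \<and>
       (\<forall>i\<in>{1..p}. 0 \<le> \<gamma> i \<and> \<gamma> i < real i / r + 2 * (real p - real i) - real CARD('d)) \<and>
       (\<forall>i\<in>{1..p}. mono_on {0..} (\<Phi> i) \<and> (\<forall>z\<ge>0. \<Phi> i z \<ge> 0)) \<and>
       (\<forall>i\<in>{1..p}. (\<lambda>z. \<Phi> i (2 * \<Psi> z)) \<in> O[at_top](\<lambda>z. z powr \<gamma> i)) \<and>
       (\<forall>f\<in>G. (\<forall>x. \<bar>f x\<bar> \<le> 1) \<longrightarrow> (\<forall>n\<ge>1.
          (let m = (LINT \<omega>|M. f (X 0 \<omega>)) in
           (LINT \<omega>|M. \<bar>\<Sum>i=1..n. f (X i \<omega>) - m\<bar> ^ (2 * p))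
             \<le> C * (\<Sum>i=1..p. real n ^ i
                   * ((LINT \<omega>|M. \<bar>f (X 0 \<omega>) - m\<bar> powr r) powr (1 / r)) ^ i
                   * \<Phi> i (normG (\<lambda>x. f x - m))))))"
  shows "\<exists>N :: (ereal^'d \<Rightarrow> real) measure.
           centered_gaussian_law N \<and>
           (AE w in N. continuous_on UNIV w) \<and>
           converges_in_distribution_D M (empirical_process M X) N"
proof -
  obtain C r :: real and p :: nat and \<gamma> :: "nat \<Rightarrow> real" and \<Phi> :: "nat \<Rightarrow> real \<Rightarrow> real" where
    "C > 0" "r \<ge> 1" "real p > r * real CARD('d)"
    and \<gamma>: "\<forall>i\<in>{1..p}. 0 \<le> \<gamma> i \<and> \<gamma> i < real i / r + 2 * (real p - real i) - real CARD('d)"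
    and \<Phi>: "\<forall>i\<in>{1..p}. mono_on {0..} (\<Phi> i) \<and> (\<forall>z\<ge>0. \<Phi> i z \<ge> 0)"
    and O: "\<forall>i\<in>{1..p}. (\<lambda>z. \<Phi> i (2 * \<Psi> z)) \<in> O[at_top](\<lambda>z. z powr \<gamma> i)"
    and mom: "\<forall>f\<in>G. (\<forall>x. \<bar>f x\<bar> \<le> 1) \<longrightarrow> (\<forall>n\<ge>1.
          (let m = (LINT \<omega>|M. f (X 0 \<omega>)) in
           (LINT \<omega>|M. \<bar>\<Sum>i=1..n. f (X i \<omega>) - m\<bar> ^ (2 * p))
             \<le> C * (\<Sum>i=1..p. real n ^ i
                   * ((LINT \<omega>|M. \<bar>f (X 0 \<omega>) - m\<bar> powr r) powr (1 / r)) ^ i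
                   * \<Phi> i (normG (\<lambda>x. f x - m)))))"
    using moment by (elim exE conjE) (rule that)
  interpret prob_space M by (rule M)
  interpret empirical_setting M X G normG \<Psi> C r p \<gamma> \<Phi>
  proof unfold_locales
    fix f and n :: nat assume "f \<in> G" "\<forall>x. \<bar>f x\<bar> \<le> 1" "1 \<le> n"
    then show "(LINT \<omega>|M. \<bar>\<Sum>i=1..n. f (X i \<omega>) - (LINT \<omega>|M. f (X 0 \<omega>))\<bar> ^ (2 * p))
             \<le> C * (\<Sum>i=1..p. real n ^ i
                   * ((LINT \<omega>|M. \<bar>f (X 0 \<omega>) - (LINT \<omega>|M. f (X 0 \<omega>))\<bar> powr r) powr (1 / r)) ^ i
                   * \<Phi> i (normG (\<lambda>x. f x - (LINT \<omega>|M. f (X 0 \<omega>)))))"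
      using mom unfolding Let_def by blast
  next
    show "\<And>f. f \<in> G \<Longrightarrow> (\<exists>B. \<forall>x. \<bar>f x\<bar> \<le> B) \<Longrightarrow> (LINT \<omega>|M. f (X 0 \<omega>)) = 0 \<Longrightarrow>
       \<exists>s2\<ge>0. weak_conv_m (\<lambda>n. distr M borel (\<lambda>\<omega>. (1 / sqrt n) * (\<Sum>i=1..n. f (X i \<omega>)))) (normal_law s2)"
      by (rule clt)
  qed (use X_meas F_cont G_meas G_add G_scale G_const normG_nonneg normG_scale
      normG_triangle approx \<open>C > 0\<close> \<open>r \<ge> 1\<close> \<open>real p > r * real CARD('d)\<close> \<gamma> \<Phi> O in auto)
  show ?thesis by (rule empirical_clt)
qed

end
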